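(* Let $X$ be a space with an involution $\tau$ and let $Y\subset X$ be a $\tau$-invariant subspace with $H^{odd}(X,Y)=0$. Let $(\kappa,\sigma)$ be an $H^*$-frame for $(X,Y)$ (so that $\tau$ is a conjugation on the pair $(X,Y)$). Then $\kappa\colon H^{2*}(X,Y)\to H^{*}(X^\tau,Y^\tau)$ and $\sigma\colon H^{2*}(X,Y)\to H^{2*}_C(X,Y)$ are ring homomorphisms.
   Context: $H^*$ denotes singular cohomology with $\mathbb{Z}_2$-coefficients. An involution $\tau$ on a space $X$ is a continuous action of the group $C=\{1,\tau\}$ of order $2$; $X^\tau$ is its fixed point set. A subspace $Y\subset X$ is $\tau$-invariant if $\tau(Y)=Y$; $Y^\tau=Y\cap X^\tau$. Equivariant cohomology is defined by the Borel construction: $H^*_C(X,Y)=H^*(EC\times_C X,EC\times_C Y)$. Write $H^*(BC)=\mathbb{Z}_2[u]$ with $\deg u=1$; since $C$ acts trivially on $X^\tau$, the Künneth formula identifies $H^*_C(X^\tau,Y^\tau)$ with the polynomial ring $H^*(X^\tau,Y^\tau)[u]$. Let $\rho\colon H^{2*}_C(X,Y)\to H^{2*}(X,Y)$ and $r\colon H^*_C(X,Y)\to H^*_C(X^\tau,Y^\tau)$ be the restriction homomorphisms. An $H^*$-frame for $(X,Y)$ is a pair $(\kappa,\sigma)$ where $\kappa\colon H^{2*}(X,Y)\to H^*(X^\tau,Y^\tau)$ is an additive isomorphism dividing degrees in half, $\sigma\colon H^{2*}(X,Y)\to H^{2*}_C(X,Y)$ is an additive (degree-preserving) section of $\rho$,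 and for all $m\in\mathbb{N}$ and all $a\in H^{2m}(X,Y)$ the conjugation equation $r\circ\sigma(a)=\kappa(a)u^m+\ell t_m$ holds, where $\ell t_m$ denotes some polynomial in the variable $u$ (with coefficients in $H^*(X^\tau,Y^\tau)$) of degree less than $m$. An involution admitting an $H^*$-frame is called a conjugation. *)

theory Defs
  imports "HOL-Homology.Homology" "HOL-Algebra.UnivPoly" "HOL-Algebra.QuotRing" "HOL-Library.Z2"
begin

section \<open>Singular cohomology of pairs with coefficients in the field of two elements\<close>

text \<open>
  A cochain is an element of the direct sum over all degrees \<open>n\<close> of the modules of functions
  from singular \<open>n\<close>-simplices to the two-element field. It is normalised to be zero on everything
  that is not a singular simplex of \<open>X\<close>. A relative cochain of \<open>(X, S)\<close> also vanishes on the
  simplices of \<open>S\<close>.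
\<close>

type_synonym 'a cochain = "nat \<Rightarrow> ((nat \<Rightarrow> real) \<Rightarrow> 'a) \<Rightarrow> bit"

definition cochains :: "'a topology \<Rightarrow> 'a set \<Rightarrow> 'a cochain set" where
  "cochains X S =
     {c. (\<forall>n s. c n s \<noteq> 0 \<longrightarrow> singular_simplex n X s \<and> \<not> singular_simplex n (subtopology X S) s)
       \<and> finite {n. c n \<noteq> (\<lambda>s. 0)}}"

definition coboundary :: "'a topology \<Rightarrow> 'a cochain \<Rightarrow> 'a cochain" where
  "coboundary X c = (\<lambda>n s.
     if 0 < n \<and> singular_simplex n X s then \<Sum>k\<le>n. c (n - 1) (singular_face n k s) else 0)"

definition front_face :: "nat \<Rightarrow> ((nat \<Rightarrow> real) \<Rightarrow> 'a) \<Rightarrow> (nat \<Rightarrow> real) \<Rightarrow> 'a" where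
  "front_face p s = restrict s (standard_simplex p)"

text \<open>The restriction of a \<open>(p + q)\<close>-simplex to the face spanned by the vertices \<open>p, \<dots>, p + q\<close>.\<close>

definition back_face :: "nat \<Rightarrow> nat \<Rightarrow> ((nat \<Rightarrow> real) \<Rightarrow> 'a) \<Rightarrow> (nat \<Rightarrow> real) \<Rightarrow> 'a" where
  "back_face p q s = restrict (\<lambda>x. s (\<lambda>i. if i < p then 0 else x (i - p))) (standard_simplex q)"

definition cup :: "'a topology \<Rightarrow> 'a cochain \<Rightarrow> 'a cochain \<Rightarrow> 'a cochain" where
  "cup X a b = (\<lambda>n s.
     if singular_simplex n X s
     then \<Sum>p\<le>n. a p (front_face p s) * b (n - p) (back_face p (n - p) s) else 0)"

text \<open>
  The field \<open>one\<close> is the unit cochain when \<open>S = {}\<close>. The relative cohomology ring has no unit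
  in general, and then this field is meaningless and is not used.
\<close>

definition cocycle_ring :: "'a topology \<Rightarrow> 'a set \<Rightarrow> 'a cochain ring" where
  "cocycle_ring X S =
     \<lparr>carrier = {c \<in> cochains X S. coboundary X c = (\<lambda>n s. 0)},
      mult = cup X,
      one = (\<lambda>n s. if n = 0 \<and> singular_simplex n X s \<and> \<not> singular_simplex n (subtopology X S) s
                   then 1 else 0),
      zero = (\<lambda>n s. 0),
      add = (\<lambda>a b n s. a n s + b n s)\<rparr>"

definition coboundaries :: "'a topology \<Rightarrow> 'a set \<Rightarrow> 'a cochain set" where
  "coboundaries X S = coboundary X ` cochains X S"

definition cohom_class :: "'a topology \<Rightarrow> 'a set \<Rightarrow> 'a cochain \<Rightarrow> 'a cochain set" where
  "cohom_class X S c = coboundaries X S +>\<^bsub>cocycle_ring X S\<^esub> c"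

definition cohom :: "'a topology \<Rightarrow> 'a set \<Rightarrow> 'a cochain set ring" where
  "cohom X S = cocycle_ring X S Quot coboundaries X S"

definition cohom_deg :: "'a topology \<Rightarrow> 'a set \<Rightarrow> nat \<Rightarrow> 'a cochain set set" where
  "cohom_deg X S n =
     cohom_class X S ` {c \<in> carrier (cocycle_ring X S). \<forall>k. k \<noteq> n \<longrightarrow> c k = (\<lambda>s. 0)}"

definition cohom_even :: "'a topology \<Rightarrow> 'a set \<Rightarrow> 'a cochain set ring" where
  "cohom_even X S = (cohom X S)\<lparr>carrier :=
     cohom_class X S ` {c \<in> carrier (cocycle_ring X S). \<forall>k. odd k \<longrightarrow> c k = (\<lambda>s. 0)}\<rparr>"

text \<open>
  The product of a class of \<open>(X, S)\<close> with an absolute class of \<open>X\<close>, which lies in the cohomology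
  of \<open>(X, S)\<close> because \<^const>\<open>cup\<close> is relative as soon as one factor is.
\<close>

definition cup_absolute ::
    "'a topology \<Rightarrow> 'a set \<Rightarrow> 'a cochain set \<Rightarrow> 'a cochain set \<Rightarrow> 'a cochain set" where
  "cup_absolute X S A B = rcoset_mult (cocycle_ring X S) (coboundaries X S) A B"

definition cochain_pullback :: "'a topology \<Rightarrow> ('a \<Rightarrow> 'b) \<Rightarrow> 'b cochain \<Rightarrow> 'a cochain" where
  "cochain_pullback X f c =
     (\<lambda>n s. if singular_simplex n X s then c n (simplex_map n f s) else 0)"

text \<open>The homomorphism induced by a map of pairs \<open>f\<close> whose source is \<open>(X, S)\<close>.\<close>

definition cohom_map :: "'a topology \<Rightarrow> 'a set \<Rightarrow> ('a \<Rightarrow> 'b) \<Rightarrow> 'b cochain set \<Rightarrow> 'a cochain set" where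
  "cohom_map X S f A = (\<Union>c\<in>A. cohom_class X S (cochain_pullback X f c))"

section \<open>The Borel construction\<close>

definition involution :: "'a topology \<Rightarrow> ('a \<Rightarrow> 'a) \<Rightarrow> bool" where
  "involution X \<tau> \<longleftrightarrow> continuous_map X X \<tau> \<and> (\<forall>x\<in>topspace X. \<tau> (\<tau> x) = x)"

definition fixed_set :: "'a topology \<Rightarrow> ('a \<Rightarrow> 'a) \<Rightarrow> 'a set" where
  "fixed_set X \<tau> = {x \<in> topspace X. \<tau> x = x}"

definition fixed_space :: "'a topology \<Rightarrow> ('a \<Rightarrow> 'a) \<Rightarrow> 'a topology" where
  "fixed_space X \<tau> = subtopology X (fixed_set X \<tau>)"

definition quotient_topology :: "'a topology \<Rightarrow> ('a \<Rightarrow> 'b) \<Rightarrow> 'b topology" where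
  "quotient_topology X q =
     topology (\<lambda>U. U \<subseteq> q ` topspace X \<and> openin X {x \<in> topspace X. q x \<in> U})"

lemma openin_quotient_topology:
  "openin (quotient_topology X q) U \<longleftrightarrow>
     U \<subseteq> q ` topspace X \<and> openin X {x \<in> topspace X. q x \<in> U}"
proof -
  have "istopology (\<lambda>U. U \<subseteq> q ` topspace X \<and> openin X {x \<in> topspace X. q x \<in> U})"
    unfolding istopology_def
  proof (intro conjI allI impI)
    fix U V
    assume "U \<subseteq> q ` topspace X \<and> openin X {x \<in> topspace X. q x \<in> U}"
      and "V \<subseteq> q ` topspace X \<and> openin X {x \<in> topspace X. q x \<in> V}"
    moreover have "{x \<in> topspace X. q x \<in> U \<inter> V} =
        {x \<in> topspace X. q x \<in> U} \<inter> {x \<in> topspace X. q x \<in> V}"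
      by blast
    ultimately show "U \<inter> V \<subseteq> q ` topspace X" "openin X {x \<in> topspace X. q x \<in> U \<inter> V}"
      by (blast, simp add: openin_Int)
  next
    fix \<U>
    assume *: "\<forall>K\<in>\<U>. K \<subseteq> q ` topspace X \<and> openin X {x \<in> topspace X. q x \<in> K}"
    then show "\<Union> \<U> \<subseteq> q ` topspace X"
      by blast
    have "{x \<in> topspace X. q x \<in> \<Union> \<U>} = (\<Union>K\<in>\<U>. {x \<in> topspace X. q x \<in> K})"
      by blast
    then show "openin X {x \<in> topspace X. q x \<in> \<Union> \<U>}"
      using * by auto
  qed
  then show ?thesis
    by (simp add: quotient_topology_def)
qed

lemma quotient_map_quotient_topology: "quotient_map X (quotient_topology X q) q"
proof -
  have "openin (quotient_topology X q) (q ` topspace X)"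
    by (auto simp: openin_quotient_topology intro: back_subst[where P="openin X"])
  then have "topspace (quotient_topology X q) = q ` topspace X"
    by (meson openin_quotient_topology openin_subset openin_topspace subset_antisym)
  then show ?thesis
    by (auto simp: quotient_map_def openin_quotient_topology)
qed

text \<open>
  \<open>EC\<close> is the infinite sphere of finitely supported sequences of Euclidean norm 1 with the antipodal
  action. On this sphere the product topology coincides with the norm topology; it is contractible,
  and up to rescaling coordinates it is Milnor's infinite join of copies of \<open>C\<close>.
\<close>

definition EC :: "(nat \<Rightarrow> real) topology" where
  "EC = subtopology (powertop_real UNIV)
          {e. finite {i. e i \<noteq> 0} \<and> (\<Sum>i | e i \<noteq> 0. (e i)\<^sup>2) = 1}"

definition antipode :: "(nat \<Rightarrow> real) \<Rightarrow> nat \<Rightarrow> real" where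
  "antipode e = (\<lambda>i. - e i)"

definition BC :: "(nat \<Rightarrow> real) set topology" where
  "BC = quotient_topology EC (\<lambda>e. {e, antipode e})"

definition borel_orbit :: "('a \<Rightarrow> 'a) \<Rightarrow> (nat \<Rightarrow> real) \<times> 'a \<Rightarrow> ((nat \<Rightarrow> real) \<times> 'a) set" where
  "borel_orbit \<tau> = (\<lambda>(e, x). {(e, x), (antipode e, \<tau> x)})"

definition borel_space :: "'a topology \<Rightarrow> ('a \<Rightarrow> 'a) \<Rightarrow> ((nat \<Rightarrow> real) \<times> 'a) set topology" where
  "borel_space X \<tau> = quotient_topology (prod_topology EC X) (borel_orbit \<tau>)"

definition borel_subset :: "('a \<Rightarrow> 'a) \<Rightarrow> 'a set \<Rightarrow> ((nat \<Rightarrow> real) \<times> 'a) set set" where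
  "borel_subset \<tau> Y = borel_orbit \<tau> ` (topspace EC \<times> Y)"

abbreviation equiv_cohom ::
    "'a topology \<Rightarrow> ('a \<Rightarrow> 'a) \<Rightarrow> 'a set \<Rightarrow> ((nat \<Rightarrow> real) \<times> 'a) set cochain set ring" where
  "equiv_cohom X \<tau> Y \<equiv> cohom (borel_space X \<tau>) (borel_subset \<tau> Y)"

abbreviation equiv_cohom_deg ::
    "'a topology \<Rightarrow> ('a \<Rightarrow> 'a) \<Rightarrow> 'a set \<Rightarrow> nat \<Rightarrow> ((nat \<Rightarrow> real) \<times> 'a) set cochain set set" where
  "equiv_cohom_deg X \<tau> Y \<equiv> cohom_deg (borel_space X \<tau>) (borel_subset \<tau> Y)"

abbreviation equiv_cohom_even ::
    "'a topology \<Rightarrow> ('a \<Rightarrow> 'a) \<Rightarrow> 'a set \<Rightarrow> ((nat \<Rightarrow> real) \<times> 'a) set cochain set ring" where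
  "equiv_cohom_even X \<tau> Y \<equiv> cohom_even (borel_space X \<tau>) (borel_subset \<tau> Y)"

abbreviation fixed_cohom :: "'a topology \<Rightarrow> ('a \<Rightarrow> 'a) \<Rightarrow> 'a set \<Rightarrow> 'a cochain set ring" where
  "fixed_cohom X \<tau> Y \<equiv> cohom (fixed_space X \<tau>) (Y \<inter> fixed_set X \<tau>)"

abbreviation fixed_cohom_deg ::
    "'a topology \<Rightarrow> ('a \<Rightarrow> 'a) \<Rightarrow> 'a set \<Rightarrow> nat \<Rightarrow> 'a cochain set set" where
  "fixed_cohom_deg X \<tau> Y \<equiv> cohom_deg (fixed_space X \<tau>) (Y \<inter> fixed_set X \<tau>)"

text \<open>
  \<open>\<rho>\<close> is induced by the fibre inclusion of \<open>X\<close> over a base point of \<open>EC\<close> (its choice is irrelevant,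
  as \<open>EC\<close> is path connected), and \<open>r\<close> by the inclusion of the fixed point set.
\<close>

definition rho_map :: "'a topology \<Rightarrow> ('a \<Rightarrow> 'a) \<Rightarrow> 'a set \<Rightarrow>
    ((nat \<Rightarrow> real) \<times> 'a) set cochain set \<Rightarrow> 'a cochain set" where
  "rho_map X \<tau> Y = cohom_map X Y (\<lambda>x. borel_orbit \<tau> ((\<lambda>i. if i = 0 then 1 else 0), x))"

definition r_map :: "'a topology \<Rightarrow> ('a \<Rightarrow> 'a) \<Rightarrow> 'a set \<Rightarrow>
    ((nat \<Rightarrow> real) \<times> 'a) set cochain set \<Rightarrow> ((nat \<Rightarrow> real) \<times> 'a) set cochain set" where
  "r_map X \<tau> Y =
     cohom_map (borel_space (fixed_space X \<tau>) \<tau>) (borel_subset \<tau> (Y \<inter> fixed_set X \<tau>)) id"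

text \<open>The generator \<open>u\<close> of the polynomial ring \<open>H\<^sup>*(BC)\<close>.\<close>

definition u_class :: "(nat \<Rightarrow> real) set cochain set" where
  "u_class = (THE u. u \<in> cohom_deg BC {} 1 \<and> u \<noteq> \<zero>\<^bsub>cohom BC {}\<^esub>)"

text \<open>
  For a trivial action on \<open>Z\<close> (with \<open>W \<subseteq> Z\<close>) the Borel construction is \<open>BC \<times> Z\<close>, with projections
  sending an orbit \<open>{(e, z), (- e, z)}\<close> to \<open>z\<close> and to \<open>{e, - e}\<close>. The Kunneth identification of
  \<open>H\<^sup>*(Z, W)[u]\<close> with the equivariant cohomology of \<open>(Z, W)\<close> sends the polynomial with coefficients
  \<open>P j\<close> to the sum of the cross products of \<open>u\<^sup>j\<close> and \<open>P j\<close>.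
\<close>

definition kunneth :: "'a topology \<Rightarrow> ('a \<Rightarrow> 'a) \<Rightarrow> 'a set \<Rightarrow> (nat \<Rightarrow> 'a cochain set) \<Rightarrow>
    ((nat \<Rightarrow> real) \<times> 'a) set cochain set" where
  "kunneth Z \<tau> W P =
     (let B = borel_space Z \<tau>; S = borel_subset \<tau> W in
      \<Oplus>\<^bsub>cohom B S\<^esub>j\<in>{j. coeff (UP (cohom Z W)) P j \<noteq> \<zero>\<^bsub>cohom Z W\<^esub>}.
        cup_absolute B S
          (cohom_map B S (\<lambda>A. the_elem (snd ` A)) (coeff (UP (cohom Z W)) P j))
          (cohom_map B {} (\<lambda>A. fst ` A) (u_class [^]\<^bsub>cohom BC {}\<^esub> j)))"

section \<open>Frames\<close>

text \<open>
  The last condition is the conjugation equation. The degree of the polynomial \<open>l\<close> is bounded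
  through its coefficients, because \<^const>\<open>deg\<close> gives the zero polynomial degree 0, and for
  \<open>m = 0\<close> the polynomial \<open>l\<close> must be zero.
\<close>

definition H_frame :: "'a topology \<Rightarrow> ('a \<Rightarrow> 'a) \<Rightarrow> 'a set \<Rightarrow>
    ('a cochain set \<Rightarrow> 'a cochain set) \<Rightarrow>
    ('a cochain set \<Rightarrow> ((nat \<Rightarrow> real) \<times> 'a) set cochain set) \<Rightarrow> bool" where
  "H_frame X \<tau> Y \<kappa> \<sigma> \<longleftrightarrow>
     \<kappa> \<in> iso (add_monoid (cohom_even X Y)) (add_monoid (fixed_cohom X \<tau> Y)) \<and>
     (\<forall>m. \<kappa> ` cohom_deg X Y (2 * m) \<subseteq> fixed_cohom_deg X \<tau> Y m) \<and>
     \<sigma> \<in> hom (add_monoid (cohom_even X Y)) (add_monoid (equiv_cohom_even X \<tau> Y)) \<and>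
     (\<forall>m. \<sigma> ` cohom_deg X Y (2 * m) \<subseteq> equiv_cohom_deg X \<tau> Y (2 * m)) \<and>
     (\<forall>a \<in> carrier (cohom_even X Y). rho_map X \<tau> Y (\<sigma> a) = a) \<and>
     (\<forall>m. \<forall>a \<in> cohom_deg X Y (2 * m).
        \<exists>l \<in> carrier (UP (fixed_cohom X \<tau> Y)).
          (\<forall>j\<ge>m. coeff (UP (fixed_cohom X \<tau> Y)) l j = \<zero>\<^bsub>fixed_cohom X \<tau> Y\<^esub>) \<and>
          r_map X \<tau> Y (\<sigma> a) =
            kunneth (fixed_space X \<tau>) \<tau> (Y \<inter> fixed_set X \<tau>)
              (monom (UP (fixed_cohom X \<tau> Y)) (\<kappa> a) m \<oplus>\<^bsub>UP (fixed_cohom X \<tau> Y)\<^esub> l))"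

text \<open>
  Homomorphisms of rings that need not have a unit; \<^const>\<open>ring_hom\<close> also requires
  preservation of the unit.
\<close>

definition rng_hom :: "('a, 'm) ring_scheme \<Rightarrow> ('b, 'n) ring_scheme \<Rightarrow> ('a \<Rightarrow> 'b) set" where
  "rng_hom R S = hom (add_monoid R) (add_monoid S) \<inter> hom R S"

end

theory Submission
  imports Defs "HOL-Library.Function_Algebras" "HOL-Analysis.Uniform_Limit"
begin

text \<open>
  All computations are made with cochains modulo coboundaries. The Borel construction is the base
  of the double cover \<open>EC \<times> X\<close>, whose transfer gives the Gysin sequence: a cocycle that becomes a
  coboundary on \<open>EC \<times> X\<close> is cohomologous to a multiple of the class \<open>w\<close> of the cover, and over a
  fixed space multiplication by \<open>w\<close> is injective. Since \<open>EC\<close> is contractible, the first condition is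
  the vanishing of \<open>\<rho>\<close>, and the class of \<open>BC\<close> is \<open>u\<close>.

  Let \<open>L m\<close> be the set of equivariant classes of the fixed point set that are polynomials in \<open>u\<close> of
  degree less than \<open>m\<close>. If a class \<open>D\<close> of degree \<open>2 * n\<close> satisfies \<open>\<rho> D = 0\<close> and \<open>r D \<in> L (n + 1)\<close>, then
  \<open>D\<close> can be divided by \<open>w\<close> twice, the second time because the odd cohomology vanishes, and the
  quotient lies over \<open>L (n - 1)\<close>; subtracting its value under \<open>\<sigma> \<circ> \<rho>\<close>, induction and the injectivity of
  \<open>\<kappa>\<close> show that \<open>D = 0\<close>. Applied to \<open>D = \<sigma> (a b) + \<sigma> a * \<sigma> b\<close> this makes \<open>\<sigma>\<close> multiplicative, and
  the comparison of leading coefficients makes \<open>\<kappa>\<close> multiplicative.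
\<close>

text \<open>Modulo 2 there are no signs, and two cochains agree as soon as their sum vanishes. The
  obstacle at cochain level is that the cup product does not commute; the only commutation used is
  that with powers of \<open>w\<close>, and the transfer provides it. The conjugation equation
  delivers the polynomials in \<open>u\<close>; what has to be shown is that their leading
  coefficients are determined. This comes from two facts: multiplication by \<open>w\<close> is
  injective over a fixed space, and restriction to a fibre kills \<open>w\<close> while it recovers
  a class pulled back from that space. The induction rests on a balance of degrees. The value of
  \<open>\<sigma>\<close> at a class a of degree 2k restricts to a polynomial with leading term
  \<open>\<kappa> a\<close> times u^k. Each division by \<open>w\<close> costs one degree and lowers
  the bound of the polynomial by one. The defect D of multiplicativity has degree 2n and only the
  bound n + 1, because the leading coefficients of its two summands are not yet known to agree. Two
  divisions reach degree 2k with k = n - 1 and the bound k, just below the exponent at which the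
  value under \<open>\<kappa>\<close> appears.\<close>

text \<open>These two rules would replace the ring operations of \<open>bit\<close> by bitwise ones.\<close>

declare add_bit_eq_xor [simp del] mult_bit_eq_and [simp del]

lemma bit_add_self [simp]: "x + x = (0::bit)"
  by (cases x) auto

lemma cochain_add_self [simp]: "c + c = (0::'a cochain)"
  by (simp add: fun_eq_iff)

lemma cochain_add_self_left [simp]: "c + (c + d) = (d::'a cochain)"
  by (simp flip: add.assoc)

lemma cochain_add_eq_0_iff: "c + d = 0 \<longleftrightarrow> c = (d::'a cochain)"
  by (metis cochain_add_self cochain_add_self_left add.right_neutral)

lemma zero_cochain_eq: "(\<lambda>n s. 0) = (0::'a cochain)" "(\<lambda>s. 0) = (0::'b \<Rightarrow> bit)"
  by (auto simp: fun_eq_iff)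

lemma additive_sum:
  fixes F :: "'b::comm_monoid_add \<Rightarrow> 'c::comm_monoid_add"
  assumes "\<And>a b. F (a + b) = F a + F b" "F 0 = 0"
  shows "F (\<Sum>i\<in>I. f i) = (\<Sum>i\<in>I. F (f i))"
  by (induction I rule: infinite_finite_induct) (auto simp: assms)

lemma sum_cochain_apply: "(\<Sum>i\<in>I. f i) n s = (\<Sum>i\<in>I. (f i :: 'a cochain) n s)"
  by (induction I rule: infinite_finite_induct) auto

text \<open>Kept apart from the field \<open>one\<close> of \<open>cocycle_ring\<close>, with which
  it agrees for the empty subspace, because it also multiplies relative cochains.\<close>

definition one_cochain :: "'a topology \<Rightarrow> 'a cochain" where
  "one_cochain X = (\<lambda>n s. if n = 0 \<and> singular_simplex n X s then 1 else 0)"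

section \<open>Cochains\<close>

text \<open>A simplex of \<open>X\<close> belongs to the subspace exactly when its image lies in
  \<open>S\<close>, and finitely many nonzero degrees amount to a bound \<open>N\<close>. Both forms
  pass easily through constructions on simplices.\<close>

lemma cochainsI:
  assumes "\<And>n s. \<not> singular_simplex n X s \<Longrightarrow> c n s = 0"
    and "\<And>n s. \<lbrakk>singular_simplex n X s; s ` standard_simplex n \<subseteq> S\<rbrakk> \<Longrightarrow> c n s = 0"
    and "\<And>n. N < n \<Longrightarrow> c n = 0"
  shows "c \<in> cochains X S"
proof -
  have "{n. c n \<noteq> (\<lambda>s. 0)} \<subseteq> {..N}"
    using assms(3) by (force simp: zero_cochain_eq intro: leI)
  then have "finite {n. c n \<noteq> (\<lambda>s. 0)}"
    by (rule finite_subset) simp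
  moreover have "singular_simplex n X s \<and> \<not> s ` standard_simplex n \<subseteq> S" if "c n s \<noteq> 0" for n s
    using assms(1)[of n s] assms(2)[of n s] that by metis
  ultimately show ?thesis
    unfolding cochains_def singular_simplex_subtopology by blast
qed

lemma cochainsD:
  assumes "c \<in> cochains X S"
  shows "\<not> singular_simplex n X s \<Longrightarrow> c n s = 0"
    and "s ` standard_simplex n \<subseteq> S \<Longrightarrow> c n s = 0"
  using assms unfolding cochains_def singular_simplex_subtopology by blast+

lemma cochains_bounded:
  assumes "c \<in> cochains X S"
  obtains N where "\<And>n. N < n \<Longrightarrow> c n = 0"
proof -
  have "finite {n. c n \<noteq> 0}"
    using assms by (simp add: cochains_def zero_fun_def)
  then obtain N where "\<forall>n\<in>{n. c n \<noteq> 0}. n \<le> N"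
    using finite_nat_set_iff_bounded_le by auto
  then show ?thesis
    using that by (metis mem_Collect_eq not_le)
qed

lemma cochains_zero [simp]: "0 \<in> cochains X S"
  by (rule cochainsI[where N=0]) auto

lemma cochains_add [simp]:
  assumes "a \<in> cochains X S" "b \<in> cochains X S"
  shows "a + b \<in> cochains X S"
proof -
  obtain M N where "\<And>n. M < n \<Longrightarrow> a n = 0" "\<And>n. N < n \<Longrightarrow> b n = 0"
    using assms by (metis cochains_bounded)
  then show ?thesis
    using assms by (intro cochainsI[where N="max M N"]) (auto simp: cochainsD)
qed

lemma cochains_mono: "T \<subseteq> S \<Longrightarrow> cochains X S \<subseteq> cochains X T"
  by (auto simp: cochains_def dest: singular_simplex_mono)

lemma cochains_absolute: "c \<in> cochains X S \<Longrightarrow> c \<in> cochains X {}"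
  using cochains_mono by blast

lemma one_cochain_in_cochains [simp]: "one_cochain X \<in> cochains X {}"
  by (rule cochainsI[where N=0]) (auto simp: one_cochain_def nonempty_standard_simplex)

lemma singular_simplex_face:
  "\<lbrakk>singular_simplex (Suc n) X s; k \<le> Suc n\<rbrakk> \<Longrightarrow> singular_simplex n X (singular_face (Suc n) k s)"
  using singular_simplex_singular_face[of "Suc n"] by auto

lemma simplical_face_in:
  "\<lbrakk>k \<le> Suc n; x \<in> standard_simplex n\<rbrakk> \<Longrightarrow> simplical_face k x \<in> standard_simplex (Suc n)"
  using simplical_face_in_standard_simplex[of "Suc n"] by auto

lemma singular_face_image:
  "k \<le> Suc n \<Longrightarrow> singular_face (Suc n) k s ` standard_simplex n \<subseteq> s ` standard_simplex (Suc n)"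
  by (auto simp: singular_face_def simplical_face_in)

lemma coboundary_0 [simp]: "coboundary X c 0 = 0"
  by (simp add: coboundary_def fun_eq_iff)

lemma coboundary_Suc:
  "coboundary X c (Suc n) s =
     (if singular_simplex (Suc n) X s then \<Sum>k\<le>Suc n. c n (singular_face (Suc n) k s) else 0)"
  by (simp add: coboundary_def)

lemma coboundary_in_cochains [simp]:
  assumes "c \<in> cochains X S"
  shows "coboundary X c \<in> cochains X S"
proof -
  obtain N where N: "\<And>n. N < n \<Longrightarrow> c n = 0"
    using assms cochains_bounded by blast
  show ?thesis
  proof (rule cochainsI[where N="Suc N"])
    fix n s assume s: "singular_simplex n X s" "s ` standard_simplex n \<subseteq> S"
    show "coboundary X c n s = 0"
    proof (cases n)
      case (Suc m)
      have "c m (singular_face (Suc m) k s) = 0" if "k \<le> Suc m" for k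
        using singular_face_image[OF that, of s] s(2) Suc
        by (intro cochainsD(2)[OF assms]) blast
      then show ?thesis
        by (auto simp: Suc coboundary_Suc simp del: sum.atMost_Suc)
    qed simp
  next
    fix n assume "Suc N < n"
    then show "coboundary X c n = 0"
      by (cases n) (auto simp: fun_eq_iff coboundary_Suc N)
  qed (auto simp: coboundary_def)
qed

lemma coboundary_add: "coboundary X (a + b) = coboundary X a + coboundary X b"
  by (auto simp: coboundary_def fun_eq_iff sum.distrib)

lemma coboundary_zero [simp]: "coboundary X 0 = 0"
  by (auto simp: coboundary_def fun_eq_iff)

lemma singular_face_alt:
  "singular_face (Suc n) k s = restrict (\<lambda>x. s (simplical_face k x)) (standard_simplex n)"
  by (auto simp: singular_face_def fun_eq_iff)

text \<open>The simplicial identity: two vertices may be deleted in either order, and the larger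
  index drops by one when the smaller vertex goes first.\<close>

lemma singular_face_face:
  assumes "j < k" "k \<le> Suc (Suc n)"
  shows "singular_face (Suc n) j (singular_face (Suc (Suc n)) k s)
       = singular_face (Suc n) (k - 1) (singular_face (Suc (Suc n)) j s)"
proof -
  have "simplical_face k (simplical_face j x) = simplical_face j (simplical_face (k - 1) x)"
    for x :: "nat \<Rightarrow> real"
    using assms by (auto simp: simplical_face_def fun_eq_iff)
  then show ?thesis
    using assms by (intro ext) (auto simp: singular_face_alt simplical_face_in)
qed

lemma coboundary_coboundary [simp]: "coboundary X (coboundary X c) = 0"
proof (intro ext)
  fix m s
  show "coboundary X (coboundary X c) m s = 0 m s"
  proof (cases "\<exists>n. m = Suc (Suc n) \<and> singular_simplex m X s")
    case False
    then consider "m = 0" | "m = Suc 0" | "\<not> singular_simplex m X s"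
      by (metis not0_implies_Suc)
    then show ?thesis
      by cases (auto simp: coboundary_def)
  next
    case True
    then obtain n where m: "m = Suc (Suc n)" and s: "singular_simplex (Suc (Suc n)) X s"
      by auto
    define f where "f = (\<lambda>(k, j). c n (singular_face (Suc n) j (singular_face (Suc (Suc n)) k s)))"
    let ?A = "{(k, j). j < k \<and> k \<le> Suc (Suc n)}" and ?B = "{(k, j). k \<le> j \<and> j \<le> Suc n}"
    have fin0: "finite ({..Suc (Suc n)} \<times> {..Suc n})"
      by (intro finite_cartesian_product finite_atMost)
    have "?A \<subseteq> {..Suc (Suc n)} \<times> {..Suc n}"
      by (intro subrelI) (simp del: sum.atMost_Suc)
    then have finA: "finite ?A"
      using fin0 finite_subset by blast
    have "?B \<subseteq> {..Suc (Suc n)} \<times> {..Suc n}"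
      by (intro subrelI) simp
    then have finB: "finite ?B"
      using fin0 finite_subset by blast
    have "coboundary X (coboundary X c) m s
        = (\<Sum>k\<le>Suc (Suc n). \<Sum>j\<le>Suc n. f (k, j))"
      using s by (simp add: m coboundary_Suc singular_simplex_face f_def del: sum.atMost_Suc)
    also have "\<dots> = sum f (?A \<union> ?B)"
      unfolding sum.cartesian_product by (intro sum.cong) auto
    also have "\<dots> = sum f ?A + sum f ?B"
      by (intro sum.union_disjoint finA finB) auto
    \<comment> \<open>The simplicial identity carries (k, j) with j < k to (j, k - 1), so the double
      sum consists of two equal halves and vanishes modulo 2.\<close>
    also have "sum f ?A = sum f ?B"
      by (rule sum.reindex_bij_witness[where i="\<lambda>(k, j). (Suc j, k)" and j="\<lambda>(k, j). (j, k - 1)"])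
         (auto simp: f_def singular_face_face)
    finally show ?thesis
      by simp
  qed
qed

section \<open>Cup products\<close>

text \<open>The inclusion of the standard q-simplex as the face on the vertices p, ..., p + q;
  \<open>back_face\<close> is composition with it.\<close>

definition shift :: "nat \<Rightarrow> (nat \<Rightarrow> real) \<Rightarrow> nat \<Rightarrow> real" where
  "shift p x = (\<lambda>i. if i < p then 0 else x (i - p))"

lemma sum_shift: "(\<Sum>i\<le>p + q. shift p x i) = (\<Sum>i\<le>q. x i)"
proof -
  have "(\<Sum>i\<le>p + q. shift p x i) = (\<Sum>i=p..p + q. shift p x i)"
    by (rule sum.mono_neutral_right) (auto simp: shift_def)
  also have "\<dots> = (\<Sum>i\<le>q. x i)"
    by (rule sum.reindex_bij_witness[where i="\<lambda>i. i + p" and j="\<lambda>i. i - p"]) (auto simp: shift_def)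
  finally show ?thesis .
qed

lemma shift_in: "x \<in> standard_simplex q \<Longrightarrow> shift p x \<in> standard_simplex (p + q)"
  using sum_shift[of p x q] by (auto simp: standard_simplex_def shift_def)

lemma back_face_alt: "back_face p q s = restrict (\<lambda>x. s (shift p x)) (standard_simplex q)"
  by (simp add: back_face_def shift_def)

lemma continuous_map_shift:
  "continuous_map (subtopology (powertop_real UNIV) (standard_simplex q))
     (subtopology (powertop_real UNIV) (standard_simplex (p + q))) (shift p)"
proof -
  have "continuous_map (powertop_real UNIV) (powertop_real UNIV) (shift p)"
    by (auto simp: continuous_map_componentwise shift_def intro: continuous_map_product_projection)
  then show ?thesis
    by (auto simp: continuous_map_in_subtopology shift_in continuous_map_from_subtopology)
qed

lemma singular_simplex_back_face:
  assumes "singular_simplex (p + q) X s"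
  shows "singular_simplex q X (back_face p q s)"
proof -
  have "continuous_map (subtopology (powertop_real UNIV) (standard_simplex q)) X (s \<circ> shift p)"
    using assms continuous_map_shift continuous_map_compose unfolding singular_simplex_def by blast
  then show ?thesis
    unfolding singular_simplex_def back_face_alt
    by (auto intro: continuous_map_eq)
qed

lemma singular_simplex_front_face:
  assumes "singular_simplex n X s" "p \<le> n"
  shows "singular_simplex p X (front_face p s)"
proof -
  have "continuous_map (subtopology (powertop_real UNIV) (standard_simplex p)) X s"
    using assms standard_simplex_mono unfolding singular_simplex_def
    by (metis continuous_map_from_subtopology_mono)
  then show ?thesis
    unfolding singular_simplex_def front_face_def
    by (auto intro: continuous_map_eq)
qed

text \<open>Every face of a simplex in \<open>S\<close> lies in \<open>S\<close>, so one relative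
  factor kills all terms of the product. The disjunction serves products with an absolute cochain on
  either side.\<close>

lemma cup_in_cochains_gen:
  assumes a: "a \<in> cochains X {}" and b: "b \<in> cochains X {}"
    and S: "a \<in> cochains X S \<or> b \<in> cochains X S"
  shows "cup X a b \<in> cochains X S"
proof -
  obtain M N where MN: "\<And>n. M < n \<Longrightarrow> a n = 0" "\<And>n. N < n \<Longrightarrow> b n = 0"
    using a b by (metis cochains_bounded)
  show ?thesis
  proof (rule cochainsI[where N="M + N"])
    fix n s assume s: "singular_simplex n X s" "s ` standard_simplex n \<subseteq> S"
    have "a p (front_face p s) * b (n - p) (back_face p (n - p) s) = 0" if "p \<le> n" for p
    proof -
      have "front_face p s ` standard_simplex p \<subseteq> S"
        using s standard_simplex_mono[OF that] by (auto simp: front_face_def)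
      moreover have "back_face p (n - p) s ` standard_simplex (n - p) \<subseteq> S"
        using s shift_in[of _ "n - p" p] that by (auto simp: back_face_alt)
      ultimately show ?thesis
        using S cochainsD(2) by fastforce
    qed
    then show "cup X a b n s = 0"
      by (auto simp: cup_def intro: sum.neutral)
  next
    fix n assume n: "M + N < n"
    have "M < p \<or> N < n - p" if "p \<le> n" for p
      using that n by linarith
    then have "a p x * b (n - p) y = 0" if "p \<le> n" for p x y
      using MN that by (metis mult_eq_0_iff zero_fun_apply)
    then show "cup X a b n = 0"
      by (auto simp: cup_def fun_eq_iff intro!: sum.neutral)
  qed (auto simp: cup_def)
qed

lemma cup_in_cochains_left:
  "\<lbrakk>a \<in> cochains X S; b \<in> cochains X {}\<rbrakk> \<Longrightarrow> cup X a b \<in> cochains X S"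
  and cup_in_cochains_right:
  "\<lbrakk>a \<in> cochains X {}; b \<in> cochains X S\<rbrakk> \<Longrightarrow> cup X a b \<in> cochains X S"
  using cup_in_cochains_gen cochains_absolute by blast+

lemma cup_in_cochains: "\<lbrakk>a \<in> cochains X S; b \<in> cochains X S\<rbrakk> \<Longrightarrow> cup X a b \<in> cochains X S"
  using cup_in_cochains_left cochains_absolute by blast

lemma cup_add_left: "cup X (a + b) c = cup X a c + cup X b c"
  by (auto simp: cup_def fun_eq_iff distrib_right sum.distrib)

lemma cup_add_right: "cup X a (b + c) = cup X a b + cup X a c"
  by (auto simp: cup_def fun_eq_iff distrib_left sum.distrib)

lemma cup_zero [simp]: "cup X 0 b = 0" "cup X a 0 = 0"
  by (auto simp: cup_def fun_eq_iff)

lemma cup_sum_left: "cup X (\<Sum>i\<in>I. f i) b = (\<Sum>i\<in>I. cup X (f i) b)"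
  by (rule additive_sum[of "\<lambda>a. cup X a b", OF cup_add_left cup_zero(1)])

lemma cup_sum_right: "cup X a (\<Sum>i\<in>I. f i) = (\<Sum>i\<in>I. cup X a (f i))"
  by (rule additive_sum[of "cup X a", OF cup_add_right cup_zero(2)])

lemma singular_simplex_restrict_id:
  "singular_simplex n X s \<Longrightarrow> restrict s (standard_simplex n) = s"
  by (simp add: singular_simplex_def extensional_restrict)

lemma cup_one_right: 
  assumes "a \<in> cochains X {}"
  shows "cup X a (one_cochain X) = a"
proof (intro ext)
  fix n s
  show "cup X a (one_cochain X) n s = a n s"
  proof (cases "singular_simplex n X s")
    case True
    have "cup X a (one_cochain X) n s
        = (\<Sum>p\<in>{n}. a p (front_face p s) * one_cochain X (n - p) (back_face p (n - p) s))"
      using True by (simp only: cup_def if_True) (rule sum.mono_neutral_right, auto simp: one_cochain_def)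
    also have "\<dots> = a n s"
      using True singular_simplex_back_face[of n 0 X s]
      by (simp add: one_cochain_def front_face_def singular_simplex_restrict_id)
    finally show ?thesis .
  qed (use assms cochainsD in \<open>auto simp: cup_def\<close>)
qed

lemma cup_one_left:
  assumes "a \<in> cochains X {}"
  shows "cup X (one_cochain X) a = a"
proof (intro ext)
  fix n s
  show "cup X (one_cochain X) a n s = a n s"
  proof (cases "singular_simplex n X s")
    case True
    have "cup X (one_cochain X) a n s
        = (\<Sum>p\<in>{0}. one_cochain X p (front_face p s) * a (n - p) (back_face p (n - p) s))"
      using True by (simp only: cup_def if_True) (rule sum.mono_neutral_right, auto simp: one_cochain_def)
    also have "\<dots> = a n s"
      using True singular_simplex_front_face[of n X s 0]
      by (simp add: one_cochain_def back_face_def singular_simplex_restrict_id)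
    finally show ?thesis .
  qed (use assms cochainsD in \<open>auto simp: cup_def\<close>)
qed

text \<open>Both bracketings run over the ways to cut a simplex into a front, a middle and a back
  face, so associativity holds for cochains and not only for classes.\<close>

lemma cup_assoc: "cup X (cup X a b) c = cup X a (cup X b c)"
proof (intro ext)
  fix n s
  show "cup X (cup X a b) c n s = cup X a (cup X b c) n s"
  proof (cases "singular_simplex n X s")
    case s: True
    define F where "F i k = a i (front_face i s) * b k (front_face k (back_face i (n - i) s))
      * c (n - i - k) (back_face (i + k) (n - i - k) s)" for i k
    have ff: "front_face i (front_face p s) = front_face i s" if "i \<le> p" for i p
      using that standard_simplex_mono by (auto simp: front_face_def fun_eq_iff)
    have bf: "back_face i (p - i) (front_face p s) = front_face (p - i) (back_face i (n - i) s)"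
      if "i \<le> p" "p \<le> n" for i p
    proof -
      have "x \<in> standard_simplex (n - i)" if "x \<in> standard_simplex (p - i)" for x
        using that \<open>p \<le> n\<close> standard_simplex_mono[OF diff_le_mono[OF \<open>p \<le> n\<close>, of i]] by auto
      then show ?thesis
        using that shift_in[of _ "p - i" i] by (intro ext) (auto simp: front_face_def back_face_alt)
    qed
    have bb: "back_face k (n - (i + k)) (back_face i (n - i) s) = back_face (i + k) (n - (i + k)) s"
      if "i + k \<le> n" for i k
    proof -
      have "shift k x \<in> standard_simplex (n - i)" if "x \<in> standard_simplex (n - (i + k))" for x
      proof -
        have "k + (n - (i + k)) = n - i"
          using \<open>i + k \<le> n\<close> by simp
        then show ?thesis
          using shift_in[OF that, of k] by simp
      qed
      moreover have "shift i (shift k x) = shift (i + k) x" for x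
        by (auto simp: shift_def fun_eq_iff)
      ultimately show ?thesis
        by (intro ext) (auto simp: back_face_alt)
    qed
    have "cup X (cup X a b) c n s = (\<Sum>p\<le>n. \<Sum>i\<le>p. F i (p - i))"
      using s by (auto simp: cup_def singular_simplex_front_face sum_distrib_right ff bf F_def
          intro!: sum.cong)
    also have "\<dots> = (\<Sum>(i, k)\<in>{(i, k). i + k \<le> n}. F i k)"
      by (rule sum.triangle_reindex_eq[symmetric])
    also have "{(i, k). i + k \<le> n} = (SIGMA i:{..n}. {..n - i})"
      by auto
    also have "(\<Sum>(i, k)\<in>(SIGMA i:{..n}. {..n - i}). F i k) = (\<Sum>i\<le>n. \<Sum>k\<le>n - i. F i k)"
      by (rule sum.Sigma[symmetric]) auto
    also have "\<dots> = cup X a (cup X b c) n s"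
      using s by (auto simp: cup_def singular_simplex_back_face sum_distrib_left bb F_def mult.assoc
          intro!: sum.cong)
    finally show ?thesis .
  qed (auto simp: cup_def)
qed

lemma coboundary_cup:
  "coboundary X (cup X a b) = cup X (coboundary X a) b + cup X a (coboundary X b)"
proof (intro ext)
  fix m s
  show "coboundary X (cup X a b) m s = (cup X (coboundary X a) b + cup X a (coboundary X b)) m s"
  proof (cases "m = 0 \<or> \<not> singular_simplex m X s")
    case True
    then show ?thesis
      by (cases m) (auto simp: cup_def coboundary_Suc)
  next
    case False
    then obtain n where m: "m = Suc n" and s: "singular_simplex (Suc n) X s"
      by (cases m) auto
    let ?B = "\<lambda>p. b (n - p) (back_face (Suc p) (n - p) s)"
    let ?A = "\<lambda>p. a p (front_face p s)"
    define G where "G p = (\<Sum>k\<le>p. a p (singular_face (Suc p) k (front_face (Suc p) s))) * ?B p" for p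
    define H where "H p = ?A p * (\<Sum>j\<in>{1..Suc n - p}. b (n - p)
       (singular_face (Suc (n - p)) j (back_face p (Suc n - p) s)))" for p
    have front1: "front_face p (singular_face (Suc n) k s) = singular_face (Suc p) k (front_face (Suc p) s)"
      if "k \<le> p" "p \<le> n" for p k
      using that standard_simplex_mono[of p n]
      by (auto simp: singular_face_alt front_face_def fun_eq_iff simplical_face_in)
    have front2: "front_face p (singular_face (Suc n) k s) = front_face p s"
      if "p < k" "p \<le> n" for p k
    proof -
      have "simplical_face k x = x" if "x \<in> standard_simplex p" for x
        using that \<open>p < k\<close> by (auto simp: simplical_face_def fun_eq_iff standard_simplex_def)
      then have "s (simplical_face k x) = s x" if "x \<in> standard_simplex p" for x
        using that by simp
      then show ?thesis
        using that standard_simplex_mono[of p n]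
        by (auto simp: singular_face_alt front_face_def fun_eq_iff)
    qed
    have back1: "back_face p (n - p) (singular_face (Suc n) k s) = back_face (Suc p) (n - p) s"
      if "k \<le> p" "p \<le> n" for p k
    proof -
      have "shift p x \<in> standard_simplex n" if "x \<in> standard_simplex (n - p)" for x
        using shift_in[OF that, of p] \<open>p \<le> n\<close> by simp
      moreover have "simplical_face k (shift p x) = shift (Suc p) x" for x
        using that by (auto simp: simplical_face_def shift_def fun_eq_iff)
      ultimately show ?thesis
        by (intro ext) (auto simp: singular_face_alt back_face_alt)
    qed
    have back2: "back_face p (n - p) (singular_face (Suc n) (p + j) s)
        = singular_face (Suc (n - p)) j (back_face p (Suc n - p) s)"
      if "1 \<le> j" "p \<le> n" "j \<le> Suc n - p" for p j
    proof -
      have "shift p x \<in> standard_simplex n" if "x \<in> standard_simplex (n - p)" for x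
        using shift_in[OF that, of p] \<open>p \<le> n\<close> by simp
      moreover have "simplical_face (p + j) (shift p x) = shift p (simplical_face j x)" for x
        using that by (auto simp: simplical_face_def shift_def fun_eq_iff)
      moreover have "simplical_face j x \<in> standard_simplex (Suc n - p)" if "x \<in> standard_simplex (n - p)" for x
        using simplical_face_in[OF _ that, of j] \<open>p \<le> n\<close> \<open>j \<le> Suc n - p\<close> by (simp add: Suc_diff_le)
      ultimately show ?thesis
        by (intro ext) (auto simp: singular_face_alt back_face_alt)
    qed
    have last: "singular_face (Suc p) (Suc p) (front_face (Suc p) s) = front_face p s" if "p \<le> n" for p
    proof -
      have "simplical_face (Suc p) x = x" if "x \<in> standard_simplex p" for x
        using that by (auto simp: simplical_face_def fun_eq_iff standard_simplex_def)
      then show ?thesis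
        using standard_simplex_mono[of p "Suc p"]
        by (intro ext) (auto simp: singular_face_alt front_face_def)
    qed
    have first: "singular_face (Suc (n - p)) 0 (back_face p (Suc n - p) s) = back_face (Suc p) (n - p) s"
      if "p \<le> n" for p
    proof -
      have "simplical_face 0 x \<in> standard_simplex (Suc n - p)" if "x \<in> standard_simplex (n - p)" for x
        using simplical_face_in[OF _ that, of 0] \<open>p \<le> n\<close> by (simp add: Suc_diff_le)
      moreover have "shift p (simplical_face 0 x) = shift (Suc p) x" for x
        by (auto simp: simplical_face_def shift_def fun_eq_iff)
      ultimately show ?thesis
        by (intro ext) (auto simp: singular_face_alt back_face_alt)
    qed
    have "coboundary X (cup X a b) m s
        = (\<Sum>k\<le>Suc n. \<Sum>p\<le>n. a p (front_face p (singular_face (Suc n) k s))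
            * b (n - p) (back_face p (n - p) (singular_face (Suc n) k s)))"
      using s by (auto simp: m coboundary_Suc cup_def singular_simplex_face intro!: sum.cong)
    also have "\<dots> = (\<Sum>p\<le>n. \<Sum>k\<le>Suc n. a p (front_face p (singular_face (Suc n) k s))
            * b (n - p) (back_face p (n - p) (singular_face (Suc n) k s)))"
      by (rule sum.swap)
    also have "\<dots> = (\<Sum>p\<le>n. G p + H p)"
    proof (rule sum.cong[OF refl])
      fix p assume "p \<in> {..n}"
      then have p: "p \<le> n" by simp
      let ?f = "\<lambda>k. a p (front_face p (singular_face (Suc n) k s))
            * b (n - p) (back_face p (n - p) (singular_face (Suc n) k s))"
      have "{..Suc n} = {..p} \<union> {Suc p..Suc n}"
        using p by auto
      then have "sum ?f {..Suc n} = sum ?f {..p} + sum ?f {Suc p..Suc n}"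
        by (simp only:) (rule sum.union_disjoint, auto)
      moreover have "sum ?f {..p} = G p"
        using p by (auto simp: G_def sum_distrib_right front1 back1 intro!: sum.cong)
      moreover have "sum ?f {Suc p..Suc n} = (\<Sum>j\<in>{1..Suc n - p}. ?f (p + j))"
        by (rule sum.reindex_bij_witness[where i="\<lambda>j. p + j" and j="\<lambda>k. k - p"]) (use p in auto)
      moreover have "(\<Sum>j\<in>{1..Suc n - p}. ?f (p + j)) = H p"
        unfolding H_def sum_distrib_left
        by (rule sum.cong[OF refl]) (use p front2 back2 in auto)
      ultimately show "sum ?f {..Suc n} = G p + H p"
        by simp
    qed
    \<comment> \<open>Both missing faces contribute the same product \<open>?A p * ?B p\<close>;
      adding it twice changes nothing modulo 2 and completes both coboundaries.\<close>
    also have "\<dots> = (\<Sum>p\<le>n. (G p + ?A p * ?B p) + (?A p * ?B p + H p))"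
    proof (rule sum.cong[OF refl])
      fix p
      show "G p + H p = (G p + ?A p * ?B p) + (?A p * ?B p + H p)"
        by (cases "?A p * ?B p") (auto simp: algebra_simps)
    qed
    also have "\<dots> = (\<Sum>p\<le>n. G p + ?A p * ?B p) + (\<Sum>p\<le>n. ?A p * ?B p + H p)"
      by (rule sum.distrib)
    also have "(\<Sum>p\<le>n. G p + ?A p * ?B p) = cup X (coboundary X a) b m s"
    proof -
      have "cup X (coboundary X a) b m s = (\<Sum>p\<le>n. coboundary X a (Suc p) (front_face (Suc p) s) * ?B p)"
        using s by (simp add: m cup_def sum.atMost_Suc_shift del: sum.atMost_Suc)
      also have "\<dots> = (\<Sum>p\<le>n. G p + ?A p * ?B p)"
        using s singular_simplex_front_face[OF s]
        by (intro sum.cong) (auto simp: coboundary_Suc G_def last distrib_right)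
      finally show ?thesis by simp
    qed
    also have "(\<Sum>p\<le>n. ?A p * ?B p + H p) = cup X a (coboundary X b) m s"
    proof -
      have "cup X a (coboundary X b) m s
          = (\<Sum>p\<le>n. ?A p * coboundary X b (Suc n - p) (back_face p (Suc n - p) s))"
        using s by (simp add: m cup_def)
      also have "\<dots> = (\<Sum>p\<le>n. ?A p * ?B p + H p)"
      proof (rule sum.cong[OF refl])
        fix p assume "p \<in> {..n}"
        then have p: "p \<le> n" by simp
        let ?g = "\<lambda>j. b (n - p) (singular_face (Suc (n - p)) j (back_face p (Suc n - p) s))"
        have "singular_simplex (Suc (n - p)) X (back_face p (Suc n - p) s)"
          using singular_simplex_back_face[of p "Suc n - p" X s] s p by (simp add: Suc_diff_le)
        then have "coboundary X b (Suc n - p) (back_face p (Suc n - p) s) = sum ?g {..Suc n - p}"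
          using p by (simp add: Suc_diff_le coboundary_Suc)
        also have "{..Suc n - p} = insert 0 {1..Suc n - p}"
          by auto
        also have "sum ?g \<dots> = ?g 0 + sum ?g {1..Suc n - p}"
          by (rule sum.insert) auto
        finally show "?A p * coboundary X b (Suc n - p) (back_face p (Suc n - p) s) = ?A p * ?B p + H p"
          using first[OF p] by (simp add: distrib_left H_def)
      qed
      finally show ?thesis by simp
    qed
    finally show ?thesis
      by simp
  qed
qed

lemma coboundary_one [simp]: "coboundary X (one_cochain X) = 0"
proof (intro ext)
  fix m s
  consider "m = 0" | "m = Suc 0" | n where "m = Suc (Suc n)"
    by (metis not0_implies_Suc)
  then show "coboundary X (one_cochain X) m s = 0 m s"
  proof cases
    \<comment> \<open>An edge has two vertices, so the unit is counted twice.\<close>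
    case 2
    then show ?thesis
      using singular_simplex_face[of 0 X s] by (auto simp: coboundary_Suc one_cochain_def)
  qed (auto simp: coboundary_Suc one_cochain_def)
qed

section \<open>Pullbacks\<close>

text \<open>\<open>S\<close> may stick out of the space, so the condition concerns only its part
  inside \<open>topspace X\<close>.\<close>

abbreviation pair_map :: "'a topology \<Rightarrow> 'a set \<Rightarrow> 'b topology \<Rightarrow> 'b set \<Rightarrow> ('a \<Rightarrow> 'b) \<Rightarrow> bool" where
  "pair_map X S Y T f \<equiv> continuous_map X Y f \<and> f ` (topspace X \<inter> S) \<subseteq> T"

lemma pullback_add: "cochain_pullback X f (a + b) = cochain_pullback X f a + cochain_pullback X f b"
  by (auto simp: cochain_pullback_def fun_eq_iff)

lemma pullback_zero [simp]: "cochain_pullback X f 0 = 0"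
  by (auto simp: cochain_pullback_def fun_eq_iff)

lemma singular_simplex_image: "singular_simplex n X s \<Longrightarrow> s ` standard_simplex n \<subseteq> topspace X"
  using continuous_map_image_subset_topspace unfolding singular_simplex_def by fastforce

lemma pullback_in_cochains:
  assumes f: "pair_map X S Y T f" and c: "c \<in> cochains Y T"
  shows "cochain_pullback X f c \<in> cochains X S"
proof -
  obtain N where N: "\<And>n. N < n \<Longrightarrow> c n = 0"
    using c cochains_bounded by blast
  show ?thesis
  proof (rule cochainsI[where N=N])
    fix n s assume s: "singular_simplex n X s" "s ` standard_simplex n \<subseteq> S"
    have "simplex_map n f s ` standard_simplex n \<subseteq> T"
      using s f singular_simplex_image[OF s(1)] by (auto simp: simplex_map_def)
    then show "cochain_pullback X f c n s = 0"
      using cochainsD(2)[OF c] by (simp add: cochain_pullback_def)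
  qed (auto simp: cochain_pullback_def N)
qed

lemma pullback_coboundary:
  assumes "continuous_map X Y f"
  shows "cochain_pullback X f (coboundary Y c) = coboundary X (cochain_pullback X f c)"
proof (intro ext)
  fix m s
  show "cochain_pullback X f (coboundary Y c) m s = coboundary X (cochain_pullback X f c) m s"
  proof (cases m)
    case (Suc n)
    have "singular_face (Suc n) k (simplex_map (Suc n) f s) = simplex_map n f (singular_face (Suc n) k s)"
      if "k \<le> Suc n" for k
      using that by (auto simp: singular_face_alt simplex_map_def fun_eq_iff simplical_face_in)
    then show ?thesis
      using singular_simplex_simplex_map[OF _ assms]
      by (auto simp: Suc cochain_pullback_def coboundary_Suc singular_simplex_face
          simp del: sum.atMost_Suc intro!: sum.cong)
  qed (auto simp: cochain_pullback_def)
qed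

lemma front_face_simplex_map: "p \<le> n \<Longrightarrow> front_face p (simplex_map n f s) = simplex_map p f (front_face p s)"
  using standard_simplex_mono[of p n] by (auto simp: front_face_def simplex_map_def fun_eq_iff)

lemma back_face_simplex_map:
  "p \<le> n \<Longrightarrow> back_face p (n - p) (simplex_map n f s) = simplex_map (n - p) f (back_face p (n - p) s)"
  using shift_in[of _ "n - p" p] by (auto simp: back_face_alt simplex_map_def fun_eq_iff)

lemma singular_simplex_back_face':
  "\<lbrakk>singular_simplex n X s; p \<le> n\<rbrakk> \<Longrightarrow> singular_simplex (n - p) X (back_face p (n - p) s)"
  by (simp add: singular_simplex_back_face)

lemma pullback_cup:
  assumes "continuous_map X Y f"
  shows "cochain_pullback X f (cup Y a b) = cup X (cochain_pullback X f a) (cochain_pullback X f b)"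
  using singular_simplex_simplex_map[OF _ assms]
  by (auto simp: cochain_pullback_def cup_def fun_eq_iff front_face_simplex_map back_face_simplex_map
      singular_simplex_front_face singular_simplex_back_face' intro!: sum.cong)

lemma pullback_one:
  assumes "continuous_map X Y f"
  shows "cochain_pullback X f (one_cochain Y) = one_cochain X"
  using singular_simplex_simplex_map[OF _ assms]
  by (auto simp: cochain_pullback_def one_cochain_def fun_eq_iff)

lemma pullback_compose:
  assumes "continuous_map X Y f"
  shows "cochain_pullback X f (cochain_pullback Y g c) = cochain_pullback X (g \<circ> f) c"
  using singular_simplex_simplex_map[OF _ assms]
  by (auto simp: cochain_pullback_def fun_eq_iff simplex_map_compose)

lemma pullback_cong:
  assumes "\<And>x. x \<in> topspace X \<Longrightarrow> f x = g x"
  shows "cochain_pullback X f c = cochain_pullback X g c"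
proof -
  have "simplex_map n f s = simplex_map n g s" if "singular_simplex n X s" for n s
    using singular_simplex_image[OF that] assms by (auto simp: simplex_map_def fun_eq_iff)
  then show ?thesis
    unfolding cochain_pullback_def by (intro ext) auto
qed

lemma pullback_id:
  assumes "c \<in> cochains X S" "\<And>x. x \<in> topspace X \<Longrightarrow> f x = x"
  shows "cochain_pullback X f c = c"
proof -
  have "cochain_pullback X f c = cochain_pullback X id c"
    using assms(2) by (intro pullback_cong) auto
  also have "\<dots> = c"
    using cochainsD(1)[OF assms(1)] unfolding cochain_pullback_def
    by (intro ext) (auto simp: simplex_map_def singular_simplex_restrict_id)
  finally show ?thesis .
qed

section \<open>Cocycles and homogeneous components\<close>

definition cocycles :: "'a topology \<Rightarrow> 'a set \<Rightarrow> 'a cochain set" where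
  "cocycles X S = {c \<in> cochains X S. coboundary X c = 0}"

lemma cocycles_cochains: "c \<in> cocycles X S \<Longrightarrow> c \<in> cochains X S"
  and cocyclesD: "c \<in> cocycles X S \<Longrightarrow> coboundary X c = 0"
  by (auto simp: cocycles_def)

lemma cocycles_absolute: "c \<in> cocycles X S \<Longrightarrow> c \<in> cocycles X {}"
  by (auto simp: cocycles_def intro: cochains_absolute)

lemma cocycles_zero [simp]: "0 \<in> cocycles X S"
  and cocycles_add [simp]: "\<lbrakk>a \<in> cocycles X S; b \<in> cocycles X S\<rbrakk> \<Longrightarrow> a + b \<in> cocycles X S"
  by (auto simp: cocycles_def coboundary_add)

lemma cocycles_sum [simp]: "(\<And>i. i \<in> I \<Longrightarrow> f i \<in> cocycles X S) \<Longrightarrow> (\<Sum>i\<in>I. f i) \<in> cocycles X S"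
  by (induction I rule: infinite_finite_induct) auto

lemma cocycles_one [simp]: "one_cochain X \<in> cocycles X {}"
  by (auto simp: cocycles_def)

lemma cocycles_cup_left: "\<lbrakk>a \<in> cocycles X S; b \<in> cocycles X {}\<rbrakk> \<Longrightarrow> cup X a b \<in> cocycles X S"
  by (auto simp: cocycles_def coboundary_cup cup_in_cochains_left)

lemma cocycles_cup: "\<lbrakk>a \<in> cocycles X S; b \<in> cocycles X S\<rbrakk> \<Longrightarrow> cup X a b \<in> cocycles X S"
  using cocycles_cup_left cocycles_absolute by blast

lemma cocycles_pullback:
  "\<lbrakk>pair_map X S Y T f; c \<in> cocycles Y T\<rbrakk> \<Longrightarrow> cochain_pullback X f c \<in> cocycles X S"
  by (auto simp: cocycles_def pullback_in_cochains simp flip: pullback_coboundary)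

lemma coboundariesI: "\<lbrakk>b \<in> cochains X S; c = coboundary X b\<rbrakk> \<Longrightarrow> c \<in> coboundaries X S"
  by (auto simp: coboundaries_def)

lemma coboundariesE:
  assumes "c \<in> coboundaries X S"
  obtains b where "b \<in> cochains X S" "c = coboundary X b"
  using assms by (auto simp: coboundaries_def)

lemma coboundaries_zero [simp]: "0 \<in> coboundaries X S"
  by (rule coboundariesI[of 0]) auto

lemma coboundaries_add [simp]: "\<lbrakk>a \<in> coboundaries X S; b \<in> coboundaries X S\<rbrakk> \<Longrightarrow> a + b \<in> coboundaries X S"
  by (metis coboundariesE coboundariesI coboundary_add cochains_add)

lemma coboundaries_cocycles: "c \<in> coboundaries X S \<Longrightarrow> c \<in> cocycles X S"
  by (auto simp: cocycles_def elim!: coboundariesE)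

lemma coboundaries_cup_left: "\<lbrakk>a \<in> coboundaries X S; b \<in> cocycles X {}\<rbrakk> \<Longrightarrow> cup X a b \<in> coboundaries X S"
  by (auto simp: cocycles_def coboundary_cup cup_in_cochains_left elim!: coboundariesE
      intro!: coboundariesI[of "cup X _ b"])

lemma coboundaries_cup_right: "\<lbrakk>a \<in> cocycles X {}; b \<in> coboundaries X S\<rbrakk> \<Longrightarrow> cup X a b \<in> coboundaries X S"
  by (auto simp: cocycles_def coboundary_cup cup_in_cochains_right elim!: coboundariesE
      intro!: coboundariesI[of "cup X a _"])

text \<open>In \<open>cup_absolute\<close> the second factor is an absolute class, whose
  representatives differ by coboundaries of absolute cochains. The primitive of the product is still
  relative because its first factor is.\<close>

lemma coboundaries_cup_right_absolute:
  "\<lbrakk>a \<in> cocycles X S; b \<in> coboundaries X {}\<rbrakk> \<Longrightarrow> cup X a b \<in> coboundaries X S"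
  by (auto simp: cocycles_def coboundary_cup cup_in_cochains_left elim!: coboundariesE
      intro!: coboundariesI[of "cup X a _"])

lemma coboundaries_pullback:
  "\<lbrakk>pair_map X S Y T f; c \<in> coboundaries Y T\<rbrakk> \<Longrightarrow> cochain_pullback X f c \<in> coboundaries X S"
  by (metis coboundariesE coboundariesI pullback_coboundary pullback_in_cochains)

section \<open>Grading of cochains by degree\<close>

definition homogeneous :: "nat \<Rightarrow> 'a cochain \<Rightarrow> bool" where
  "homogeneous n c \<longleftrightarrow> (\<forall>k. k \<noteq> n \<longrightarrow> c k = 0)"

definition component :: "nat \<Rightarrow> 'a cochain \<Rightarrow> 'a cochain" where
  "component n c = (\<lambda>k. if k = n then c k else 0)"

lemma homogeneous_component [simp]: "homogeneous n (component n c)"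
  by (simp add: homogeneous_def component_def)

lemma component_homogeneous: "homogeneous n c \<Longrightarrow> component n c = c"
  by (auto simp: homogeneous_def component_def fun_eq_iff)

lemma homogeneous_add [simp]: "\<lbrakk>homogeneous n a; homogeneous n b\<rbrakk> \<Longrightarrow> homogeneous n (a + b)"
  and homogeneous_zero [simp]: "homogeneous n 0"
  and homogeneous_one [simp]: "homogeneous 0 (one_cochain X)"
  by (auto simp: homogeneous_def one_cochain_def fun_eq_iff)

lemma homogeneous_cup:
  assumes "homogeneous p a" "homogeneous q b"
  shows "homogeneous (p + q) (cup X a b)"
proof -
  have "cup X a b n s = 0" if "n \<noteq> p + q" for n s
  proof -
    have "a i x * b (n - i) y = 0" if "i \<le> n" for i x y
    proof (cases "i = p")
      case True
      then have "n - i \<noteq> q"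
        using that \<open>n \<noteq> p + q\<close> by simp
      then show ?thesis
        using assms(2) by (simp add: homogeneous_def)
    next
      case False
      then show ?thesis
        using assms(1) by (simp add: homogeneous_def)
    qed
    then show ?thesis
      by (auto simp: cup_def intro!: sum.neutral)
  qed
  then show ?thesis
    by (auto simp: homogeneous_def fun_eq_iff)
qed

lemma homogeneous_pullback: "homogeneous n c \<Longrightarrow> homogeneous n (cochain_pullback X f c)"
  by (auto simp: homogeneous_def cochain_pullback_def fun_eq_iff)

lemma component_in_cochains [simp]: "c \<in> cochains X S \<Longrightarrow> component n c \<in> cochains X S"
  by (rule cochainsI[where N=n]) (auto simp: component_def cochainsD)

lemma coboundary_component: "coboundary X (component n c) = component (Suc n) (coboundary X c)"
proof (intro ext)
  fix m s show "coboundary X (component n c) m s = component (Suc n) (coboundary X c) m s"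
    by (cases m) (auto simp: component_def coboundary_Suc)
qed

lemma component_coboundary_0: "component 0 (coboundary X c) = 0"
  by (auto simp: component_def fun_eq_iff)

lemma component_in_cocycles [simp]: "c \<in> cocycles X S \<Longrightarrow> component n c \<in> cocycles X S"
  by (auto simp: cocycles_def coboundary_component) (auto simp: component_def fun_eq_iff)

lemma coboundary_homogeneous_eq:
  assumes "homogeneous (Suc n) c" "c \<in> coboundaries X S"
  obtains b where "b \<in> cochains X S" "homogeneous n b" "c = coboundary X b"
proof -
  obtain b where b: "b \<in> cochains X S" "c = coboundary X b"
    using assms coboundariesE by blast
  then have "c = coboundary X (component n b)"
    using component_homogeneous[OF assms(1)] by (simp add: coboundary_component)
  then show ?thesis
    using that b by (metis component_in_cochains homogeneous_component)
qed

text \<open>There are no cochains in degree -1. The degree 0 arguments below use this to turn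
  cohomologous cocycles into equal ones.\<close>

lemma homogeneous_0_coboundaries:
  assumes "homogeneous 0 c" "c \<in> coboundaries X S"
  shows "c = 0"
  using assms component_homogeneous component_coboundary_0 by (metis coboundariesE)

lemma sum_components:
  assumes "\<And>n. N < n \<Longrightarrow> c n = 0"
  shows "(\<Sum>n\<le>N. component n c) = c"
proof (intro ext)
  fix m s
  have "(\<Sum>n\<le>N. component n c) m s = (\<Sum>n\<le>N. if n = m then c m s else 0)"
    unfolding sum_cochain_apply component_def by (intro sum.cong) auto
  also have "\<dots> = c m s"
    using assms[of m] by (auto simp: not_le)
  finally show "(\<Sum>n\<le>N. component n c) m s = c m s" .
qed

text \<open>Subgoals made by resolution are eta-expanded, so that these two rules would rewrite sums of
  cochains pointwise.\<close>

declare plus_fun_apply [simp del] zero_fun_apply [simp del]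

lemma zero_cochain_eq1: "(\<lambda>n. 0) = (0::'a cochain)"
  by (auto simp: fun_eq_iff zero_fun_apply)

section \<open>Cohomology classes\<close>

lemma carrier_cocycle_ring: "carrier (cocycle_ring X S) = cocycles X S"
  by (simp add: cocycle_ring_def cocycles_def zero_cochain_eq zero_cochain_eq1)

lemma cocycle_ring_add: "a \<oplus>\<^bsub>cocycle_ring X S\<^esub> b = a + b"
  and cocycle_ring_mult: "a \<otimes>\<^bsub>cocycle_ring X S\<^esub> b = cup X a b"
  by (auto simp: cocycle_ring_def fun_eq_iff plus_fun_apply)

lemma cohom_class_eq_image: "cohom_class X S c = (\<lambda>b. b + c) ` coboundaries X S"
  by (auto simp: cohom_class_def a_r_coset_def' cocycle_ring_add)

lemma mem_cohom_class_iff: "d \<in> cohom_class X S c \<longleftrightarrow> c + d \<in> coboundaries X S"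
proof
  assume "c + d \<in> coboundaries X S"
  moreover have "d = (c + d) + c"
    by (metis add.commute cochain_add_self_left)
  ultimately show "d \<in> cohom_class X S c"
    unfolding cohom_class_eq_image by blast
next
  assume "d \<in> cohom_class X S c"
  then obtain b where "b \<in> coboundaries X S" "d = b + c"
    unfolding cohom_class_eq_image by blast
  then show "c + d \<in> coboundaries X S"
    by (metis add.commute cochain_add_self_left)
qed

lemma mem_cohom_class_self [simp]: "c \<in> cohom_class X S c"
  by (simp add: mem_cohom_class_iff)

lemma cohom_class_eq_iff: "cohom_class X S c = cohom_class X S d \<longleftrightarrow> c + d \<in> coboundaries X S"
proof
  assume "cohom_class X S c = cohom_class X S d"
  then show "c + d \<in> coboundaries X S"
    using mem_cohom_class_iff mem_cohom_class_self by metis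
next
  assume cd: "c + d \<in> coboundaries X S"
  have "e \<in> cohom_class X S d" if "e \<in> cohom_class X S c" and "c + d \<in> coboundaries X S" for c d e
  proof -
    have "(c + e) + (c + d) \<in> coboundaries X S"
      using that coboundaries_add by (metis mem_cohom_class_iff)
    moreover have "(c + e) + (c + d) = d + e"
      by (metis add.assoc add.commute cochain_add_self_left)
    ultimately show ?thesis
      by (simp add: mem_cohom_class_iff)
  qed
  then show "cohom_class X S c = cohom_class X S d"
    using cd by (metis add.commute subsetI subset_antisym)
qed

lemma cocycles_of_mem_class:
  "\<lbrakk>c \<in> cocycles X S; d \<in> cohom_class X S c\<rbrakk> \<Longrightarrow> d \<in> cocycles X S"
  by (auto simp: cohom_class_eq_image intro: coboundaries_cocycles cocycles_add)

lemma carrier_cohom: "carrier (cohom X S) = cohom_class X S ` cocycles X S"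
  by (auto simp: cohom_def FactRing_def A_RCOSETS_def' carrier_cocycle_ring cohom_class_def)

lemma cohom_class_in_carrier [simp]: "c \<in> cocycles X S \<Longrightarrow> cohom_class X S c \<in> carrier (cohom X S)"
  by (simp add: carrier_cohom)

lemma cohom_zero: "\<zero>\<^bsub>cohom X S\<^esub> = cohom_class X S 0"
  by (simp add: cohom_def FactRing_def cohom_class_eq_image)

lemma cohom_class_eq_zero_iff: "cohom_class X S c = \<zero>\<^bsub>cohom X S\<^esub> \<longleftrightarrow> c \<in> coboundaries X S"
  by (simp add: cohom_zero cohom_class_eq_iff)

lemma cohom_one: "\<one>\<^bsub>cohom X {}\<^esub> = cohom_class X {} (one_cochain X)"
proof -
  have "\<not> singular_simplex n (subtopology X {}) s" for n s
    by (rule singular_simplex_empty) simp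
  then have "\<one>\<^bsub>cocycle_ring X {}\<^esub> = one_cochain X"
    unfolding cocycle_ring_def one_cochain_def by auto
  then show ?thesis
    by (simp add: cohom_def FactRing_def cohom_class_def)
qed

lemma cohom_add: "cohom_class X S c \<oplus>\<^bsub>cohom X S\<^esub> cohom_class X S d = cohom_class X S (c + d)"
proof -
  have "cohom_class X S c \<oplus>\<^bsub>cohom X S\<^esub> cohom_class X S d
      = {x + y |x y. x \<in> cohom_class X S c \<and> y \<in> cohom_class X S d}"
    by (auto simp: cohom_def FactRing_def set_add_def' cocycle_ring_add)
  also have "\<dots> = cohom_class X S (c + d)"
  proof (intro equalityI subsetI)
    fix z assume "z \<in> {x + y |x y. x \<in> cohom_class X S c \<and> y \<in> cohom_class X S d}"
    then obtain x y where "z = x + y" "c + x \<in> coboundaries X S" "d + y \<in> coboundaries X S"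
      by (auto simp: mem_cohom_class_iff)
    then show "z \<in> cohom_class X S (c + d)"
      using coboundaries_add by (fastforce simp: mem_cohom_class_iff ac_simps)
  next
    fix z assume "z \<in> cohom_class X S (c + d)"
    then have "z + d \<in> cohom_class X S c" "z = (z + d) + d"
      by (auto simp: mem_cohom_class_iff ac_simps)
    then show "z \<in> {x + y |x y. x \<in> cohom_class X S c \<and> y \<in> cohom_class X S d}"
      using mem_cohom_class_self by blast
  qed
  finally show ?thesis .
qed

text \<open>The union that defines \<open>rcoset_mult\<close> collapses because all its members are
  the same coset. \<open>T\<close> is separate from \<open>S\<close> so that one argument serves the
  product of two relative classes and the product with an absolute one.\<close>

lemma cup_class_gen:
  assumes "a \<in> cocycles X S" "b \<in> cocycles X T"
    and left: "\<And>u v. \<lbrakk>u \<in> coboundaries X S; v \<in> cocycles X T\<rbrakk> \<Longrightarrow> cup X u v \<in> coboundaries X S"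
    and right: "\<And>u v. \<lbrakk>u \<in> cocycles X S; v \<in> coboundaries X T\<rbrakk> \<Longrightarrow> cup X u v \<in> coboundaries X S"
  shows "rcoset_mult (cocycle_ring X S) (coboundaries X S) (cohom_class X S a) (cohom_class X T b)
    = cohom_class X S (cup X a b)"
proof -
  have "cohom_class X S (cup X x y) = cohom_class X S (cup X a b)"
    if x: "x \<in> cohom_class X S a" and y: "y \<in> cohom_class X T b" for x y
  proof -
    have "cup X (a + x) y \<in> coboundaries X S" "cup X a (b + y) \<in> coboundaries X S"
      using left[of "a + x" y] right[of a "b + y"] x y assms(1) cocycles_of_mem_class[OF assms(2) y]
      by (simp_all add: mem_cohom_class_iff)
    then have "cup X (a + x) y + cup X a (b + y) \<in> coboundaries X S"
      by simp
    \<comment> \<open>Changing one factor at a time produces the mixed term \<open>cup X a y\<close>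
      twice.\<close>
    also have "cup X (a + x) y + cup X a (b + y) = (cup X a y + cup X a y) + (cup X x y + cup X a b)"
      unfolding cup_add_left cup_add_right by (simp only: ac_simps)
    finally show ?thesis
      by (simp add: cohom_class_eq_iff)
  qed
  then have "(\<Union>x\<in>cohom_class X S a. \<Union>y\<in>cohom_class X T b. cohom_class X S (cup X x y))
      = (\<Union>x\<in>cohom_class X S a. \<Union>y\<in>cohom_class X T b. cohom_class X S (cup X a b))"
    by (intro SUP_cong refl)
  also have "\<dots> = cohom_class X S (cup X a b)"
    using mem_cohom_class_self[of a X S] mem_cohom_class_self[of b X T] by fast
  finally show ?thesis
    unfolding rcoset_mult_def cocycle_ring_mult cohom_class_def .
qed

lemma cohom_mult:
  assumes "a \<in> cocycles X S" "b \<in> cocycles X S"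
  shows "cohom_class X S a \<otimes>\<^bsub>cohom X S\<^esub> cohom_class X S b = cohom_class X S (cup X a b)"
  unfolding cohom_def FactRing_def monoid.simps ring.simps
  using cup_class_gen[OF assms coboundaries_cup_left[OF _ cocycles_absolute]
      coboundaries_cup_right[OF cocycles_absolute]]
  by simp

lemma cup_absolute_class:
  assumes "a \<in> cocycles X S" "b \<in> cocycles X {}"
  shows "cup_absolute X S (cohom_class X S a) (cohom_class X {} b) = cohom_class X S (cup X a b)"
  unfolding cup_absolute_def
  by (rule cup_class_gen[OF assms coboundaries_cup_left coboundaries_cup_right_absolute])

lemma cohom_map_class:
  assumes "pair_map X S Y T f"
  shows "cohom_map X S f (cohom_class Y T c) = cohom_class X S (cochain_pullback X f c)"
proof -
  have "cohom_class X S (cochain_pullback X f d) = cohom_class X S (cochain_pullback X f c)"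
    if "d \<in> cohom_class Y T c" for d
    using that coboundaries_pullback[OF assms]
    by (simp add: cohom_class_eq_iff mem_cohom_class_iff add.commute flip: pullback_add)
  then have "cohom_map X S f (cohom_class Y T c)
      = (\<Union>d\<in>cohom_class Y T c. cohom_class X S (cochain_pullback X f c))"
    unfolding cohom_map_def by (intro SUP_cong refl)
  then show ?thesis
    using mem_cohom_class_self[of c Y T] by fast
qed

text \<open>Every class is its own negative. The group structure gives access to the finite sums in
  \<open>kunneth\<close> and to the addition of polynomials in \<open>UP\<close>.\<close>

lemma abelian_group_cohom: "abelian_group (cohom X S)"
proof (rule abelian_groupI)
  fix x assume "x \<in> carrier (cohom X S)"
  then obtain c where c: "c \<in> cocycles X S" "x = cohom_class X S c"
    by (auto simp: carrier_cohom)
  then have "x \<oplus>\<^bsub>cohom X S\<^esub> x = \<zero>\<^bsub>cohom X S\<^esub>"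
    by (simp add: cohom_add cohom_zero)
  then show "\<exists>y\<in>carrier (cohom X S). y \<oplus>\<^bsub>cohom X S\<^esub> x = \<zero>\<^bsub>cohom X S\<^esub>"
    using c by auto
qed (auto simp: carrier_cohom cohom_add cohom_zero ac_simps simp flip: ex_simps)

lemma finsum_cohom_class:
  assumes "finite J" "\<And>j. j \<in> J \<Longrightarrow> f j \<in> cocycles X S"
  shows "(\<Oplus>\<^bsub>cohom X S\<^esub>j\<in>J. cohom_class X S (f j)) = cohom_class X S (\<Sum>j\<in>J. f j)"
proof -
  interpret abelian_group "cohom X S"
    by (rule abelian_group_cohom)
  show ?thesis
    using assms
  proof (induction J rule: finite_induct)
    case empty
    then show ?case by (simp add: cohom_zero)
  next
    case (insert x F)
    then show ?case
      by (subst finsum_insert) (auto simp: cohom_add)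
  qed
qed

fun cup_power :: "'a topology \<Rightarrow> 'a cochain \<Rightarrow> nat \<Rightarrow> 'a cochain" where
  "cup_power X w 0 = one_cochain X"
| "cup_power X w (Suc j) = cup X (cup_power X w j) w"

lemma cocycles_cup_power [simp]: "w \<in> cocycles X {} \<Longrightarrow> cup_power X w j \<in> cocycles X {}"
  by (induction j) (auto intro: cocycles_cup_left)

lemma cohom_power:
  assumes "w \<in> cocycles X {}"
  shows "cohom_class X {} w [^]\<^bsub>cohom X {}\<^esub> j = cohom_class X {} (cup_power X w j)"
proof (induction j)
  case 0
  then show ?case
    by (simp add: nat_pow_def cohom_one)
next
  case (Suc j)
  have "cohom_class X {} w [^]\<^bsub>cohom X {}\<^esub> Suc j
      = cohom_class X {} w [^]\<^bsub>cohom X {}\<^esub> j \<otimes>\<^bsub>cohom X {}\<^esub> cohom_class X {} w"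
    by (simp add: nat_pow_def)
  then show ?case
    using Suc assms by (simp add: cohom_mult)
qed

lemma pullback_cup_power:
  assumes "continuous_map X Y f"
  shows "cochain_pullback X f (cup_power Y w j) = cup_power X (cochain_pullback X f w) j"
  by (induction j) (auto simp: pullback_one pullback_cup assms)

lemma carrier_cohom_even:
  "carrier (cohom_even X S) = cohom_class X S ` {c \<in> cocycles X S. \<forall>k. odd k \<longrightarrow> c k = 0}"
  by (simp add: cohom_even_def carrier_cocycle_ring zero_cochain_eq)

lemma cohom_even_simps:
  "x \<otimes>\<^bsub>cohom_even X S\<^esub> y = x \<otimes>\<^bsub>cohom X S\<^esub> y" "x \<oplus>\<^bsub>cohom_even X S\<^esub> y = x \<oplus>\<^bsub>cohom X S\<^esub> y"
  "\<one>\<^bsub>cohom_even X S\<^esub> = \<one>\<^bsub>cohom X S\<^esub>" "\<zero>\<^bsub>cohom_even X S\<^esub> = \<zero>\<^bsub>cohom X S\<^esub>"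
  by (auto simp: cohom_even_def)

lemma cohom_deg_alt: "cohom_deg X S n = cohom_class X S ` {c \<in> cocycles X S. homogeneous n c}"
  by (simp add: cohom_deg_def carrier_cocycle_ring zero_cochain_eq homogeneous_def)

section \<open>Homotopy invariance\<close>

lemma standard_simplex_iff:
  "x \<in> standard_simplex n \<longleftrightarrow> (\<forall>i. 0 \<le> x i) \<and> (\<forall>i>n. x i = 0) \<and> (\<Sum>i\<le>n. x i) = 1"
proof -
  have "x i \<le> 1" if "\<forall>i. 0 \<le> x i" "\<forall>i>n. x i = 0" "(\<Sum>i\<le>n. x i) = 1" for i
  proof (cases "i \<le> n")
    case True
    then have "x i \<le> (\<Sum>i\<le>n. x i)"
      using that by (intro member_le_sum) auto
    then show ?thesis using that by simp
  qed (use that in auto)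
  then show ?thesis
    unfolding standard_simplex_def by blast
qed

text \<open>The degeneracy of the standard simplex that merges the vertices i and i + 1 into the
  vertex i.\<close>

definition degen :: "nat \<Rightarrow> (nat \<Rightarrow> real) \<Rightarrow> nat \<Rightarrow> real" where
  "degen i x = (\<lambda>j. if j < i then x j else if j = i then x i + x (Suc i) else x (Suc j))"

lemma sum_degen: "(\<Sum>j\<le>m. degen i x j) = (if m < i then \<Sum>j\<le>m. x j else \<Sum>j\<le>Suc m. x j)"
  by (induction m) (auto simp: degen_def not_less_eq less_Suc_eq)

lemma degen_in: "\<lbrakk>i \<le> n; x \<in> standard_simplex (Suc n)\<rbrakk> \<Longrightarrow> degen i x \<in> standard_simplex n"
  unfolding standard_simplex_iff sum_degen by (auto simp: degen_def)

text \<open>Partial sums of barycentric coordinates are the time coordinate of the prism simplices,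
  so this governs how time behaves under faces.\<close>

lemma sum_simplical_face:
  "(\<Sum>j\<le>i. simplical_face k x j) = (if k \<le> i then \<Sum>j<i. x j else \<Sum>j\<le>i. x j)"
  for x :: "nat \<Rightarrow> real"
  by (induction i) (auto simp: simplical_face_def not_le le_Suc_eq simp flip: lessThan_Suc_atMost)

text \<open>The i-th top simplex in the standard triangulation of the cylinder over
  \<open>s\<close>: its vertices 0, ..., i lie at time 0, the others at time 1, and the vertex i of
  \<open>s\<close> occurs at both ends.\<close>

definition prism_simplex ::
    "(real \<times> 'a \<Rightarrow> 'b) \<Rightarrow> nat \<Rightarrow> nat \<Rightarrow> ((nat \<Rightarrow> real) \<Rightarrow> 'a) \<Rightarrow> (nat \<Rightarrow> real) \<Rightarrow> 'b" where
  "prism_simplex h n i s = restrict (\<lambda>x. h (1 - (\<Sum>j\<le>i. x j), s (degen i x))) (standard_simplex (Suc n))"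

text \<open>The dual of the prism operator on chains; it lowers the degree of a cochain by
  one.\<close>

definition prism :: "'a topology \<Rightarrow> (real \<times> 'a \<Rightarrow> 'b) \<Rightarrow> 'b cochain \<Rightarrow> 'a cochain" where
  "prism X h c = (\<lambda>n s. if singular_simplex n X s then \<Sum>i\<le>n. c (Suc n) (prism_simplex h n i s) else 0)"

lemma simplex_partial_sum:
  assumes "x \<in> standard_simplex n" "i \<le> n"
  shows "(\<Sum>j\<le>i. x j) \<in> {0..1}"
proof -
  have "(\<Sum>j\<le>i. x j) \<le> (\<Sum>j\<le>n. x j)"
    using assms by (intro sum_mono2) (auto simp: standard_simplex_iff)
  then show ?thesis
    using assms by (auto simp: standard_simplex_iff intro: sum_nonneg)
qed

lemma singular_simplex_prism:
  assumes h: "continuous_map (prod_topology (top_of_set {0..1}) X) Y h"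
    and s: "singular_simplex n X s" and i: "i \<le> n"
  shows "singular_simplex (Suc n) Y (prism_simplex h n i s)"
proof -
  let ?D = "\<lambda>n. subtopology (powertop_real UNIV) (standard_simplex n)"
  have "continuous_map (powertop_real UNIV) euclideanreal (\<lambda>x. 1 - (\<Sum>j\<le>i. x j))"
    by (intro continuous_intros) (auto intro: continuous_map_product_projection)
  then have "continuous_map (?D (Suc n)) (top_of_set {0..1}) (\<lambda>x. 1 - (\<Sum>j\<le>i. x j))"
    using simplex_partial_sum[of _ "Suc n" i] i
    by (force simp: continuous_map_in_subtopology continuous_map_from_subtopology)
  moreover have "continuous_map (powertop_real UNIV) (powertop_real UNIV) (degen i)"
    unfolding continuous_map_componentwise_UNIV degen_def
    by (auto intro!: continuous_intros continuous_map_product_projection)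
  then have "continuous_map (?D (Suc n)) (?D n) (degen i)"
    using degen_in[OF i] by (auto simp: continuous_map_in_subtopology continuous_map_from_subtopology)
  then have "continuous_map (?D (Suc n)) X (\<lambda>x. s (degen i x))"
    using s continuous_map_compose unfolding singular_simplex_def comp_def by blast
  ultimately have "continuous_map (?D (Suc n)) (prod_topology (top_of_set {0..1}) X)
      (\<lambda>x. (1 - (\<Sum>j\<le>i. x j), s (degen i x)))"
    by (simp add: continuous_map_pairwise comp_def)
  then have "continuous_map (?D (Suc n)) Y (\<lambda>x. h (1 - (\<Sum>j\<le>i. x j), s (degen i x)))"
    using continuous_map_compose[OF _ h] by (simp add: comp_def)
  then show ?thesis
    unfolding singular_simplex_def prism_simplex_def by (auto intro: continuous_map_eq)
qed

lemma prism_simplex_image: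
  assumes "i \<le> n"
  shows "prism_simplex h n i s ` standard_simplex (Suc n) \<subseteq> h ` ({0..1} \<times> s ` standard_simplex n)"
  using simplex_partial_sum[of _ "Suc n" i] degen_in[OF assms] assms
  by (fastforce simp: prism_simplex_def)

lemma prism_in_cochains:
  assumes "h ` ({0..1} \<times> (topspace X \<inter> S)) \<subseteq> T" and c: "c \<in> cochains Y T"
  shows "prism X h c \<in> cochains X S"
proof -
  obtain N where N: "\<And>n. N < n \<Longrightarrow> c n = 0"
    using c cochains_bounded by blast
  show ?thesis
  proof (rule cochainsI[where N=N])
    fix n s assume s: "singular_simplex n X s" "s ` standard_simplex n \<subseteq> S"
    have "c (Suc n) (prism_simplex h n i s) = 0" if "i \<le> n" for i
    proof (rule cochainsD(2)[OF c])
      have "h ` ({0..1} \<times> s ` standard_simplex n) \<subseteq> T"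
        using assms(1) s singular_simplex_image[OF s(1)] by blast
      then show "prism_simplex h n i s ` standard_simplex (Suc n) \<subseteq> T"
        using prism_simplex_image[OF that, of h s] by (rule order_trans[rotated])
    qed
    then show "prism X h c n s = 0"
      by (simp add: prism_def)
  qed (auto simp: prism_def N fun_eq_iff zero_fun_apply)
qed

text \<open>Deleting a vertex before the doubled one leaves a prism simplex over a face of
  \<open>s\<close>. Such side walls make up the coboundary of the prism in the homotopy
  formula.\<close>

lemma prism_face_less:
  assumes "k < i" "i \<le> Suc n"
  shows "singular_face (Suc (Suc n)) k (prism_simplex h (Suc n) i s)
       = prism_simplex h n (i - 1) (singular_face (Suc n) k s)"
proof -
  have 1: "degen i (simplical_face k x) = simplical_face k (degen (i - 1) x)" for x
    using assms by (auto simp: degen_def simplical_face_def fun_eq_iff)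
  have 2: "{..<i} = {..i - 1}"
    using assms by auto
  show ?thesis
  proof
    fix x
    show "singular_face (Suc (Suc n)) k (prism_simplex h (Suc n) i s) x
       = prism_simplex h n (i - 1) (singular_face (Suc n) k s) x"
      using assms degen_in[of "i - 1" n x]
      by (auto simp: singular_face_alt prism_simplex_def simplical_face_in sum_simplical_face 1 2
          simp del: One_nat_def)
  qed
qed

lemma prism_face_greater:
  assumes "Suc i < k" "k \<le> Suc (Suc n)"
  shows "singular_face (Suc (Suc n)) k (prism_simplex h (Suc n) i s)
       = prism_simplex h n i (singular_face (Suc n) (k - 1) s)"
proof -
  have 1: "degen i (simplical_face k x) = simplical_face (k - 1) (degen i x)" for x
    using assms by (auto simp: degen_def simplical_face_def fun_eq_iff)
  show ?thesis
  proof
    fix x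
    show "singular_face (Suc (Suc n)) k (prism_simplex h (Suc n) i s) x
       = prism_simplex h n i (singular_face (Suc n) (k - 1) s) x"
      using assms degen_in[of i n x]
      by (auto simp: singular_face_alt prism_simplex_def simplical_face_in sum_simplical_face 1
          simp del: One_nat_def)
  qed
qed

text \<open>The common face of the prism simplices i - 1 and i: vertices below i at time 0, the
  others at time 1. The indices 0 and n + 1 give the two ends of the cylinder.\<close>

definition prism_mid :: "(real \<times> 'a \<Rightarrow> 'b) \<Rightarrow> nat \<Rightarrow> nat \<Rightarrow> ((nat \<Rightarrow> real) \<Rightarrow> 'a) \<Rightarrow> (nat \<Rightarrow> real) \<Rightarrow> 'b" where
  "prism_mid h n i s = restrict (\<lambda>x. h (1 - (\<Sum>j<i. x j), s x)) (standard_simplex n)"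

lemma prism_face_mid:
  assumes "i \<le> n" "k = i \<or> k = Suc i"
  shows "singular_face (Suc n) k (prism_simplex h n i s) = prism_mid h n k s"
proof -
  have 1: "degen i (simplical_face k x) = x" for x
    using assms by (auto simp: degen_def simplical_face_def fun_eq_iff)
  have 2: "(\<Sum>j\<le>i. simplical_face k x j) = (\<Sum>j<k. x j)" for x :: "nat \<Rightarrow> real"
    using assms by (auto simp: sum_simplical_face lessThan_Suc_atMost)
  show ?thesis
    using assms by (intro ext) (auto simp: singular_face_alt prism_simplex_def prism_mid_def simplical_face_in 1 2)
qed

lemma prism_mid_0: "prism_mid h n 0 s = simplex_map n (\<lambda>x. h (1, x)) s"
  and prism_mid_last: "prism_mid h n (Suc n) s = simplex_map n (\<lambda>x. h (0, x)) s"
  by (auto simp: prism_mid_def simplex_map_def fun_eq_iff standard_simplex_iff lessThan_Suc_atMost)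

lemma telescope_mod2: "(\<Sum>i\<le>n. f i + f (Suc i)) = f 0 + (f (Suc n) :: bit)"
  by (induction n) (auto simp: add.assoc simp flip: add.assoc[of "f (Suc _)" "f (Suc _)"])

lemma prism_homotopy:
  assumes h: "continuous_map (prod_topology (top_of_set {0..1}) X) Y h"
  shows "prism X h (coboundary Y c) + coboundary X (prism X h c)
    = cochain_pullback X (\<lambda>x. h (0, x)) c + cochain_pullback X (\<lambda>x. h (1, x)) c"
proof (intro ext)
  fix n s
  show "(prism X h (coboundary Y c) + coboundary X (prism X h c)) n s
    = (cochain_pullback X (\<lambda>x. h (0, x)) c + cochain_pullback X (\<lambda>x. h (1, x)) c) n s"
  proof (cases "singular_simplex n X s")
    case s: True
    define f where "f = (\<lambda>(i, k). c n (singular_face (Suc n) k (prism_simplex h n i s)))"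
    define q where "q k = c n (prism_mid h n k s)" for k
    \<comment> \<open>\<open>?A\<close> and \<open>?C\<close> index the side walls. The remaining
      pairs have k = i or k = i + 1; these inner faces telescope to the two ends.\<close>
    let ?A = "{(i, k). k < i \<and> i \<le> n}" and ?C = "{(i, k). Suc i < k \<and> k \<le> Suc n}"
    have fin0: "finite ({..n} \<times> {..Suc n})"
      by simp
    have A: "?A \<subseteq> {..n} \<times> {..Suc n}" and C: "?C \<subseteq> {..n} \<times> {..Suc n}"
      by auto
    let ?M = "{..n} \<times> {..Suc n} - (?A \<union> ?C)"
    have "prism X h (coboundary Y c) n s = (\<Sum>i\<le>n. \<Sum>k\<le>Suc n. f (i, k))"
      using s singular_simplex_prism[OF h s]
      by (auto simp: prism_def coboundary_Suc f_def simp del: sum.atMost_Suc intro!: sum.cong)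
    also have "\<dots> = sum f ({..n} \<times> {..Suc n})"
      by (simp add: sum.cartesian_product del: sum.atMost_Suc)
    also have "\<dots> = sum f ?M + sum f (?A \<union> ?C)"
      using A C by (intro sum.subset_diff[OF _ fin0]) blast
    also have "sum f (?A \<union> ?C) = sum f ?A + sum f ?C"
      by (intro sum.union_disjoint finite_subset[OF A fin0] finite_subset[OF C fin0]) auto
    also have "sum f ?M = q 0 + q (Suc n)"
    proof -
      have "?M = (SIGMA i:{..n}. {i, Suc i})"
        by auto
      then have "sum f ?M = (\<Sum>i\<le>n. \<Sum>k\<in>{i, Suc i}. f (i, k))"
        by (subst sum.Sigma) auto
      also have "\<dots> = (\<Sum>i\<le>n. q i + q (Suc i))"
        by (intro sum.cong) (auto simp: f_def q_def prism_face_mid)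
      finally show ?thesis
        by (simp add: telescope_mod2)
    qed
    also have "sum f ?A + sum f ?C = coboundary X (prism X h c) n s"
    proof (cases n)
      case 0
      then have "?A = {}" "?C = {}"
        by auto
      then have "sum f ?A = 0" "sum f ?C = 0"
        by (metis sum.empty)+
      then show ?thesis
        by (simp add: 0 coboundary_def)
    next
      case (Suc m)
      define g where "g = (\<lambda>(k, i). c n (prism_simplex h m i (singular_face n k s)))"
      let ?A' = "{(k, i). k \<le> i \<and> i \<le> m}" and ?C' = "{(k, i). i < k \<and> k \<le> n}"
      have fin1: "finite ({..n} \<times> {..m})"
        by simp
      have A': "?A' \<subseteq> {..n} \<times> {..m}" and C': "?C' \<subseteq> {..n} \<times> {..m}"
        using Suc by auto
      \<comment> \<open>When the face of \<open>s\<close> is taken first, a vertex deleted before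
        the doubled one lowers the index of the doubled vertex, and one deleted after it lowers the
        index of the face. The two ranges then fill the whole rectangle.\<close>
      have "sum f ?A = sum g ?A'"
        by (rule sum.reindex_bij_witness[where i="\<lambda>(k, i). (Suc i, k)" and j="\<lambda>(i, k). (k, i - 1)"])
           (auto simp: f_def g_def Suc prism_face_less simp del: One_nat_def)
      moreover have "sum f ?C = sum g ?C'"
        by (rule sum.reindex_bij_witness[where i="\<lambda>(k, i). (i, Suc k)" and j="\<lambda>(i, k). (k - 1, i)"])
           (auto simp: f_def g_def Suc prism_face_greater simp del: One_nat_def)
      ultimately have "sum f ?A + sum f ?C = sum g ?A' + sum g ?C'"
        by simp
      also have "\<dots> = sum g (?A' \<union> ?C')"
        by (intro sum.union_disjoint[symmetric] finite_subset[OF A' fin1] finite_subset[OF C' fin1]) auto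
      also have "?A' \<union> ?C' = {..n} \<times> {..m}"
        using Suc by auto
      also have "sum g ({..n} \<times> {..m}) = (\<Sum>k\<le>n. \<Sum>i\<le>m. g (k, i))"
        by (simp add: sum.cartesian_product)
      also have "\<dots> = coboundary X (prism X h c) n s"
        using s by (auto simp: Suc coboundary_Suc prism_def g_def singular_simplex_face
            simp del: sum.atMost_Suc intro!: sum.cong)
      finally show ?thesis .
    qed
    finally have "prism X h (coboundary Y c) n s = q 0 + q (Suc n) + coboundary X (prism X h c) n s" .
    then have "(prism X h (coboundary Y c) + coboundary X (prism X h c)) n s = q (Suc n) + q 0"
      by (simp add: add.assoc add.commute plus_fun_apply)
    then show ?thesis
      using s by (simp add: plus_fun_apply q_def prism_mid_0 prism_mid_last cochain_pullback_def)
  next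
    case False
    then show ?thesis
      by (auto simp: plus_fun_apply prism_def coboundary_def cochain_pullback_def)
  qed
qed

theorem homotopy_invariance:
  fixes h :: "real \<times> 'a \<Rightarrow> 'b"
  assumes h: "continuous_map (prod_topology (top_of_set {0..1}) X) Y h"
    and hS: "h ` ({0..1} \<times> (topspace X \<inter> S)) \<subseteq> T" and c: "c \<in> cocycles Y T"
  shows "cochain_pullback X (\<lambda>x. h (0, x)) c + cochain_pullback X (\<lambda>x. h (1, x)) c \<in> coboundaries X S"
proof (rule coboundariesI)
  show "prism X h c \<in> cochains X S"
    using prism_in_cochains[OF hS] c cocycles_cochains by blast
  have "prism X h 0 = 0"
    by (auto simp: prism_def fun_eq_iff zero_fun_apply)
  then show "cochain_pullback X (\<lambda>x. h (0, x)) c + cochain_pullback X (\<lambda>x. h (1, x)) c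
      = coboundary X (prism X h c)"
    using prism_homotopy[OF h, of c] cocyclesD[OF c] by simp
qed

section \<open>Lifting simplices through a free double cover\<close>

text \<open>The weights make this pairing jointly continuous in the product topology. Its sign picks one of
  two antipodal lifts near a given one.\<close>

definition weighted_inner :: "(nat \<Rightarrow> real) \<Rightarrow> (nat \<Rightarrow> real) \<Rightarrow> real" where
  "weighted_inner a b = suminf (\<lambda>i. a i * b i / 2 ^ i)"

lemma EC_finite_support: "e \<in> topspace EC \<Longrightarrow> finite {i. e i \<noteq> 0}"
  and EC_norm: "e \<in> topspace EC \<Longrightarrow> (\<Sum>i | e i \<noteq> 0. (e i)\<^sup>2) = 1"
  by (auto simp: EC_def)

lemma continuous_map_in: "\<lbrakk>continuous_map X Y f; x \<in> topspace X\<rbrakk> \<Longrightarrow> f x \<in> topspace Y"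
  by (auto simp: continuous_map_def)

lemma openin_prodE:
  assumes "openin (prod_topology X Y) W" "(x, y) \<in> W"
  obtains U V where "openin X U" "openin Y V" "x \<in> U" "y \<in> V" "U \<times> V \<subseteq> W"
proof -
  have "\<exists>U V. openin X U \<and> openin Y V \<and> x \<in> U \<and> y \<in> V \<and> U \<times> V \<subseteq> W"
    using assms by (simp only: openin_prod_topology_alt)
  then show ?thesis
    using that by blast
qed

lemma EC_nonzero:
  assumes "e \<in> topspace EC"
  obtains i where "e i \<noteq> 0"
proof -
  have "{i. e i \<noteq> 0} \<noteq> {}"
    using EC_norm[OF assms] by force
  then show ?thesis using that by blast
qed

lemma EC_bounded:
  assumes "e \<in> topspace EC"
  shows "\<bar>e i\<bar> \<le> 1"
proof (cases "e i = 0")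
  case False
  then have "(e i)\<^sup>2 \<le> (\<Sum>i | e i \<noteq> 0. (e i)\<^sup>2)"
    using EC_finite_support[OF assms] by (intro member_le_sum) auto
  then show ?thesis
    using EC_norm[OF assms] abs_square_le_1 by auto
qed auto

lemma antipode_ne: "e \<in> topspace EC \<Longrightarrow> antipode e \<noteq> e"
  by (metis EC_nonzero antipode_def equal_neg_zero)

lemma antipode_antipode [simp]: "antipode (antipode e) = e"
  by (auto simp: antipode_def)

lemma antipode_in_EC: "e \<in> topspace EC \<Longrightarrow> antipode e \<in> topspace EC"
  by (auto simp: EC_def antipode_def)

lemma weighted_inner_summable:
  assumes "\<And>i. \<bar>a i\<bar> \<le> 1" "\<And>i. \<bar>b i\<bar> \<le> 1"
  shows "summable (\<lambda>i. a i * b i / 2 ^ i :: real)"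
proof (rule summable_comparison_test')
  show "summable (\<lambda>i. (1/2::real) ^ i)"
    by (rule summable_geometric) simp
  show "norm (a i * b i / 2 ^ i) \<le> (1/2) ^ i" if "i \<ge> 0" for i
    using mult_mono[OF assms(1)[of i] assms(2)[of i]]
    by (simp add: abs_mult power_divide divide_right_mono)
qed

lemma weighted_inner_self_pos:
  assumes "e \<in> topspace EC"
  shows "0 < weighted_inner e e"
proof -
  obtain i where i: "e i \<noteq> 0"
    using EC_nonzero[OF assms] .
  show ?thesis
    unfolding weighted_inner_def
    using weighted_inner_summable[of e e] EC_bounded[OF assms] i
    by (intro suminf_pos2[of _ i]) (auto intro!: divide_pos_pos simp: zero_less_mult_iff linorder_neq_iff)
qed

lemma weighted_inner_antipode: "weighted_inner (antipode a) b = - weighted_inner a b"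
  if "a \<in> topspace EC" "b \<in> topspace EC"
  using suminf_minus[OF weighted_inner_summable[of a b]] EC_bounded that
  by (simp add: weighted_inner_def antipode_def)

text \<open>Coordinates of points of \<open>EC\<close> are bounded by 1, so the weights 1/2^i
  dominate the series. It converges uniformly, and its partial sums depend on finitely many
  coordinates.\<close>

lemma continuous_map_weighted_inner:
  "continuous_map (prod_topology EC EC) euclideanreal (\<lambda>(a, b). weighted_inner a b)"
proof -
  define C :: "(nat \<Rightarrow> real) set" where "C = {a. \<forall>i. \<bar>a i\<bar> \<le> 1}"
  have "uniform_limit (C \<times> C) (\<lambda>n p. \<Sum>i<n. fst p i * snd p i / 2 ^ i)
      (\<lambda>p. suminf (\<lambda>i. fst p i * snd p i / 2 ^ i)) sequentially"
  proof (rule Weierstrass_m_test)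
    show "summable (\<lambda>i. (1/2::real) ^ i)"
      by (rule summable_geometric) simp
    fix n p assume "p \<in> C \<times> C"
    then have "\<bar>fst p n\<bar> * \<bar>snd p n\<bar> \<le> 1 * 1"
      by (intro mult_mono) (auto simp: C_def)
    then show "norm (fst p n * snd p n / 2 ^ n) \<le> (1/2) ^ n"
      by (simp add: abs_mult power_divide divide_right_mono)
  qed
  moreover have "continuous_on UNIV (\<lambda>x::nat \<Rightarrow> real. x i)" for i
    by (rule continuous_on_product_coordinates)
  then have "continuous_on (C \<times> C) (\<lambda>p. \<Sum>i<n. fst p i * snd p i / 2 ^ i)" for n
    by (intro continuous_intros continuous_on_compose2[of UNIV "\<lambda>x. x _" _ fst]
        continuous_on_compose2[of UNIV "\<lambda>x. x _" _ snd]) auto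
  ultimately have "continuous_on (C \<times> C) (\<lambda>p. suminf (\<lambda>i. fst p i * snd p i / 2 ^ i))"
    by (intro uniform_limit_theorem) (auto intro: always_eventually)
  then have "continuous_on (topspace EC \<times> topspace EC) (\<lambda>p. suminf (\<lambda>i. fst p i * snd p i / 2 ^ i))"
    by (rule continuous_on_subset) (auto simp: C_def EC_bounded)
  moreover have "prod_topology EC EC = top_of_set (topspace EC \<times> topspace EC)"
  proof -
    have "EC = top_of_set (topspace EC)"
      by (simp add: EC_def euclidean_product_topology)
    then show ?thesis
      by (metis prod_topology_euclidean subtopology_Times)
  qed
  ultimately show ?thesis
    by (simp add: weighted_inner_def case_prod_unfold)
qed

text \<open>A space with involution and an equivariant map to the sphere. The map makes the action
  free, and the sign of the pairing of images in the sphere takes the place of local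
  trivializations. The instances are \<open>EC\<close> itself and the product of \<open>EC\<close>
  with a space with involution.\<close>

locale double_cover =
  fixes E :: "'e topology" and T :: "'e \<Rightarrow> 'e" and \<pi> :: "'e \<Rightarrow> nat \<Rightarrow> real"
  assumes continuous_T: "continuous_map E E T"
    and T_T: "x \<in> topspace E \<Longrightarrow> T (T x) = x"
    and continuous_\<pi>: "continuous_map E EC \<pi>"
    and \<pi>_T: "x \<in> topspace E \<Longrightarrow> \<pi> (T x) = antipode (\<pi> x)"
begin

definition q :: "'e \<Rightarrow> 'e set" where "q x = {x, T x}"

definition B :: "'e set topology" where "B = quotient_topology E q"

lemma T_in: "x \<in> topspace E \<Longrightarrow> T x \<in> topspace E"
  using continuous_T by (rule continuous_map_in)

lemma \<pi>_in: "x \<in> topspace E \<Longrightarrow> \<pi> x \<in> topspace EC"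
  using continuous_\<pi> by (rule continuous_map_in)

lemma T_ne: "x \<in> topspace E \<Longrightarrow> T x \<noteq> x"
  using \<pi>_T \<pi>_in antipode_ne by metis

lemma q_eq_iff: "\<lbrakk>x \<in> topspace E; y \<in> topspace E\<rbrakk> \<Longrightarrow> q x = q y \<longleftrightarrow> y = x \<or> y = T x"
  using T_T by (auto simp: q_def doubleton_eq_iff)

lemma q_T: "x \<in> topspace E \<Longrightarrow> q (T x) = q x"
  using T_T by (auto simp: q_def)

lemma quotient_map_q: "quotient_map E B q"
  unfolding B_def by (rule quotient_map_quotient_topology)

lemma topspace_B: "topspace B = q ` topspace E"
  using quotient_map_q by (simp add: quotient_imp_surjective_map)

lemma continuous_q: "continuous_map E B q"
  using quotient_map_q quotient_imp_continuous_map by blast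

lemma openin_q_image:
  assumes "openin E U"
  shows "openin B (q ` U)"
proof -
  have "{x \<in> topspace E. q x \<in> q ` U} = U \<union> {x \<in> topspace E. T x \<in> U}"
    using openin_subset[OF assms] q_eq_iff q_T T_T by blast
  moreover have "openin E \<dots>"
    using assms continuous_T by (intro openin_Un openin_continuous_map_preimage)
  ultimately show ?thesis
    using openin_subset[OF assms] by (auto simp: B_def openin_quotient_topology)
qed

section \<open>Choice of a sheet by the sign of the pairing\<close>

abbreviation \<phi> :: "'e \<Rightarrow> 'e \<Rightarrow> real" where "\<phi> x y \<equiv> weighted_inner (\<pi> x) (\<pi> y)"

lemma \<phi>_T: "\<lbrakk>x \<in> topspace E; y \<in> topspace E\<rbrakk> \<Longrightarrow> \<phi> (T x) y = - \<phi> x y"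
  by (simp add: \<pi>_T \<pi>_in weighted_inner_antipode)

lemma continuous_\<phi>:
  assumes "continuous_map Z E f" "continuous_map Z E g"
  shows "continuous_map Z euclideanreal (\<lambda>z. \<phi> (f z) (g z))"
proof -
  have "continuous_map Z (prod_topology EC EC) (\<lambda>z. (\<pi> (f z), \<pi> (g z)))"
    using continuous_map_compose[OF assms(1) continuous_\<pi>] continuous_map_compose[OF assms(2) continuous_\<pi>]
    by (simp add: continuous_map_pairwise comp_def)
  then show ?thesis
    using continuous_map_compose[OF _ continuous_map_weighted_inner] by (force simp: comp_def)
qed

text \<open>The pairing is odd under \<open>T\<close>. Where its value against the old lift
  \<open>L\<close> never vanishes, exactly one of the two preimages of \<open>s z\<close> pairs
  positively with \<open>L z\<close>, and this preimage is the new lift.\<close>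

lemma lift_step:
  assumes L: "continuous_map Z E L" and s: "continuous_map Z B s"
    and ne: "\<And>z x. \<lbrakk>z \<in> topspace Z; x \<in> topspace E; q x = s z\<rbrakk> \<Longrightarrow> \<phi> x (L z) \<noteq> 0"
  obtains M where "continuous_map Z E M" "\<And>z. z \<in> topspace Z \<Longrightarrow> q (M z) = s z"
proof -
  have L_in: "L z \<in> topspace E" if "z \<in> topspace Z" for z
    using L that by (rule continuous_map_in)
  have s_in: "s z \<in> q ` topspace E" if "z \<in> topspace Z" for z
    using continuous_map_in[OF s that] by (simp add: topspace_B)
  have ex1: "\<exists>!x. x \<in> topspace E \<and> q x = s z \<and> \<phi> x (L z) > 0" if z: "z \<in> topspace Z" for z
  proof -
    obtain x where x: "x \<in> topspace E" "q x = s z"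
      using s_in[OF z] by auto
    then have "\<phi> x (L z) \<noteq> 0"
      using ne z by blast
    then have "\<exists>x. x \<in> topspace E \<and> q x = s z \<and> \<phi> x (L z) > 0"
      using x \<phi>_T[OF x(1) L_in[OF z]] T_in q_T by (metis linorder_neqE_linordered_idom neg_0_less_iff_less)
    moreover have "x = y" if "x \<in> topspace E" "q x = s z" "\<phi> x (L z) > 0"
      "y \<in> topspace E" "q y = s z" "\<phi> y (L z) > 0" for x y
      using that q_eq_iff[OF that(1,4)] \<phi>_T[OF that(1) L_in[OF z]] by auto
    ultimately show ?thesis
      by blast
  qed
  define M where "M z = (THE x. x \<in> topspace E \<and> q x = s z \<and> \<phi> x (L z) > 0)" for z
  have M: "M z \<in> topspace E \<and> q (M z) = s z \<and> \<phi> (M z) (L z) > 0" if "z \<in> topspace Z" for z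
    unfolding M_def by (rule theI') (rule ex1[OF that])
  have "continuous_map Z E M"
    unfolding continuous_map
  proof (intro conjI allI impI)
    show "M ` topspace Z \<subseteq> topspace E"
      using M by blast
    fix U assume U: "openin E U"
    let ?W = "{z \<in> topspace Z. M z \<in> U}"
    show "openin Z ?W"
    proof (subst openin_subopen, intro ballI)
      fix z assume "z \<in> ?W"
      then have z: "z \<in> topspace Z" "M z \<in> U" by auto
      let ?O = "{p \<in> topspace (prod_topology E Z). \<phi> (fst p) (L (snd p)) \<in> {0<..}} \<inter> U \<times> topspace Z"
      have "continuous_map (prod_topology E Z) E (\<lambda>p. L (snd p))"
        using continuous_map_compose[OF continuous_map_snd L] by (simp add: comp_def)
      then have "continuous_map (prod_topology E Z) euclideanreal (\<lambda>p. \<phi> (fst p) (L (snd p)))"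
        by (intro continuous_\<phi> continuous_map_fst)
      then have "openin (prod_topology E Z) {p \<in> topspace (prod_topology E Z). \<phi> (fst p) (L (snd p)) \<in> {0<..}}"
        by (rule openin_continuous_map_preimage) simp
      moreover have "openin (prod_topology E Z) (U \<times> topspace Z)"
        using U by (simp add: openin_prod_Times_iff)
      ultimately have "openin (prod_topology E Z) ?O"
        by (rule openin_Int)
      moreover have "(M z, z) \<in> ?O"
        using z M by auto
      ultimately obtain U' V' where UV: "openin E U'" "openin Z V'" "M z \<in> U'" "z \<in> V'" "U' \<times> V' \<subseteq> ?O"
        by (rule openin_prodE)
      \<comment> \<open>On this neighbourhood \<open>s z'\<close> has a preimage in
        \<open>U'\<close> that pairs positively with \<open>L z'\<close>; by uniqueness it is
        \<open>M z'\<close>, which therefore lies in \<open>U\<close>.\<close>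
      let ?V = "V' \<inter> {z' \<in> topspace Z. s z' \<in> q ` U'}"
      have "openin Z ?V"
        using UV s by (intro openin_Int openin_continuous_map_preimage[OF s] openin_q_image)
      moreover have "z \<in> ?V"
        using UV z M[OF z(1)] by (metis (mono_tags, lifting) IntI imageI mem_Collect_eq)
      moreover have "?V \<subseteq> ?W"
      proof
        fix z' assume "z' \<in> ?V"
        then obtain x where x: "z' \<in> V'" "z' \<in> topspace Z" "x \<in> U'" "s z' = q x" by auto
        then have "(x, z') \<in> ?O"
          using UV by blast
        then have "M z' = x" "x \<in> U"
          using M[OF x(2)] ex1[OF x(2)] x by auto
        then show "z' \<in> ?W"
          using x by simp
      qed
      ultimately show "\<exists>V. openin Z V \<and> z \<in> V \<and> V \<subseteq> ?W"
        by blast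
    qed
  qed
  then show ?thesis
    using that M by blast
qed

text \<open>Near each point of \<open>K\<close>, any two values of \<open>f\<close> have preimages
  close to one common point, hence with positive pairing. A Lebesgue number of this cover is a
  uniform step size.\<close>

lemma lift_step_size:
  fixes K :: "'k::metric_space set"
  assumes K: "compact K" and f: "continuous_map (top_of_set K) B f"
  obtains \<delta> where "\<delta> > 0"
    "\<And>k k' x x'. \<lbrakk>k \<in> K; k' \<in> K; dist k k' < \<delta>; x \<in> topspace E; x' \<in> topspace E; q x = f k; q x' = f k'\<rbrakk>
       \<Longrightarrow> \<phi> x x' \<noteq> 0"
proof -
  have "\<exists>A. open A \<and> k \<in> A \<and> (\<forall>k1\<in>A\<inter>K. \<forall>k2\<in>A\<inter>K. \<exists>x\<in>topspace E. \<exists>y\<in>topspace E. q x = f k1 \<and> q y = f k2 \<and> \<phi> x y > 0)"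
    if k: "k \<in> K" for k
  proof -
    obtain e where e: "e \<in> topspace E" "q e = f k"
      using continuous_map_in[OF f, of k] k by (auto simp: topspace_B)
    let ?O = "{p \<in> topspace (prod_topology E E). \<phi> (fst p) (snd p) \<in> {0<..}}"
    have "openin (prod_topology E E) ?O"
      by (intro openin_continuous_map_preimage[OF continuous_\<phi>] continuous_map_fst continuous_map_snd) auto
    moreover have "(e, e) \<in> ?O"
      using e \<pi>_in weighted_inner_self_pos by auto
    ultimately obtain U V where UV: "openin E U" "openin E V" "e \<in> U" "e \<in> V" "U \<times> V \<subseteq> ?O"
      by (rule openin_prodE)
    have "openin (top_of_set K) {k \<in> topspace (top_of_set K). f k \<in> q ` (U \<inter> V)}"
      using UV by (intro openin_continuous_map_preimage[OF f] openin_q_image) blast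
    then obtain A where A: "open A" "{k \<in> K. f k \<in> q ` (U \<inter> V)} = K \<inter> A"
      by (auto simp: openin_open)
    have "\<exists>x\<in>topspace E. \<exists>y\<in>topspace E. q x = f k1 \<and> q y = f k2 \<and> \<phi> x y > 0"
      if "k1 \<in> A \<inter> K" "k2 \<in> A \<inter> K" for k1 k2
    proof -
      have "k1 \<in> {k \<in> K. f k \<in> q ` (U \<inter> V)}" "k2 \<in> {k \<in> K. f k \<in> q ` (U \<inter> V)}"
        unfolding A(2) using that by auto
      then obtain x y where "x \<in> U \<inter> V" "y \<in> U \<inter> V" "f k1 = q x" "f k2 = q y"
        by auto
      moreover from this have "(x, y) \<in> ?O"
        using UV(5) by blast
      ultimately show ?thesis
        by (intro bexI[of _ x] bexI[of _ y]) auto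
    qed
    moreover have "k \<in> A"
    proof -
      have "k \<in> {k \<in> K. f k \<in> q ` (U \<inter> V)}"
        using k e(2)[symmetric] UV(3,4) by auto
      then show ?thesis
        unfolding A(2) by simp
    qed
    ultimately show ?thesis
      using A(1) by blast
  qed
  then obtain A where A: "\<And>k. k \<in> K \<Longrightarrow> open (A k)" "\<And>k. k \<in> K \<Longrightarrow> k \<in> A k"
    "\<And>k k1 k2. \<lbrakk>k \<in> K; k1 \<in> A k \<inter> K; k2 \<in> A k \<inter> K\<rbrakk> \<Longrightarrow>
       \<exists>x\<in>topspace E. \<exists>y\<in>topspace E. q x = f k1 \<and> q y = f k2 \<and> \<phi> x y > 0"
    by metis
  show ?thesis
  proof (cases "K = {}")
    case True
    then show ?thesis using that[of 1] by auto
  next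
    case False
    obtain \<delta> where \<delta>: "\<delta> > 0" "\<And>S. \<lbrakk>S \<subseteq> K; diameter S < \<delta>\<rbrakk> \<Longrightarrow> \<exists>C\<in>A ` K. S \<subseteq> C"
      using Lebesgue_number_lemma[OF K, of "A ` K"] False A(1,2) by blast
    show ?thesis
    proof (rule that[OF \<delta>(1)])
      fix k k' x x'
      assume k: "k \<in> K" "k' \<in> K" "dist k k' < \<delta>"
        and x: "x \<in> topspace E" "x' \<in> topspace E" "q x = f k" "q x' = f k'"
      have "diameter {k, k'} < \<delta>"
      proof -
        have "diameter {k, k'} \<le> dist k k'"
          unfolding diameter_def by (simp only: insert_not_empty if_False)
            (rule cSUP_least, auto simp: dist_commute)
        then show ?thesis using k by simp
      qed
      then obtain c where "c \<in> K" "{k, k'} \<subseteq> A c"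
        using \<delta>(2)[of "{k, k'}"] k by auto
      then obtain y y' where y: "y \<in> topspace E" "y' \<in> topspace E" "q y = f k" "q y' = f k'" "\<phi> y y' > 0"
        using A(3)[of c k k'] k by auto
      have sym: "\<phi> a b = \<phi> b a" for a b
        by (simp add: weighted_inner_def mult.commute)
      \<comment> \<open>Passing to the other point of a fibre only changes the sign of the pairing,
        so it is nonzero for every choice of preimages.\<close>
      have "x = y \<or> x = T y" "x' = y' \<or> x' = T y'"
        using q_eq_iff[OF y(1) x(1)] q_eq_iff[OF y(2) x(2)] x y by auto
      moreover have "\<phi> (T y) y' = - \<phi> y y'" "\<phi> y (T y') = - \<phi> y y'"
        using \<phi>_T[OF y(1,2)] \<phi>_T[OF y(2,1)] sym[of y "T y'"] sym[of y y'] by simp_all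
      moreover have "\<phi> (T y) (T y') = - \<phi> y (T y')"
        using \<phi>_T[OF y(1) T_in[OF y(2)]] .
      ultimately show "\<phi> x x' \<noteq> 0"
        using y(5) by auto
    qed
  qed
qed

text \<open>The lift is continued from vertex 0 along the segments to all other points, in finitely many
  steps that are so short that the pairing does not vanish within one of them.\<close>

lemma simplex_lift_exists:
  assumes s: "singular_simplex n B s"
  obtains l where "singular_simplex n E l" "simplex_map n q l = s"
proof -
  define v :: "nat \<Rightarrow> real" where "v = (\<lambda>j. if j = 0 then 1 else 0)"
  have v: "v \<in> standard_simplex n"
    by (simp add: v_def)
  \<comment> \<open>The straight homotopy from the constant map at the vertex \<open>v\<close> to
    the identity of the simplex; at time 0 a constant lift is available.\<close>
  define r where "r = (\<lambda>(t::real, x) j. (1 - t) * v j + t * x j)"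
  let ?D = "top_of_set (standard_simplex n)"
  let ?K = "{0..1::real} \<times> standard_simplex n"
  have D: "?D = subtopology (powertop_real UNIV) (standard_simplex n)"
    by (simp add: euclidean_product_topology)
  have s_cont: "continuous_map ?D B s"
    using s by (simp add: singular_simplex_def D)
  have "compact (standard_simplex n)"
    using compactin_standard_simplex[of n] compactin_euclidean_iff[of "standard_simplex n"]
    unfolding euclidean_product_topology by simp
  then have K: "compact ?K"
    by (intro compact_Times) auto
  have r_in: "r p \<in> standard_simplex n" if "p \<in> ?K" for p
    using that convex_standard_simplex[OF v] by (auto simp: r_def)
  have "continuous_on ?K r"
    unfolding r_def case_prod_unfold
    by (intro continuous_on_coordinatewise_then_product continuous_intros
        continuous_on_compose2[OF continuous_on_product_coordinates continuous_on_snd]) auto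
  then have r_cont: "continuous_map (top_of_set ?K) ?D r"
    using r_in by (auto simp: continuous_map_in_subtopology)
  have "continuous_map (top_of_set ?K) B (s \<circ> r)"
    using continuous_map_compose[OF r_cont s_cont] .
  then obtain \<delta> where \<delta>: "\<delta> > 0"
    "\<And>k k' x x'. \<lbrakk>k \<in> ?K; k' \<in> ?K; dist k k' < \<delta>; x \<in> topspace E; x' \<in> topspace E;
       q x = (s \<circ> r) k; q x' = (s \<circ> r) k'\<rbrakk> \<Longrightarrow> \<phi> x x' \<noteq> 0"
    using lift_step_size[OF K] by blast
  obtain m where m: "m > 0" "1 / real m < \<delta>"
    using reals_Archimedean[OF \<delta>(1)] by (metis inverse_eq_divide zero_less_Suc)
  have slice: "continuous_map ?D ?D (\<lambda>x. r (t, x))" if "t \<in> {0..1}" for t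
  proof -
    have "continuous_map ?D (top_of_set ?K) (\<lambda>x. (t, x))"
      using that by (auto simp: continuous_map_in_subtopology intro!: continuous_intros)
    then show ?thesis
      using continuous_map_compose[OF _ r_cont, of ?D "\<lambda>x. (t, x)"] by (simp add: comp_def)
  qed
  have "\<exists>L. continuous_map ?D E L \<and> (\<forall>x\<in>standard_simplex n. q (L x) = s (r (real i / m, x)))"
    if "i \<le> m" for i
    using that
  proof (induction i)
    case 0
    obtain e where "e \<in> topspace E" "q e = s v"
      using continuous_map_in[OF s_cont, of v] v by (auto simp: topspace_B)
    then show ?case
      by (intro exI[of _ "\<lambda>x. e"]) (auto simp: r_def)
  next
    case (Suc i)
    then obtain L where L: "continuous_map ?D E L"
      "\<And>x. x \<in> standard_simplex n \<Longrightarrow> q (L x) = s (r (real i / m, x))"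
      by auto
    let ?t = "real i / m" and ?t' = "real (Suc i) / m"
    have t: "?t \<in> {0..1}" "?t' \<in> {0..1}" and dt: "\<bar>?t' - ?t\<bar> < \<delta>"
      using Suc.prems m by (auto simp: field_simps)
    have s': "continuous_map ?D B (\<lambda>x. s (r (?t', x)))"
      using continuous_map_compose[OF slice[OF t(2)] s_cont] by (simp add: comp_def)
    obtain M where "continuous_map ?D E M" "\<And>z. z \<in> topspace ?D \<Longrightarrow> q (M z) = s (r (?t', z))"
    proof (rule lift_step[OF L(1) s'])
      fix z x assume z: "z \<in> topspace ?D" and x: "x \<in> topspace E" "q x = s (r (?t', z))"
      have "L z \<in> topspace E"
        using L(1) z by (rule continuous_map_in)
      then show "\<phi> x (L z) \<noteq> 0"
        using \<delta>(2)[of "(?t', z)" "(?t, z)" x "L z"] z x t dt L(2) by (auto simp: dist_Pair_Pair dist_real_def)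
    qed blast
    then show ?case
      by auto
  qed
  from this[of m] obtain L where L: "continuous_map ?D E L"
    "\<And>x. x \<in> standard_simplex n \<Longrightarrow> q (L x) = s x"
    using m(1) by (auto simp: r_def)
  show ?thesis
  proof
    show "singular_simplex n E (restrict L (standard_simplex n))"
      using L(1) unfolding singular_simplex_def D by (auto intro: continuous_map_eq)
    show "simplex_map n q (restrict L (standard_simplex n)) = s"
    proof (rule extensionalityI[of _ "standard_simplex n"])
      show "s \<in> extensional (standard_simplex n)"
        using s by (simp add: singular_simplex_def)
    qed (simp_all add: simplex_map_def L(2))
  qed
qed

section \<open>Uniqueness of lifts and saturation of invariant sets\<close>

lemma simplex_in: "\<lbrakk>singular_simplex n E l; x \<in> standard_simplex n\<rbrakk> \<Longrightarrow> l x \<in> topspace E"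
  using singular_simplex_image[of n E l] by (simp add: image_subset_iff)

lemma simplex_eqI:
  "\<lbrakk>singular_simplex n E l; singular_simplex n E l'; \<And>x. x \<in> standard_simplex n \<Longrightarrow> l x = l' x\<rbrakk> \<Longrightarrow> l = l'"
  by (rule extensionalityI[of l "standard_simplex n"]) (simp_all add: singular_simplex_def)

lemma simplex_map_T_in: "singular_simplex n E l \<Longrightarrow> singular_simplex n E (simplex_map n T l)"
  by (rule singular_simplex_simplex_map[OF _ continuous_T])

lemma simplex_map_q_in: "singular_simplex n E l \<Longrightarrow> singular_simplex n B (simplex_map n q l)"
  using continuous_q by (rule singular_simplex_simplex_map[rotated])

lemma simplex_map_T_T: "singular_simplex n E l \<Longrightarrow> simplex_map n T (simplex_map n T l) = l"
  by (rule simplex_eqI[OF simplex_map_T_in[OF simplex_map_T_in]])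
     (auto simp: simplex_map_def T_T simplex_in)

lemma simplex_map_q_T: "singular_simplex n E l \<Longrightarrow> simplex_map n q (simplex_map n T l) = simplex_map n q l"
  by (auto simp: simplex_map_def fun_eq_iff q_T simplex_in)

text \<open>The points where \<open>l'\<close> agrees with \<open>l\<close> and those where it
  agrees with \<open>T\<close> after \<open>l\<close> form a partition of a connected simplex. Both
  are closed because agreement can be tested on the real coordinates of \<open>\<pi>\<close>; no
  separation property of \<open>E\<close> is at hand.\<close>

lemma simplex_lift_unique:
  assumes l: "singular_simplex n E l" and l': "singular_simplex n E l'"
    and eq: "simplex_map n q l' = simplex_map n q l"
  shows "l' = l \<or> l' = simplex_map n T l"
proof -
  let ?D = "subtopology (powertop_real UNIV) (standard_simplex n)"
  have cont: "continuous_map ?D E l" "continuous_map ?D E l'"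
    using l l' by (auto simp: singular_simplex_def)
  have coord: "continuous_map EC euclideanreal (\<lambda>e. e i)" for i
    unfolding EC_def by (intro continuous_map_from_subtopology continuous_map_product_projection) auto
  have c: "continuous_map ?D euclideanreal (\<lambda>x. \<pi> (f x) i)" if "continuous_map ?D E f" for f i
    using continuous_map_compose[OF continuous_map_compose[OF that continuous_\<pi>] coord] by (simp add: comp_def)
  have alt: "l' x = l x \<or> l' x = T (l x)" if x: "x \<in> standard_simplex n" for x
  proof -
    have "q (l' x) = q (l x)"
      using eq x by (metis comp_apply restrict_apply' simplex_map_def)
    then show ?thesis
      using q_eq_iff[of "l x" "l' x"] simplex_in[OF l x] simplex_in[OF l' x] by auto
  qed
  define A where "A = (\<Inter>i. {x \<in> topspace ?D. \<pi> (l' x) i - \<pi> (l x) i \<in> {0}})"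
  define A' where "A' = (\<Inter>i. {x \<in> topspace ?D. \<pi> (l' x) i + \<pi> (l x) i \<in> {0}})"
  have "closedin ?D {x \<in> topspace ?D. \<pi> (l' x) i - \<pi> (l x) i \<in> {0}}" for i
    by (rule closedin_continuous_map_preimage[where Y=euclideanreal]) (intro continuous_intros c cont, simp)
  moreover have "closedin ?D {x \<in> topspace ?D. \<pi> (l' x) i + \<pi> (l x) i \<in> {0}}" for i
    by (rule closedin_continuous_map_preimage[where Y=euclideanreal]) (intro continuous_intros c cont, simp)
  ultimately have closed: "closedin ?D A" "closedin ?D A'"
    unfolding A_def A'_def by blast+
  have A_iff: "x \<in> A \<longleftrightarrow> l' x = l x" "x \<in> A' \<longleftrightarrow> l' x = T (l x)" if x: "x \<in> standard_simplex n" for x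
  proof -
    have 1: "\<pi> (T (l x)) = antipode (\<pi> (l x))" "antipode (\<pi> (l x)) \<noteq> \<pi> (l x)"
      using simplex_in[OF l x] \<pi>_T antipode_ne \<pi>_in by auto
    have "x \<in> A \<longleftrightarrow> \<pi> (l' x) = \<pi> (l x)" "x \<in> A' \<longleftrightarrow> \<pi> (l' x) = antipode (\<pi> (l x))"
      using x by (auto simp: A_def A'_def antipode_def fun_eq_iff eq_neg_iff_add_eq_0)
    then show "x \<in> A \<longleftrightarrow> l' x = l x" "x \<in> A' \<longleftrightarrow> l' x = T (l x)"
      using alt[OF x] 1 by metis+
  qed
  have sub: "A \<subseteq> standard_simplex n" "A' \<subseteq> standard_simplex n"
    by (auto simp: A_def A'_def)
  have "A \<inter> A' = {}"
  proof -
    have "T (l x) \<noteq> l x" if "x \<in> standard_simplex n" for x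
      using T_ne simplex_in[OF l that] by auto
    then show ?thesis
      using A_iff sub by (metis disjoint_iff subsetD)
  qed
  moreover have "topspace ?D \<subseteq> A \<union> A'"
    using alt A_iff by auto
  moreover have "connected_space ?D"
    using connectedin_standard_simplex[of n] by (simp add: connectedin_def)
  ultimately consider "A = {}" | "A' = {}"
    using closed unfolding connected_space_closedin by blast
  then show ?thesis
  proof cases
    case 1
    then have "l' x = T (l x)" if "x \<in> standard_simplex n" for x
      using alt[OF that] A_iff[OF that] by auto
    then have "l' = simplex_map n T l"
      by (intro simplex_eqI[OF l' simplex_map_T_in[OF l]]) (simp add: simplex_map_def)
    then show ?thesis ..
  next
    case 2
    then have "l' x = l x" if "x \<in> standard_simplex n" for x
      using alt[OF that] A_iff[OF that] by auto
    then have "l' = l"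
      by (intro simplex_eqI[OF l' l])
    then show ?thesis ..
  qed
qed

text \<open>An invariant set is a union of orbits. Hence lifts of simplices of the relative part
  stay relative, and the transfer is defined for pairs.\<close>

lemma q_image_subset_iff:
  assumes F: "F \<subseteq> topspace E" "T ` F \<subseteq> F" and l: "singular_simplex n E l"
  shows "simplex_map n q l ` standard_simplex n \<subseteq> q ` F \<longleftrightarrow> l ` standard_simplex n \<subseteq> F"
proof -
  have "q y \<in> q ` F \<longleftrightarrow> y \<in> F" if "y \<in> topspace E" for y
  proof
    assume "q y \<in> q ` F"
    then obtain z where z: "z \<in> F" "q z = q y" by auto
    then have "y = z \<or> y = T z"
      using q_eq_iff[of z y] F that by blast
    then show "y \<in> F"
      using z F by blast
  qed auto
  then show ?thesis
    using simplex_in[OF l] by (auto simp: simplex_map_def image_subset_iff)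
qed

end

section \<open>Transfer and Gysin sequence of a double cover\<close>

text \<open>An arbitrary choice of one vector in each antipodal pair. It cannot be continuous, but
  cochains are arbitrary functions on simplices.\<close>

definition positive_vector :: "(nat \<Rightarrow> real) \<Rightarrow> bool" where
  "positive_vector e \<longleftrightarrow> 0 < e (LEAST i. e i \<noteq> 0)"

lemma positive_vector_antipode:
  assumes "e \<in> topspace EC"
  shows "positive_vector (antipode e) \<longleftrightarrow> \<not> positive_vector e"
proof -
  obtain i where "e i \<noteq> 0"
    using EC_nonzero[OF assms] .
  then have "e (LEAST i. e i \<noteq> 0) \<noteq> 0"
    by (rule LeastI)
  then show ?thesis
    by (auto simp: positive_vector_def antipode_def)
qed

context double_cover
begin

abbreviation pull :: "'e set cochain \<Rightarrow> 'e cochain" where "pull \<equiv> cochain_pullback E q"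

definition lift :: "nat \<Rightarrow> ((nat \<Rightarrow> real) \<Rightarrow> 'e set) \<Rightarrow> (nat \<Rightarrow> real) \<Rightarrow> 'e" where
  "lift n s = (SOME l. singular_simplex n E l \<and> simplex_map n q l = s)"

definition transfer :: "'e cochain \<Rightarrow> 'e set cochain" where
  "transfer c = (\<lambda>n s. if singular_simplex n B s then c n (lift n s) + c n (simplex_map n T (lift n s)) else 0)"

lemma lift:
  assumes "singular_simplex n B s"
  shows "singular_simplex n E (lift n s) \<and> simplex_map n q (lift n s) = s"
proof -
  obtain l where "singular_simplex n E l \<and> simplex_map n q l = s"
    using simplex_lift_exists[OF assms] by blast
  then show ?thesis
    unfolding lift_def by (rule someI[where P="\<lambda>l. singular_simplex n E l \<and> simplex_map n q l = s"])
qed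

text \<open>The value does not depend on the chosen lift, since the only other one is obtained by
  \<open>T\<close> and the sum is symmetric.\<close>

lemma transfer_map:
  assumes l: "singular_simplex n E l"
  shows "transfer c n (simplex_map n q l) = c n l + c n (simplex_map n T l)"
proof -
  let ?l = "lift n (simplex_map n q l)"
  have 1: "singular_simplex n E ?l" "simplex_map n q ?l = simplex_map n q l"
    using lift[OF simplex_map_q_in[OF l]] by auto
  have "transfer c n (simplex_map n q l) = c n ?l + c n (simplex_map n T ?l)"
    by (simp add: transfer_def simplex_map_q_in[OF l])
  also have "\<dots> = c n l + c n (simplex_map n T l)"
    using simplex_lift_unique[OF l 1]
  proof
    assume "?l = simplex_map n T l"
    then show ?thesis
      by (simp add: simplex_map_T_T[OF l] add.commute)
  qed simp
  finally show ?thesis .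
qed

text \<open>Every simplex of the base lifts, so cochains on the base may be compared on images of
  simplices of \<open>E\<close>, where the transfer has an explicit value.\<close>

lemma cochain_B_eqI:
  assumes "a \<in> cochains B {}" "b \<in> cochains B {}"
    and "\<And>n l. singular_simplex n E l \<Longrightarrow> a n (simplex_map n q l) = b n (simplex_map n q l)"
  shows "a = b"
proof (intro ext)
  fix n s
  show "a n s = b n s"
  proof (cases "singular_simplex n B s")
    case True
    then show ?thesis
      using lift[OF True] assms(3) by metis
  next
    case False
    then show ?thesis
      using cochainsD(1)[OF assms(1)] cochainsD(1)[OF assms(2)] by simp
  qed
qed

lemma pull_inj:
  assumes "a \<in> cochains B {}" "b \<in> cochains B {}" "pull a = pull b"
  shows "a = b"
proof (rule cochain_B_eqI[OF assms(1,2)])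
  fix n l assume "singular_simplex n E l"
  then show "a n (simplex_map n q l) = b n (simplex_map n q l)"
    using fun_cong[OF fun_cong[OF assms(3)], of n l] by (simp add: cochain_pullback_def)
qed

lemma transfer_add: "transfer (a + b) = transfer a + transfer b"
  by (auto simp: transfer_def fun_eq_iff plus_fun_apply)

definition invariant :: "'e set \<Rightarrow> bool" where
  "invariant F \<longleftrightarrow> F \<subseteq> topspace E \<and> T ` F \<subseteq> F"

lemma invariant_empty [simp]: "invariant {}"
  by (simp add: invariant_def)

lemma lift_image_subset:
  assumes "invariant F" "singular_simplex n E l" "simplex_map n q l ` standard_simplex n \<subseteq> q ` F"
  shows "l ` standard_simplex n \<subseteq> F"
  using assms q_image_subset_iff by (simp add: invariant_def)

lemma transfer_in_cochains:
  assumes F: "invariant F" and c: "c \<in> cochains E F"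
  shows "transfer c \<in> cochains B (q ` F)"
proof -
  obtain N where N: "\<And>n. N < n \<Longrightarrow> c n = 0"
    using c cochains_bounded by blast
  show ?thesis
  proof (rule cochainsI[where N=N])
    fix n s assume s: "singular_simplex n B s" "s ` standard_simplex n \<subseteq> q ` F"
    obtain l where l: "singular_simplex n E l" "simplex_map n q l = s"
      using lift[OF s(1)] by blast
    have "l ` standard_simplex n \<subseteq> F"
      using lift_image_subset[OF F l(1)] s l by simp
    moreover from this have "simplex_map n T l ` standard_simplex n \<subseteq> F"
      using F by (auto simp: invariant_def simplex_map_def)
    ultimately have "c n l = 0" "c n (simplex_map n T l) = 0"
      using cochainsD(2)[OF c] by blast+
    then show "transfer c n s = 0"
      using transfer_map[OF l(1)] l(2) by (metis add_0)
  qed (auto simp: transfer_def N fun_eq_iff zero_fun_apply)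
qed

lemma simplex_face_map:
  "k \<le> Suc n \<Longrightarrow> singular_face (Suc n) k (simplex_map (Suc n) f s) = simplex_map n f (singular_face (Suc n) k s)"
  by (auto simp: singular_face_alt simplex_map_def fun_eq_iff simplical_face_in)

lemma coboundary_transfer:
  assumes "c \<in> cochains E {}"
  shows "coboundary B (transfer c) = transfer (coboundary E c)"
proof (rule cochain_B_eqI)
  show "coboundary B (transfer c) \<in> cochains B {}" "transfer (coboundary E c) \<in> cochains B {}"
    using transfer_in_cochains[of "{}"] assms by simp_all
  fix n l assume l: "singular_simplex n E l"
  show "coboundary B (transfer c) n (simplex_map n q l) = transfer (coboundary E c) n (simplex_map n q l)"
  proof (cases n)
    case 0
    then show ?thesis
      using l by (auto simp: transfer_map zero_fun_apply)
  next
    case (Suc m)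
    have "coboundary B (transfer c) n (simplex_map n q l)
        = (\<Sum>k\<le>Suc m. transfer c m (simplex_map m q (singular_face (Suc m) k l)))"
      using l simplex_map_q_in[OF l] by (simp add: Suc coboundary_Suc simplex_face_map del: sum.atMost_Suc)
    also have "\<dots> = (\<Sum>k\<le>Suc m. c m (singular_face (Suc m) k l) + c m (simplex_map m T (singular_face (Suc m) k l)))"
      using l by (intro sum.cong) (auto simp: Suc transfer_map singular_simplex_face)
    also have "\<dots> = coboundary E c n l + coboundary E c n (simplex_map n T l)"
      using l simplex_map_T_in[OF l]
      by (simp add: Suc coboundary_Suc simplex_face_map sum.distrib del: sum.atMost_Suc)
    finally show ?thesis
      using l by (simp add: transfer_map)
  qed
qed

lemma transfer_pull: "transfer (pull c) = 0"
proof (intro ext)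
  fix n s
  show "transfer (pull c) n s = 0 n s"
  proof (cases "singular_simplex n B s")
    case True
    obtain l where l: "singular_simplex n E l" "simplex_map n q l = s"
      using lift[OF True] by blast
    then show ?thesis
      using transfer_map[OF l(1), of "pull c"] simplex_map_T_in[OF l(1)] simplex_map_q_T[OF l(1)]
      by (simp add: cochain_pullback_def zero_fun_apply)
  qed (simp add: transfer_def zero_fun_apply)
qed

lemma pair_map_q: "F \<subseteq> topspace E \<Longrightarrow> pair_map E F B (q ` F) q"
  using continuous_q by auto

lemma pull_in_cochains: "\<lbrakk>invariant F; c \<in> cochains B (q ` F)\<rbrakk> \<Longrightarrow> pull c \<in> cochains E F"
  using pullback_in_cochains[OF pair_map_q] by (simp add: invariant_def)

lemma pull_in_cocycles: "\<lbrakk>invariant F; c \<in> cocycles B (q ` F)\<rbrakk> \<Longrightarrow> pull c \<in> cocycles E F"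
  using cocycles_pullback[OF pair_map_q] by (simp add: invariant_def)

text \<open>Modulo 2 a vanishing transfer says that the cochain takes the same value on both lifts
  of a simplex, so it descends. This is exactness in the middle of the transfer sequence of
  cochains.\<close>

lemma transfer_eq_0:
  assumes F: "invariant F" and c: "c \<in> cochains E F" and 0: "transfer c = 0"
  obtains b where "b \<in> cochains B (q ` F)" "c = pull b"
proof
  let ?b = "\<lambda>n s. if singular_simplex n B s then c n (lift n s) else 0"
  obtain N where N: "\<And>n. N < n \<Longrightarrow> c n = 0"
    using c cochains_bounded by blast
  show "?b \<in> cochains B (q ` F)"
  proof (rule cochainsI[where N=N])
    fix n s assume s: "singular_simplex n B s" "s ` standard_simplex n \<subseteq> q ` F"
    have "lift n s ` standard_simplex n \<subseteq> F"
      using lift_image_subset[OF F, of n "lift n s"] lift[OF s(1)] s(2) by simp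
    then show "?b n s = 0"
      using cochainsD(2)[OF c] by simp
  qed (auto simp: N fun_eq_iff zero_fun_apply)
  show "c = pull ?b"
  proof (intro ext)
    fix n l
    show "c n l = pull ?b n l"
    proof (cases "singular_simplex n E l")
      case True
      let ?l = "lift n (simplex_map n q l)"
      have l: "singular_simplex n E ?l" "simplex_map n q ?l = simplex_map n q l"
        using lift[OF simplex_map_q_in[OF True]] by auto
      have "c n l + c n (simplex_map n T l) = 0"
        using transfer_map[OF True, of c] 0 by (simp add: zero_fun_apply)
      then have eq: "c n (simplex_map n T l) = c n l"
        by (cases "c n l"; cases "c n (simplex_map n T l)") auto
      have "c n ?l = c n l"
        using simplex_lift_unique[OF True l] eq by auto
      then show ?thesis
        using True simplex_map_q_in[OF True] by (simp add: cochain_pullback_def)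
    next
      case False
      then show ?thesis
        using cochainsD(1)[OF c] by (simp add: cochain_pullback_def)
    qed
  qed
qed

text \<open>The projection formula: a pulled back factor has the same value on both lifts and can be
  taken out of the sum. It holds for cochains, not just for classes.\<close>

lemma transfer_cup_pull_left:
  assumes a: "a \<in> cochains B {}" and c: "c \<in> cochains E {}"
  shows "transfer (cup E (pull a) c) = cup B a (transfer c)"
proof (rule cochain_B_eqI)
  have "pull a \<in> cochains E {}"
    using pull_in_cochains[of "{}"] a by simp
  then show "transfer (cup E (pull a) c) \<in> cochains B {}"
    using transfer_in_cochains[of "{}" "cup E (pull a) c"] cup_in_cochains[OF _ c] by simp
  show "cup B a (transfer c) \<in> cochains B {}"
    using transfer_in_cochains[of "{}" c] c cup_in_cochains[OF a] by simp
  fix n l assume l: "singular_simplex n E l"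
  show "transfer (cup E (pull a) c) n (simplex_map n q l) = cup B a (transfer c) n (simplex_map n q l)"
    using l simplex_map_T_in[OF l] simplex_map_q_in[OF l] singular_simplex_front_face[OF l]
      singular_simplex_front_face[OF simplex_map_T_in[OF l]] singular_simplex_back_face'[OF l]
    by (auto simp: transfer_map cup_def cochain_pullback_def front_face_simplex_map back_face_simplex_map
        simplex_map_q_T distrib_left simplex_map_T_in simp flip: sum.distrib intro!: sum.cong)
qed

lemma transfer_cup_pull_right:
  assumes a: "a \<in> cochains B {}" and c: "c \<in> cochains E {}"
  shows "transfer (cup E c (pull a)) = cup B (transfer c) a"
proof (rule cochain_B_eqI)
  have "pull a \<in> cochains E {}"
    using pull_in_cochains[of "{}"] a by simp
  then show "transfer (cup E c (pull a)) \<in> cochains B {}"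
    using transfer_in_cochains[of "{}" "cup E c (pull a)"] cup_in_cochains[OF c] by simp
  show "cup B (transfer c) a \<in> cochains B {}"
    using transfer_in_cochains[of "{}" c] c cup_in_cochains[OF _ a] by simp
  fix n l assume l: "singular_simplex n E l"
  show "transfer (cup E c (pull a)) n (simplex_map n q l) = cup B (transfer c) a n (simplex_map n q l)"
    using l simplex_map_T_in[OF l] simplex_map_q_in[OF l] singular_simplex_front_face[OF l]
      singular_simplex_front_face[OF simplex_map_T_in[OF l]] singular_simplex_back_face'[OF l]
    by (auto simp: transfer_map cup_def cochain_pullback_def front_face_simplex_map back_face_simplex_map
        simplex_map_q_T distrib_right simplex_map_T_in simp flip: sum.distrib intro!: sum.cong)
qed

text \<open>The sheet cochain is a section of the transfer over the unit; its coboundary descends to a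
  cocycle representing the Stiefel-Whitney class of the cover.\<close>

definition sheet :: "'e cochain" where
  "sheet = (\<lambda>n s. if n = 0 \<and> singular_simplex n E s \<and> positive_vector (\<pi> (s (\<lambda>j. if j = 0 then 1 else 0)))
                  then 1 else 0)"

lemma sheet_in_cochains [simp]: "sheet \<in> cochains E {}"
  by (rule cochainsI[where N=0]) (auto simp: sheet_def nonempty_standard_simplex fun_eq_iff zero_fun_apply)

lemma homogeneous_sheet: "homogeneous 0 sheet"
  by (auto simp: sheet_def homogeneous_def fun_eq_iff zero_fun_apply)

text \<open>Of the two lifts of a vertex exactly one is positive.\<close>

lemma transfer_sheet: "transfer sheet = one_cochain B"
proof (rule cochain_B_eqI)
  show "transfer sheet \<in> cochains B {}"
    using transfer_in_cochains[of "{}" sheet] by simp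
  show "one_cochain B \<in> cochains B {}" by simp
  fix n l assume l: "singular_simplex n E l"
  show "transfer sheet n (simplex_map n q l) = one_cochain B n (simplex_map n q l)"
  proof (cases "n = 0")
    case True
    let ?v = "\<lambda>j::nat. if j = 0 then 1 else 0 :: real"
    have v: "?v \<in> standard_simplex n"
      by simp
    then have "simplex_map n T l ?v = T (l ?v)" "l ?v \<in> topspace E"
      using simplex_in[OF l v] by (simp_all add: simplex_map_def)
    then show ?thesis
      using l simplex_map_T_in[OF l] simplex_map_q_in[OF l] True
      by (auto simp: transfer_map sheet_def one_cochain_def \<pi>_T positive_vector_antipode \<pi>_in)
  next
    case False
    then show ?thesis
      using l by (simp add: transfer_map sheet_def one_cochain_def)
  qed
qed

definition w :: "'e set cochain" where
  "w = (SOME w. w \<in> cochains B {} \<and> pull w = coboundary E sheet)"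

lemma w_cochain: "w \<in> cochains B {}" and pull_w: "pull w = coboundary E sheet"
proof -
  have "transfer (coboundary E sheet) = 0"
    using coboundary_transfer[OF sheet_in_cochains] by (simp add: transfer_sheet)
  then obtain b where "b \<in> cochains B (q ` {})" "coboundary E sheet = pull b"
    using transfer_eq_0[of "{}" "coboundary E sheet"] by auto
  then have "\<exists>w. w \<in> cochains B {} \<and> pull w = coboundary E sheet"
    by auto
  then have "w \<in> cochains B {} \<and> pull w = coboundary E sheet"
    unfolding w_def by (rule someI_ex)
  then show "w \<in> cochains B {}" "pull w = coboundary E sheet"
    by auto
qed

text \<open>The choice in the definition of \<open>w\<close> has only one possible value. This makes
  naturality of the class an equality of cochains.\<close>

lemma w_unique: "\<lbrakk>v \<in> cochains B {}; pull v = coboundary E sheet\<rbrakk> \<Longrightarrow> v = w"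
  using pull_inj[OF _ w_cochain] pull_w by simp

lemma pull_coboundary: "pull (coboundary B c) = coboundary E (pull c)"
  by (rule pullback_coboundary[OF continuous_q])

lemma w_cocycle [simp]: "w \<in> cocycles B {}"
proof -
  have "coboundary B w = 0"
    by (rule pull_inj) (use w_cochain in \<open>simp_all add: pull_coboundary pull_w\<close>)
  then show ?thesis
    using w_cochain by (simp add: cocycles_def)
qed

lemma homogeneous_w: "homogeneous 1 w"
proof -
  have "component 1 w = w"
  proof (rule w_unique)
    have "pull (component 1 w) = component (Suc 0) (coboundary E sheet)"
      unfolding pull_w[symmetric] by (auto simp: component_def cochain_pullback_def fun_eq_iff zero_fun_apply)
    also have "\<dots> = coboundary E (component 0 sheet)"
      by (simp only: coboundary_component)
    also have "component 0 sheet = sheet"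
      by (rule component_homogeneous[OF homogeneous_sheet])
    finally show "pull (component 1 w) = coboundary E sheet" .
  qed (simp add: w_cochain)
  then show ?thesis
    by (metis homogeneous_component)
qed

section \<open>Exactness of the Gysin sequence and commutation with \<open>w\<close>\<close>

lemma pull_cup: "pull (cup B a b) = cup E (pull a) (pull b)"
  by (rule pullback_cup[OF continuous_q])

text \<open>The transfer of a primitive of \<open>pull z\<close> is a quotient of \<open>z\<close>
  by \<open>w\<close>, up to a coboundary.\<close>

lemma gysin_descend:
  assumes F: "invariant F" and z: "z \<in> cocycles B (q ` F)" and b: "b \<in> cochains E F"
    and zb: "pull z = coboundary E b"
  shows "transfer b \<in> cocycles B (q ` F)" "z + cup B (transfer b) w \<in> coboundaries B (q ` F)"
proof -
  let ?t = "transfer b"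
  have t: "?t \<in> cochains B (q ` F)"
    by (rule transfer_in_cochains[OF F b])
  have dt: "coboundary B ?t = 0"
    using coboundary_transfer[OF cochains_absolute[OF b]] transfer_pull[of z] zb by simp
  then show "?t \<in> cocycles B (q ` F)"
    using t by (simp add: cocycles_def)
  \<comment> \<open>The sheet cochain transfers to the unit, so the correction cancels the transfer
    of \<open>b\<close>. The sum descends to a cochain whose coboundary is
    \<open>z + cup B ?t w\<close>.\<close>
  let ?b = "b + cup E (pull ?t) sheet"
  have b': "?b \<in> cochains E F"
    using b cup_in_cochains_left[OF pull_in_cochains[OF F t] sheet_in_cochains] by simp
  have "transfer ?b = ?t + cup B ?t (one_cochain B)"
    by (simp add: transfer_add transfer_cup_pull_left[OF cochains_absolute[OF t]] transfer_sheet)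
  then have "transfer ?b = 0"
    by (simp add: cup_one_right[OF cochains_absolute[OF t]])
  then obtain c where c: "c \<in> cochains B (q ` F)" "?b = pull c"
    using transfer_eq_0[OF F b'] by blast
  have "pull (coboundary B c) = pull (z + cup B ?t w)"
    unfolding pull_coboundary c(2)[symmetric] coboundary_add coboundary_cup pullback_add pull_cup pull_w
    by (simp add: zb dt flip: pull_coboundary)
  then have "coboundary B c = z + cup B ?t w"
    using c(1) z cup_in_cochains_left[OF t w_cochain] cocycles_cochains
    by (intro pull_inj) (auto intro!: cochains_add dest: cochains_absolute)
  then show "z + cup B ?t w \<in> coboundaries B (q ` F)"
    using c(1) by (metis coboundariesI)
qed

text \<open>If \<open>c\<close> is a primitive of the product with \<open>w\<close>, then
  \<open>pull c\<close> corrects \<open>cup E (pull z) sheet\<close> to a cocycle, and it does not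
  affect the transfer.\<close>

lemma gysin_kernel:
  assumes F: "invariant F" and z: "z \<in> cocycles B (q ` F)" and zw: "cup B z w \<in> coboundaries B (q ` F)"
  obtains y where "y \<in> cocycles E F" "transfer y = z"
proof -
  obtain c where c: "c \<in> cochains B (q ` F)" "cup B z w = coboundary B c"
    using zw by (rule coboundariesE)
  have z': "z \<in> cochains B (q ` F)" "coboundary B z = 0"
    using z by (auto simp: cocycles_def)
  let ?y = "cup E (pull z) sheet + pull c"
  have "?y \<in> cochains E F"
    using cup_in_cochains_left[OF pull_in_cochains[OF F z'(1)] sheet_in_cochains] pull_in_cochains[OF F c(1)]
    by simp
  moreover have "coboundary E ?y = 0"
    unfolding coboundary_add coboundary_cup pull_w[symmetric]
    by (simp add: z' flip: pull_coboundary c(2) pull_cup)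
  moreover have "transfer ?y = z"
    by (simp add: transfer_add transfer_pull transfer_cup_pull_left[OF cochains_absolute[OF z'(1)]]
        transfer_sheet cup_one_right[OF cochains_absolute[OF z'(1)]])
  ultimately show ?thesis
    using that by (simp add: cocycles_def)
qed

text \<open>The two products of the sheet cochain with \<open>pull c\<close> both transfer to
  \<open>c\<close>, so their sum descends. The result is an explicit homotopy between the two
  products of \<open>c\<close> with \<open>w\<close>.\<close>

lemma w_commutes:
  assumes F: "invariant F" and c: "c \<in> cocycles B (q ` F)"
  shows "cup B w c + cup B c w \<in> coboundaries B (q ` F)"
proof -
  have c': "c \<in> cochains B (q ` F)" "coboundary B c = 0" "c \<in> cochains B {}"
    using c cochains_absolute by (auto simp: cocycles_def)
  let ?b = "cup E sheet (pull c) + cup E (pull c) sheet"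
  have "?b \<in> cochains E F"
    using cup_in_cochains_left cup_in_cochains_right pull_in_cochains[OF F c'(1)] sheet_in_cochains
    by (simp add: cup_in_cochains_left cup_in_cochains_right)
  moreover have "transfer ?b = 0"
    by (simp add: transfer_add transfer_cup_pull_left transfer_cup_pull_right c' transfer_sheet
        cup_one_right cup_one_left)
  ultimately obtain d where d: "d \<in> cochains B (q ` F)" "?b = pull d"
    using transfer_eq_0[OF F] by blast
  have "pull (coboundary B d) = pull (cup B w c + cup B c w)"
    unfolding pull_coboundary d(2)[symmetric] coboundary_add coboundary_cup pullback_add pull_cup pull_w
    by (simp add: c' flip: pull_coboundary)
  then have "coboundary B d = cup B w c + cup B c w"
    using d(1) c' w_cochain
    by (intro pull_inj) (auto intro!: cochains_add cup_in_cochains dest: cochains_absolute)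
  then show ?thesis
    using d(1) by (metis coboundariesI)
qed

lemma transfer_homogeneous: "homogeneous n c \<Longrightarrow> homogeneous n (transfer c)"
  by (auto simp: homogeneous_def transfer_def fun_eq_iff zero_fun_apply)

end

section \<open>Contractibility of the infinite sphere\<close>

definition base_point :: "nat \<Rightarrow> real" where
  "base_point = (\<lambda>i. if i = 0 then 1 else 0)"

lemma EC_iff: "e \<in> topspace EC \<longleftrightarrow> (\<exists>M. (\<forall>i\<ge>M. e i = 0) \<and> (\<Sum>i<M. (e i)\<^sup>2) = 1)"
proof
  assume e: "e \<in> topspace EC"
  obtain M where M: "{i. e i \<noteq> 0} \<subseteq> {..<M}"
    using EC_finite_support[OF e] finite_nat_iff_bounded by blast
  then have "(\<Sum>i<M. (e i)\<^sup>2) = (\<Sum>i | e i \<noteq> 0. (e i)\<^sup>2)"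
    by (intro sum.mono_neutral_right) auto
  moreover have "\<forall>i\<ge>M. e i = 0"
    using M by (auto simp: subset_iff not_less)
  ultimately show "\<exists>M. (\<forall>i\<ge>M. e i = 0) \<and> (\<Sum>i<M. (e i)\<^sup>2) = 1"
    using EC_norm[OF e] by auto
next
  assume "\<exists>M. (\<forall>i\<ge>M. e i = 0) \<and> (\<Sum>i<M. (e i)\<^sup>2) = 1"
  then obtain M where M: "\<And>i. i \<ge> M \<Longrightarrow> e i = 0" "(\<Sum>i<M. (e i)\<^sup>2) = 1" by auto
  then have sub: "{i. e i \<noteq> 0} \<subseteq> {..<M}"
    by (auto simp: not_le[symmetric])
  then have "(\<Sum>i<M. (e i)\<^sup>2) = (\<Sum>i | e i \<noteq> 0. (e i)\<^sup>2)"
    by (intro sum.mono_neutral_right) auto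
  then show "e \<in> topspace EC"
    using M finite_subset[OF sub] by (auto simp: EC_def)
qed

lemma base_point_in_EC [simp]: "base_point \<in> topspace EC"
  unfolding EC_iff by (rule exI[of _ 1]) (auto simp: base_point_def)

lemma positive_base_point: "positive_vector base_point"
proof -
  have "(LEAST i. base_point i \<noteq> 0) = 0"
    by (rule Least_equality) (auto simp: base_point_def)
  then show ?thesis
    by (simp add: positive_vector_def base_point_def)
qed

text \<open>Rotating coordinate \<open>i\<close> into coordinate \<open>i + 1\<close>, the higher coordinates earlier, shifts all
  coordinates by one while the norm stays equal to 1; a last rotation moves the shifted vector
  to the base point.\<close>

definition angle :: "nat \<Rightarrow> real \<Rightarrow> real" where
  "angle i s = pi / 2 * min 1 (max 0 (2 * s * (i + 1) * (i + 2) - (i + 1)))"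

definition last_angle :: "real \<Rightarrow> real" where
  "last_angle s = pi / 2 * max 0 (2 * s - 1)"

definition contraction :: "real \<Rightarrow> (nat \<Rightarrow> real) \<Rightarrow> nat \<Rightarrow> real" where
  "contraction s e = (\<lambda>i. if i = 0 then cos (last_angle s) * (cos (angle 0 s) * e 0) + sin (last_angle s)
     else cos (last_angle s) * (cos (angle i s) * e i + sin (angle (i - 1) s) * e (i - 1)))"

text \<open>The angle i grows from 0 to pi/2 while s runs from 1/(2(i + 2)) to 1/(2(i + 1)). These
  intervals only touch, so either the angle i has not started or the angle i + 1 is
  complete.\<close>

lemma angle_consecutive: "cos (angle (Suc i) s) * sin (angle i s) = 0"
proof (cases "2 * s * (real i + 2) \<le> 1")
  case True
  then have "2 * s * (real i + 2) * (real i + 1) \<le> 1 * (real i + 1)"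
    by (intro mult_right_mono) auto
  then show ?thesis
    by (simp add: angle_def algebra_simps)
next
  case False
  then have "2 * s * (real i + 2) * (real i + 3) \<ge> 1 * (real i + 3)"
    by (intro mult_right_mono) auto
  then have "1 \<le> 2 * s * (real (Suc i) + 1) * (real (Suc i) + 2) - (real (Suc i) + 1)"
    by (simp add: algebra_simps)
  then have "angle (Suc i) s = pi / 2"
    unfolding angle_def by simp
  then show ?thesis
    by (simp only: cos_pi_half mult_zero_left)
qed

text \<open>All shifting rotations are complete at s = 1/2, the moment at which the last one
  starts.\<close>

lemma last_angle_first: "sin (last_angle s) * cos (angle 0 s) = 0"
proof (cases "2 * s \<le> 1")
  case False
  then have "angle 0 s = pi / 2"
    by (simp add: angle_def)
  then show ?thesis
    by (simp only: cos_pi_half mult_zero_right)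
qed (simp add: last_angle_def)

text \<open>The cross terms of the squared coordinates contain the products shown to vanish above.
  What remains is collected by the identity for squares of cosine and sine.\<close>

lemma contraction_in_EC:
  assumes "e \<in> topspace EC"
  shows "contraction s e \<in> topspace EC"
proof -
  obtain M where M: "\<And>i. i \<ge> M \<Longrightarrow> e i = 0" "(\<Sum>i<M. (e i)\<^sup>2) = 1"
    using assms unfolding EC_iff by auto
  define C S c d where "C = cos (last_angle s)" and "S = sin (last_angle s)"
    and "c i = cos (angle i s)" and "d i = sin (angle i s)" for i
  have CS: "C\<^sup>2 + S\<^sup>2 = 1" "(c i)\<^sup>2 + (d i)\<^sup>2 = 1" "c (Suc i) * d i = 0" "S * c 0 = 0" for i
    using angle_consecutive last_angle_first by (auto simp: C_def S_def c_def d_def)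
  have zero: "(contraction s e 0)\<^sup>2 = S\<^sup>2 + C\<^sup>2 * ((c 0)\<^sup>2 * (e 0)\<^sup>2)"
  proof -
    have "(contraction s e 0)\<^sup>2 = S\<^sup>2 + C\<^sup>2 * ((c 0)\<^sup>2 * (e 0)\<^sup>2) + 2 * C * e 0 * (S * c 0)"
      by (simp add: contraction_def C_def S_def c_def power2_eq_square algebra_simps)
    then show ?thesis by (simp add: CS)
  qed
  have suc: "(contraction s e (Suc i))\<^sup>2 = C\<^sup>2 * ((c (Suc i))\<^sup>2 * (e (Suc i))\<^sup>2 + (d i)\<^sup>2 * (e i)\<^sup>2)" for i
  proof -
    have "(contraction s e (Suc i))\<^sup>2
      = C\<^sup>2 * ((c (Suc i))\<^sup>2 * (e (Suc i))\<^sup>2 + (d i)\<^sup>2 * (e i)\<^sup>2) + 2 * C\<^sup>2 * e i * e (Suc i) * (c (Suc i) * d i)"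
      by (simp add: contraction_def C_def d_def c_def power2_eq_square algebra_simps)
    then show ?thesis by (simp add: CS)
  qed
  \<comment> \<open>The shift can push the last nonzero coordinate up by one, so the sum needs one
    more term.\<close>
  have "(\<Sum>i<Suc M. (contraction s e i)\<^sup>2)
      = S\<^sup>2 + C\<^sup>2 * ((c 0)\<^sup>2 * (e 0)\<^sup>2 + (\<Sum>i<M. (c (Suc i))\<^sup>2 * (e (Suc i))\<^sup>2 + (d i)\<^sup>2 * (e i)\<^sup>2))"
    unfolding sum.lessThan_Suc_shift zero suc by (simp add: sum_distrib_left algebra_simps)
  also have "(c 0)\<^sup>2 * (e 0)\<^sup>2 + (\<Sum>i<M. (c (Suc i))\<^sup>2 * (e (Suc i))\<^sup>2 + (d i)\<^sup>2 * (e i)\<^sup>2)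
      = (\<Sum>i<Suc M. (c i)\<^sup>2 * (e i)\<^sup>2) + (\<Sum>i<M. (d i)\<^sup>2 * (e i)\<^sup>2)"
    unfolding sum.lessThan_Suc_shift sum.distrib by simp
  also have "\<dots> = (\<Sum>i<M. ((c i)\<^sup>2 + (d i)\<^sup>2) * (e i)\<^sup>2)"
    using M(1)[of M] by (simp add: sum.distrib distrib_right)
  also have "\<dots> = 1"
    by (simp add: CS M(2))
  finally have "(\<Sum>i<Suc M. (contraction s e i)\<^sup>2) = 1"
    using CS(1) by simp
  moreover have "contraction s e i = 0" if "i \<ge> Suc M" for i
    using that M(1) by (simp add: contraction_def)
  ultimately show ?thesis
    unfolding EC_iff by blast
qed

lemma contraction_0: "contraction 0 e = e"
  by (auto simp: contraction_def last_angle_def angle_def fun_eq_iff)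

lemma contraction_1: "contraction 1 e = base_point"
proof -
  have "angle i 1 = pi / 2" for i
  proof -
    have "1 \<le> 2 * 1 * (real i + 1) * (real i + 2) - (real i + 1)"
      by (simp add: algebra_simps)
    then have "min 1 (max 0 (2 * 1 * (real i + 1) * (real i + 2) - (real i + 1))) = 1"
      by linarith
    then show ?thesis
      unfolding angle_def by (simp only: mult_1_right of_nat_add of_nat_1 of_nat_numeral)
  qed
  then show ?thesis
    by (auto simp: contraction_def last_angle_def base_point_def fun_eq_iff)
qed

lemma continuous_map_EC_coordinate: "continuous_map EC euclideanreal (\<lambda>e. e i)"
  unfolding EC_def by (intro continuous_map_from_subtopology continuous_map_product_projection) auto

text \<open>Infinitely many rotations pile up at s = 0, but each coordinate involves at most two of
  them besides the last one, and the product topology asks for continuity coordinate by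
  coordinate.\<close>

lemma continuous_map_contraction:
  "continuous_map (prod_topology (top_of_set {0..1}) EC) EC (\<lambda>(s, e). contraction s e)"
proof -
  let ?P = "prod_topology (top_of_set {0..1::real}) EC"
  have f: "continuous_map ?P euclideanreal (\<lambda>p. f (fst p))" if "continuous_on UNIV f" for f :: "real \<Rightarrow> real"
  proof -
    have "continuous_map (top_of_set {0..1}) euclideanreal f"
      using that continuous_on_subset by auto
    then show ?thesis
      using continuous_map_compose[OF continuous_map_fst, of "top_of_set {0..1}" euclideanreal f EC]
      by (simp add: comp_def)
  qed
  have g: "continuous_map ?P euclideanreal (\<lambda>p. snd p i)" for i
    using continuous_map_compose[OF continuous_map_snd continuous_map_EC_coordinate] by (simp add: comp_def)
  have ang: "continuous_on UNIV (\<lambda>s. cos (angle i s))" "continuous_on UNIV (\<lambda>s. sin (angle i s))"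
    "continuous_on UNIV (\<lambda>s. cos (last_angle s))" "continuous_on UNIV (\<lambda>s. sin (last_angle s))" for i
    unfolding angle_def last_angle_def by (intro continuous_intros)+
  have "continuous_map ?P euclideanreal (\<lambda>p. contraction (fst p) (snd p) i)" for i
  proof (cases "i = 0")
    case True
    then show ?thesis
      unfolding contraction_def
      by (simp only: if_True simp_thms) (intro continuous_intros f g ang)
  next
    case False
    then show ?thesis
      unfolding contraction_def
      by (simp only: if_False simp_thms) (intro continuous_intros f g ang)
  qed
  then have "continuous_map ?P (powertop_real UNIV) (\<lambda>p. contraction (fst p) (snd p))"
    by (simp add: continuous_map_componentwise_UNIV)
  moreover have "contraction (fst p) (snd p) \<in> {e. finite {i. e i \<noteq> 0} \<and> (\<Sum>i | e i \<noteq> 0. (e i)\<^sup>2) = 1}"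
    if "p \<in> topspace ?P" for p
    using contraction_in_EC[of "snd p" "fst p"] that by (auto simp: EC_def)
  ultimately have "continuous_map ?P EC (\<lambda>p. contraction (fst p) (snd p))"
    unfolding EC_def continuous_map_in_subtopology by (auto simp: EC_def[symmetric])
  then show ?thesis
    by (simp add: case_prod_unfold)
qed

lemma EC_contractible:
  assumes "c \<in> cocycles EC {}"
  shows "c + cochain_pullback EC (\<lambda>e. base_point) c \<in> coboundaries EC {}"
proof -
  have "cochain_pullback EC (\<lambda>x. (\<lambda>(s, e). contraction s e) (0, x)) c
      + cochain_pullback EC (\<lambda>x. (\<lambda>(s, e). contraction s e) (1, x)) c \<in> coboundaries EC {}"
    by (rule homotopy_invariance[OF continuous_map_contraction _ assms]) simp
  then show ?thesis
    using pullback_id[OF cocycles_cochains[OF assms], of "\<lambda>x. x"]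
    by (simp add: contraction_0 contraction_1)
qed

text \<open>The contraction moves only the first factor and so preserves the product of
  \<open>EC\<close> with any \<open>Y\<close>.\<close>

lemma EC_times_contractible:
  assumes c: "c \<in> cocycles (prod_topology EC X) (topspace EC \<times> Y)"
  shows "c + cochain_pullback (prod_topology EC X) (\<lambda>p. (base_point, snd p)) c
    \<in> coboundaries (prod_topology EC X) (topspace EC \<times> Y)"
proof -
  let ?E = "prod_topology EC X"
  let ?h = "\<lambda>p. (contraction (fst p) (fst (snd p)), snd (snd p))"
  let ?P = "prod_topology (top_of_set {0..1::real}) ?E"
  have "continuous_map ?P (prod_topology (top_of_set {0..1}) EC) (\<lambda>p. (fst p, fst (snd p)))"
    using continuous_map_fst[of "top_of_set {0..1::real}" ?E]
      continuous_map_compose[OF continuous_map_snd continuous_map_fst, of "top_of_set {0..1::real}" EC X]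
    by (simp add: continuous_map_pairwise comp_def)
  from continuous_map_compose[OF this continuous_map_contraction]
  have "continuous_map ?P EC (\<lambda>p. contraction (fst p) (fst (snd p)))"
    by (simp add: comp_def)
  moreover have "continuous_map ?P X (\<lambda>p. snd (snd p))"
    using continuous_map_compose[OF continuous_map_snd continuous_map_snd, of "top_of_set {0..1::real}" EC X]
    by (simp add: comp_def)
  ultimately have "continuous_map ?P ?E ?h"
    by (simp add: continuous_map_pairwise comp_def)
  moreover have "?h ` ({0..1} \<times> (topspace ?E \<inter> topspace EC \<times> Y)) \<subseteq> topspace EC \<times> Y"
    using contraction_in_EC by auto
  ultimately have "cochain_pullback ?E (\<lambda>x. ?h (0, x)) c + cochain_pullback ?E (\<lambda>x. ?h (1, x)) c
      \<in> coboundaries ?E (topspace EC \<times> Y)"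
    by (rule homotopy_invariance[OF _ _ c])
  moreover have "(\<lambda>x::(nat \<Rightarrow> real) \<times> 'a. (contraction 0 (fst x), snd x)) = (\<lambda>x. x)"
    by (simp add: contraction_0)
  ultimately show ?thesis
    using pullback_id[OF cocycles_cochains[OF c], of "\<lambda>x. x"] by (simp add: contraction_1)
qed

section \<open>The degree one class of the classifying space\<close>

text \<open>The universal case: the equivariant map is the identity and the base is
  \<open>BC\<close>.\<close>

interpretation bc: double_cover EC antipode id
proof
  have "continuous_map EC euclideanreal (\<lambda>e. - e i)" for i
    by (intro continuous_intros continuous_map_EC_coordinate)
  then have "continuous_map EC (powertop_real UNIV) antipode"
    by (simp add: continuous_map_componentwise_UNIV antipode_def)
  moreover have "antipode e \<in> {e. finite {i. e i \<noteq> 0} \<and> (\<Sum>i | e i \<noteq> 0. (e i)\<^sup>2) = 1}"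
    if "e \<in> topspace EC" for e
    using antipode_in_EC[OF that] by (auto simp: EC_def)
  ultimately have "continuous_map EC (subtopology (powertop_real UNIV)
      {e. finite {i. e i \<noteq> 0} \<and> (\<Sum>i | e i \<noteq> 0. (e i)\<^sup>2) = 1}) antipode"
    unfolding continuous_map_in_subtopology by blast
  then show "continuous_map EC EC antipode"
    by (simp add: EC_def)
qed auto

lemma bc_q: "bc.q = (\<lambda>e. {e, antipode e})"
  by (simp add: bc.q_def fun_eq_iff)

lemma bc_B: "bc.B = BC"
  by (simp add: bc.B_def BC_def bc_q)

definition point_simplex :: "nat \<Rightarrow> 'a \<Rightarrow> (nat \<Rightarrow> real) \<Rightarrow> 'a" where
  "point_simplex n x = restrict (\<lambda>_. x) (standard_simplex n)"

lemma singular_simplex_point: "x \<in> topspace X \<Longrightarrow> singular_simplex n X (point_simplex n x)"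
  unfolding singular_simplex_def point_simplex_def by (auto intro: continuous_map_eq[of _ _ "\<lambda>_. x"])

lemma simplex_map_const: "simplex_map n (\<lambda>_. x) s = point_simplex n x"
  by (auto simp: simplex_map_def point_simplex_def fun_eq_iff)

text \<open>A constant 2-simplex has three equal faces and 3 is odd, so a 1-cocycle vanishes on
  constant edges.\<close>

lemma pullback_const_degree_1:
  assumes c: "c \<in> cocycles Y {}" "homogeneous 1 c" and x: "x \<in> topspace Y"
  shows "cochain_pullback X (\<lambda>_. x) c = 0"
proof (intro ext)
  fix n s
  have 2: "singular_face (Suc 1) k (point_simplex (Suc 1) x) = point_simplex 1 x" if "k \<le> Suc 1" for k
    using that unfolding point_simplex_def by (intro ext) (auto simp: singular_face_alt simplical_face_in)
  have "0 = coboundary Y c (Suc 1) (point_simplex (Suc 1) x)"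
    using cocyclesD[OF c(1)] by (simp add: zero_fun_apply)
  also have "\<dots> = (\<Sum>k\<le>Suc 1. c 1 (point_simplex 1 x))"
    using singular_simplex_point[OF x, of "Suc 1"] 2 by (simp only: coboundary_Suc if_True) (intro sum.cong, auto)
  also have "\<dots> = c 1 (point_simplex 1 x)"
    by (simp add: eval_nat_numeral)
  finally have 0: "c 1 (point_simplex 1 x) = 0" ..
  show "cochain_pullback X (\<lambda>_. x) c n s = 0 n s"
    using 0 c(2) by (cases "n = 1") (auto simp: cochain_pullback_def simplex_map_const homogeneous_def zero_fun_apply)
qed

text \<open>In degree 0 cohomologous means equal, so by contractibility the cocycle equals its
  pullback along a constant map.\<close>

lemma EC_degree_0:
  assumes "c \<in> cocycles EC {}" "homogeneous 0 c"
  shows "c = 0 \<or> c = one_cochain EC"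
proof -
  have "c = cochain_pullback EC (\<lambda>_. base_point) c"
  proof -
    have "c + cochain_pullback EC (\<lambda>e. base_point) c = 0"
      by (rule homogeneous_0_coboundaries[OF _ EC_contractible[OF assms(1)]])
         (simp add: assms(2) homogeneous_pullback)
    then show ?thesis
      by (simp add: cochain_add_eq_0_iff)
  qed
  then have "c n s = (if singular_simplex n EC s then c n (point_simplex n base_point) else 0)" for n s
    by (metis cochain_pullback_def simplex_map_const)
  then have eq: "c n s = (if n = 0 \<and> singular_simplex n EC s then c 0 (point_simplex 0 base_point) else 0)" for n s
    using assms(2) by (cases "n = 0") (auto simp: homogeneous_def zero_fun_apply)
  show ?thesis
    by (cases "c 0 (point_simplex 0 base_point)") (auto simp: fun_eq_iff eq one_cochain_def zero_fun_apply)
qed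

lemma one_cochain_nonzero:
  assumes "x \<in> topspace X"
  shows "one_cochain X \<notin> coboundaries X {}"
proof
  assume "one_cochain X \<in> coboundaries X {}"
  then have "one_cochain X = 0"
    by (intro homogeneous_0_coboundaries) auto
  then have "one_cochain X 0 (point_simplex 0 x) = 0"
    by (simp add: zero_fun_apply)
  then show False
    using singular_simplex_point[OF assms, of 0] by (simp add: one_cochain_def)
qed

lemma base_point_in_BC: "bc.q base_point \<in> topspace BC"
  using bc.topspace_B bc_B by auto

text \<open>If the class bounded, the Gysin kernel would make the unit the transfer of a cocycle of
  \<open>EC\<close>. Up to a coboundary this cocycle is pulled back from the base and has transfer
  0, so the unit would bound.\<close>

lemma w_nonzero: "bc.w \<notin> coboundaries BC {}"
proof
  assume "bc.w \<in> coboundaries BC {}"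
  then have "cup bc.B (one_cochain bc.B) bc.w \<in> coboundaries bc.B (bc.q ` {})"
    by (simp add: bc_B cup_one_left bc.w_cochain[unfolded bc_B])
  then obtain y where y: "y \<in> cocycles EC {}" "bc.transfer y = one_cochain bc.B"
    using bc.gysin_kernel[of "{}" "one_cochain bc.B"] by auto
  obtain b where b: "b \<in> cochains EC {}" "y + cochain_pullback EC (\<lambda>_. base_point) y = coboundary EC b"
    using EC_contractible[OF y(1)] by (rule coboundariesE)
  have "continuous_map EC bc.B bc.q"
    by (rule bc.continuous_q)
  \<comment> \<open>A constant map from \<open>EC\<close> factors through
    \<open>bc.q\<close>.\<close>
  then have "bc.pull (cochain_pullback bc.B (\<lambda>_. base_point) y) = cochain_pullback EC (\<lambda>_. base_point) y"
    by (simp add: pullback_compose comp_def)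
  then have "bc.transfer (y + cochain_pullback EC (\<lambda>_. base_point) y) = one_cochain bc.B"
    using y(2) bc.transfer_pull by (metis add.right_neutral bc.transfer_add)
  then have "one_cochain BC = coboundary BC (bc.transfer b)"
    using bc.coboundary_transfer[OF b(1)] b(2) by (simp add: bc_B)
  moreover have "bc.transfer b \<in> cochains BC {}"
    using bc.transfer_in_cochains[of "{}" b] b(1) by (simp add: bc_B)
  ultimately show False
    using one_cochain_nonzero[OF base_point_in_BC] by (metis coboundariesI)
qed

text \<open>On \<open>EC\<close> the cocycle bounds, so it is a multiple of \<open>bc.w\<close> by a
  cocycle of degree 0, and this factor is 0 or the unit because its pullback to \<open>EC\<close>
  is.\<close>

lemma degree_1_class_BC:
  assumes c: "c \<in> cocycles BC {}" "homogeneous 1 c" and nz: "c \<notin> coboundaries BC {}"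
  shows "c + bc.w \<in> coboundaries BC {}"
proof -
  have pc: "bc.pull c \<in> cocycles EC {}"
    using bc.pull_in_cocycles[of "{}" c] c by (simp add: bc_B)
  have "cochain_pullback EC (\<lambda>_. base_point) (bc.pull c) = 0"
    by (rule pullback_const_degree_1[OF pc homogeneous_pullback[OF c(2)] base_point_in_EC])
  then have "bc.pull c \<in> coboundaries EC {}"
    using EC_contractible[OF pc] by simp
  then obtain b where b: "b \<in> cochains EC {}" "homogeneous 0 b" "bc.pull c = coboundary EC b"
    using homogeneous_pullback[OF c(2)] coboundary_homogeneous_eq[of 0 "bc.pull c" EC "{}"] by (metis One_nat_def)
  let ?t = "bc.transfer b"
  have t: "?t \<in> cocycles BC {}" "c + cup BC ?t bc.w \<in> coboundaries BC {}"
    using bc.gysin_descend[of "{}" c b] c b by (auto simp: bc_B)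
  have "homogeneous 0 ?t"
    by (rule bc.transfer_homogeneous[OF b(2)])
  then have "bc.pull ?t = 0 \<or> bc.pull ?t = one_cochain EC"
    using bc.pull_in_cocycles[of "{}" ?t] t(1) by (intro EC_degree_0 homogeneous_pullback) (auto simp: bc_B)
  then show ?thesis
  proof
    assume "bc.pull ?t = 0"
    then have "?t = 0"
      using bc.pull_inj[of ?t 0] cocycles_cochains[OF t(1)] by (simp add: bc_B)
    then show ?thesis
      using nz t(2) by simp
  next
    assume "bc.pull ?t = one_cochain EC"
    then have "bc.pull ?t = bc.pull (one_cochain BC)"
      using pullback_one[OF bc.continuous_q] by (simp add: bc_B)
    then have "?t = one_cochain BC"
      using bc.pull_inj[of ?t "one_cochain BC"] cocycles_cochains[OF t(1)] by (simp add: bc_B)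
    then show ?thesis
      using t(2) bc.w_cochain by (simp add: cup_one_left bc_B)
  qed
qed

text \<open>Existence and uniqueness of a nonzero class of degree one, which the description in
  \<open>u_class\<close> presupposes.\<close>

lemma u_class_eq: "u_class = cohom_class BC {} bc.w"
  unfolding u_class_def
proof (rule the_equality)
  show "cohom_class BC {} bc.w \<in> cohom_deg BC {} 1 \<and> cohom_class BC {} bc.w \<noteq> \<zero>\<^bsub>cohom BC {}\<^esub>"
    using w_nonzero bc.w_cocycle bc.homogeneous_w by (auto simp: cohom_class_eq_zero_iff cohom_deg_alt bc_B)
next
  fix u assume u: "u \<in> cohom_deg BC {} 1 \<and> u \<noteq> \<zero>\<^bsub>cohom BC {}\<^esub>"
  then obtain c where "c \<in> cocycles BC {}" "homogeneous 1 c" "u = cohom_class BC {} c"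
    by (auto simp: cohom_deg_alt)
  then show "u = cohom_class BC {} bc.w"
    using u degree_1_class_BC by (simp add: cohom_class_eq_zero_iff cohom_class_eq_iff)
qed

section \<open>The Borel construction of a pair\<close>

locale equivariant_pair =
  fixes X :: "'a topology" and \<tau> :: "'a \<Rightarrow> 'a" and Y :: "'a set"
  assumes involution: "involution X \<tau>"
    and Y_subset: "Y \<subseteq> topspace X" and \<tau>_Y: "\<tau> ` Y \<subseteq> Y"

text \<open>The first projection is equivariant, so the diagonal action is free whatever
  \<open>\<tau>\<close> does on \<open>X\<close>, and the base of the cover is the Borel
  construction.\<close>

sublocale equivariant_pair \<subseteq> double_cover "prod_topology EC X" "\<lambda>(e, x). (antipode e, \<tau> x)" fst
proof
  have "continuous_map EC EC antipode"
    by (rule bc.continuous_T)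
  moreover have "continuous_map X X \<tau>"
    using involution by (simp add: involution_def)
  ultimately show "continuous_map (prod_topology EC X) (prod_topology EC X) (\<lambda>(e, x). (antipode e, \<tau> x))"
    by (simp add: continuous_map_prod_top)
qed (use involution in \<open>auto simp: involution_def continuous_map_fst\<close>)

context equivariant_pair
begin

abbreviation "E \<equiv> prod_topology EC X"
abbreviation "F \<equiv> topspace EC \<times> Y"
abbreviation "BX \<equiv> borel_space X \<tau>"
abbreviation "S \<equiv> borel_subset \<tau> Y"

lemma q_eq_orbit: "q = borel_orbit \<tau>"
  by (auto simp: q_def borel_orbit_def fun_eq_iff)

lemma B_eq: "B = BX"
  by (simp add: B_def borel_space_def q_eq_orbit)

lemma q_image: "q ` F = S"
  by (simp add: borel_subset_def q_eq_orbit)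

lemma invariant_F: "invariant F"
  using Y_subset \<tau>_Y antipode_in_EC by (auto simp: invariant_def)

definition rho :: "((nat \<Rightarrow> real) \<times> 'a) set cochain \<Rightarrow> 'a cochain" where
  "rho = cochain_pullback X (\<lambda>x. borel_orbit \<tau> (base_point, x))"

lemma continuous_inclusion: "continuous_map X E (\<lambda>x. (base_point, x))"
  by (simp add: continuous_map_pairwise comp_def)

lemma pair_map_fibre: "pair_map X Y BX S (\<lambda>x. borel_orbit \<tau> (base_point, x))"
proof
  show "continuous_map X BX (\<lambda>x. borel_orbit \<tau> (base_point, x))"
    using continuous_map_compose[OF continuous_inclusion continuous_q] by (simp add: comp_def q_eq_orbit B_eq)
  show "(\<lambda>x. borel_orbit \<tau> (base_point, x)) ` (topspace X \<inter> Y) \<subseteq> S"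
    by (auto simp: borel_subset_def)
qed

lemma rho_map_class: "rho_map X \<tau> Y (cohom_class BX S c) = cohom_class X Y (rho c)"
  using cohom_map_class[OF pair_map_fibre, of c] by (simp add: rho_map_def rho_def base_point_def)

lemma rho_cocycles: "z \<in> cocycles BX S \<Longrightarrow> rho z \<in> cocycles X Y"
  unfolding rho_def by (rule cocycles_pullback[OF pair_map_fibre])

lemma rho_coboundaries: "z \<in> coboundaries BX S \<Longrightarrow> rho z \<in> coboundaries X Y"
  unfolding rho_def by (rule coboundaries_pullback[OF pair_map_fibre])

lemma rho_add: "rho (a + b) = rho a + rho b"
  by (simp add: rho_def pullback_add)

lemma rho_cup: "rho (cup BX a b) = cup X (rho a) (rho b)"
  unfolding rho_def by (rule pullback_cup) (use pair_map_fibre in blast)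

lemma rho_one: "rho (one_cochain BX) = one_cochain X"
  unfolding rho_def by (rule pullback_one) (use pair_map_fibre in blast)

lemma rho_homogeneous: "homogeneous n z \<Longrightarrow> homogeneous n (rho z)"
  by (simp add: rho_def homogeneous_pullback)

lemma rho_pull: "rho z = cochain_pullback X (\<lambda>x. (base_point, x)) (pull z)"
  by (simp add: rho_def pullback_compose[OF continuous_inclusion] comp_def q_eq_orbit)

text \<open>Every vertex over the positive vector \<open>base_point\<close> lies on the positive
  sheet, so the sheet cochain restricts to the unit. Thus \<open>w\<close> restricts to zero as a
  cochain.\<close>

lemma rho_w: "rho w = 0"
proof -
  have "cochain_pullback X (\<lambda>x. (base_point, x)) sheet = one_cochain X"
  proof (intro ext)
    fix n and s :: "(nat \<Rightarrow> real) \<Rightarrow> 'a"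
    have "fst (simplex_map 0 (\<lambda>x. (base_point, x)) s (\<lambda>j. if j = 0 then 1 else 0)) = base_point"
      by (simp add: simplex_map_def)
    then show "cochain_pullback X (\<lambda>x. (base_point, x)) sheet n s = one_cochain X n s"
      using singular_simplex_simplex_map[OF _ continuous_inclusion, of n s]
      by (cases "n = 0") (auto simp: cochain_pullback_def sheet_def one_cochain_def positive_base_point)
  qed
  then show ?thesis
    by (simp add: rho_pull pull_w pullback_coboundary[OF continuous_inclusion])
qed

text \<open>Contracting \<open>EC\<close> shows that \<open>pull z\<close> is cohomologous to the
  pullback of \<open>rho z\<close> along the projection to \<open>X\<close>.\<close>

lemma pull_coboundary_if_rho:
  assumes z: "z \<in> cocycles BX S" and rho: "rho z \<in> coboundaries X Y"
  shows "pull z \<in> coboundaries E F"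
proof -
  have "pull z \<in> cocycles E F"
    using pull_in_cocycles[OF invariant_F] z by (simp add: q_image B_eq)
  then have 1: "pull z + cochain_pullback E (\<lambda>p. (base_point, snd p)) (pull z) \<in> coboundaries E F"
    by (rule EC_times_contractible)
  have "cochain_pullback E (\<lambda>p. (base_point, snd p)) (pull z) = cochain_pullback E snd (rho z)"
    unfolding rho_pull
    by (subst pullback_compose[OF continuous_map_snd]) (simp add: comp_def)
  also have "\<dots> \<in> coboundaries E F"
    by (rule coboundaries_pullback[OF _ rho]) (auto simp: continuous_map_snd)
  finally have "pull z + cochain_pullback E (\<lambda>p. (base_point, snd p)) (pull z)
      + cochain_pullback E (\<lambda>p. (base_point, snd p)) (pull z) \<in> coboundaries E F"
    using 1 by (rule coboundaries_add[rotated])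
  then show ?thesis
    by (simp add: add.assoc)
qed

text \<open>In degree 0 the pullback can only bound by being zero, and \<open>pull\<close> is
  injective. This starts the induction on the degree.\<close>

lemma rho_injective_degree_0:
  assumes "z \<in> cocycles BX S" "rho z \<in> coboundaries X Y" "homogeneous 0 z"
  shows "z = 0"
proof -
  have "pull z = 0"
    by (rule homogeneous_0_coboundaries[OF homogeneous_pullback[OF assms(3)] pull_coboundary_if_rho[OF assms(1,2)]])
  then show ?thesis
    using pull_inj[of z 0] cochains_absolute[OF cocycles_cochains[OF assms(1)]] by (simp add: B_eq)
qed

text \<open>The primitive of \<open>pull z\<close> is chosen homogeneous, so that the quotient given
  by its transfer is homogeneous of one degree less.\<close>

lemma divide_by_w:
  assumes z: "z \<in> cocycles BX S" "rho z \<in> coboundaries X Y" "homogeneous (Suc n) z"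
  obtains t where "t \<in> cocycles BX S" "homogeneous n t" "z + cup BX t w \<in> coboundaries BX S"
proof -
  obtain b where b: "b \<in> cochains E F" "homogeneous n b" "pull z = coboundary E b"
    by (rule coboundary_homogeneous_eq[OF homogeneous_pullback[OF z(3)] pull_coboundary_if_rho[OF z(1,2)]])
  show ?thesis
    using that[of "transfer b"] gysin_descend[OF invariant_F _ b(1,3)] z(1) transfer_homogeneous[OF b(2)]
    by (simp add: q_image B_eq)
qed

lemma w_cocycle_BX [simp]: "w \<in> cocycles BX {}"
  using w_cocycle by (simp add: B_eq)

abbreviation "W \<equiv> cup_power BX w"

lemma cup_power_add: "cup BX (W i) (W j) = W (i + j)"
proof (induction j)
  case 0
  have "W i \<in> cochains BX {}"
    by (simp add: cocycles_cochains)
  then show ?case by (simp add: cup_one_right)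
next
  case (Suc j)
  then show ?case by (simp add: cup_assoc[symmetric])
qed

text \<open>One more factor moves past \<open>c\<close> by \<open>w_commutes\<close>, the others by
  induction; the term with \<open>c\<close> before the last factor occurs in both steps and
  cancels.\<close>

lemma W_commutes:
  assumes c: "c \<in> cocycles BX S"
  shows "cup BX (W i) c + cup BX c (W i) \<in> coboundaries BX S"
proof (induction i)
  case 0
  have "c \<in> cochains BX {}"
    using c cocycles_cochains cochains_absolute by blast
  then show ?case
    by (simp add: cup_one_left cup_one_right)
next
  case (Suc i)
  have "cup BX (W i) (cup BX w c + cup BX c w) \<in> coboundaries BX S"
    using w_commutes[OF invariant_F, of c] c by (intro coboundaries_cup_right) (auto simp: q_image B_eq)
  moreover have "cup BX (cup BX (W i) c + cup BX c (W i)) w \<in> coboundaries BX S"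
    by (rule coboundaries_cup_left[OF Suc]) simp
  ultimately have "cup BX (W i) (cup BX w c + cup BX c w) + cup BX (cup BX (W i) c + cup BX c (W i)) w
      \<in> coboundaries BX S"
    by (rule coboundaries_add)
  also have "cup BX (W i) (cup BX w c + cup BX c w) + cup BX (cup BX (W i) c + cup BX c (W i)) w
      = cup BX (W (Suc i)) c + cup BX c (W (Suc i))
        + (cup BX (cup BX (W i) c) w + cup BX (cup BX (W i) c) w)"
    unfolding cup_add_left cup_add_right cup_power.simps cup_assoc by (simp only: ac_simps)
  finally show ?case
    by (simp only: cochain_add_self add_0_right)
qed

text \<open>The sheet of a point depends only on its coordinate in \<open>EC\<close>, so sheet
  cochains are natural, and \<open>w_unique\<close> transports this to the base.\<close>

lemma pullback_bc_w: "cochain_pullback BX (\<lambda>A. fst ` A) bc.w = w"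
  and continuous_classifying: "continuous_map BX BC (\<lambda>A. fst ` A)"
proof -
  have eq: "(\<lambda>A. fst ` A) \<circ> q = bc.q \<circ> fst"
    by (auto simp: q_def bc.q_def fun_eq_iff)
  have "continuous_map E BC (bc.q \<circ> fst)"
    using continuous_map_compose[OF continuous_map_fst bc.continuous_q] by (simp add: bc_B)
  then have c: "continuous_map B BC (\<lambda>A. fst ` A)"
    unfolding eq[symmetric] by (rule continuous_compose_quotient_map[OF quotient_map_q])
  then show "continuous_map BX BC (\<lambda>A. fst ` A)"
    by (simp add: B_eq)
  have sheet: "cochain_pullback E fst bc.sheet = sheet"
  proof (intro ext)
    fix n s
    show "cochain_pullback E fst bc.sheet n s = sheet n s"
    proof -
      have "simplex_map 0 fst s (\<lambda>j. if j = 0 then 1 else 0) = fst (s (\<lambda>j. if j = 0 then 1 else 0))"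
        by (simp add: simplex_map_def)
      then show ?thesis
        using singular_simplex_simplex_map[OF _ continuous_map_fst[of EC X], of n s]
        by (cases "n = 0") (auto simp: cochain_pullback_def bc.sheet_def sheet_def)
    qed
  qed
  have "cochain_pullback B (\<lambda>A. fst ` A) bc.w = w"
  proof (rule w_unique)
    show "cochain_pullback B (\<lambda>A. fst ` A) bc.w \<in> cochains B {}"
      by (rule pullback_in_cochains[where Y=BC and T="{}"]) (use c bc.w_cochain in \<open>simp_all add: bc_B\<close>)
    have "pull (cochain_pullback B (\<lambda>A. fst ` A) bc.w) = cochain_pullback E fst (bc.pull bc.w)"
      using pullback_compose[OF continuous_q, of "\<lambda>A. fst ` A" bc.w]
        pullback_compose[OF continuous_map_fst[of EC X], of bc.q bc.w] by (simp only: eq)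
    also have "\<dots> = coboundary E sheet"
      unfolding bc.pull_w pullback_coboundary[OF continuous_map_fst] sheet ..
    finally show "pull (cochain_pullback B (\<lambda>A. fst ` A) bc.w) = coboundary E sheet" .
  qed
  then show "cochain_pullback BX (\<lambda>A. fst ` A) bc.w = w"
    by (simp add: B_eq)
qed

lemma u_power_class: "cohom_map BX {} (\<lambda>A. fst ` A) (u_class [^]\<^bsub>cohom BC {}\<^esub> j) = cohom_class BX {} (W j)"
proof -
  have "u_class [^]\<^bsub>cohom BC {}\<^esub> j = cohom_class BC {} (cup_power BC bc.w j)"
    unfolding u_class_eq using cohom_power[of bc.w BC j] bc.w_cocycle by (simp add: bc_B)
  then show ?thesis
    using cohom_map_class[where X=BX and S="{}" and Y=BC and T="{}"] continuous_classifying
    by (simp add: pullback_cup_power pullback_bc_w)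
qed

end

section \<open>Trivial actions\<close>

locale trivial_pair = equivariant_pair +
  assumes trivial: "x \<in> topspace X \<Longrightarrow> \<tau> x = x"
begin

definition proj :: "((nat \<Rightarrow> real) \<times> 'a) set \<Rightarrow> 'a" where "proj A = the_elem (snd ` A)"

definition P :: "'a cochain \<Rightarrow> ((nat \<Rightarrow> real) \<times> 'a) set cochain" where
  "P = cochain_pullback BX proj"

lemma proj_q: "p \<in> topspace E \<Longrightarrow> proj (q p) = snd p"
  by (auto simp: proj_def q_def trivial)

lemma proj_orbit: "x \<in> topspace X \<Longrightarrow> proj (borel_orbit \<tau> (e, x)) = x"
  by (auto simp: proj_def borel_orbit_def trivial)

lemma pair_map_proj: "pair_map BX S X Y proj"
proof
  have "continuous_map E X (proj \<circ> q)"
    by (rule continuous_map_eq[OF continuous_map_snd]) (simp add: proj_q)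
  then show "continuous_map BX X proj"
    using continuous_compose_quotient_map[OF quotient_map_q] by (simp add: B_eq)
  show "proj ` (topspace BX \<inter> S) \<subseteq> Y"
    using Y_subset by (auto simp: borel_subset_def proj_orbit)
qed

lemma P_cocycles: "x \<in> cocycles X Y \<Longrightarrow> P x \<in> cocycles BX S"
  unfolding P_def by (rule cocycles_pullback[OF pair_map_proj])

lemma P_coboundaries: "x \<in> coboundaries X Y \<Longrightarrow> P x \<in> coboundaries BX S"
  unfolding P_def by (rule coboundaries_pullback[OF pair_map_proj])

lemma P_add: "P (a + b) = P a + P b"
  by (simp add: P_def pullback_add)

lemma P_zero [simp]: "P 0 = 0"
  by (simp add: P_def)

lemma P_cup: "P (cup X a b) = cup BX (P a) (P b)"
  unfolding P_def by (rule pullback_cup) (use pair_map_proj in blast)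

lemma P_one: "P (one_cochain X) = one_cochain BX"
  unfolding P_def by (rule pullback_one) (use pair_map_proj in blast)

text \<open>The fibre inclusion is a section of \<open>proj\<close>. Restriction to the fibre thus
  reads off the coefficient of u^0.\<close>

lemma rho_P:
  assumes "c \<in> cochains X Y"
  shows "rho (P c) = c"
proof -
  have "rho (P c) = cochain_pullback X (proj \<circ> (\<lambda>x. borel_orbit \<tau> (base_point, x))) c"
    unfolding rho_def P_def by (rule pullback_compose) (use pair_map_fibre in blast)
  also have "\<dots> = c"
    by (rule pullback_id[OF assms]) (simp add: proj_orbit)
  finally show ?thesis .
qed

text \<open>Up to a coboundary a cocycle upstairs comes from \<open>X\<close> along
  \<open>snd\<close>. For a trivial action \<open>snd\<close> factors through the base, and pulled
  back cochains have transfer 0.\<close>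

lemma transfer_coboundary_if_trivial:
  assumes y: "y \<in> cocycles E F"
  shows "transfer y \<in> coboundaries BX S"
proof -
  let ?y = "cochain_pullback X (\<lambda>x. (base_point, x)) y"
  obtain b where b: "b \<in> cochains E F" "y + cochain_pullback E (\<lambda>p. (base_point, snd p)) y = coboundary E b"
    using EC_times_contractible[OF y] by (rule coboundariesE)
  have "cochain_pullback E (\<lambda>p. (base_point, snd p)) y = cochain_pullback E snd ?y"
    by (subst pullback_compose[OF continuous_map_snd]) (simp add: comp_def)
  also have "\<dots> = cochain_pullback E (proj \<circ> q) ?y"
    by (rule pullback_cong) (simp add: proj_q)
  also have "\<dots> = pull (P ?y)"
    unfolding P_def B_eq[symmetric] by (rule pullback_compose[OF continuous_q, symmetric])
  finally have "transfer (y + cochain_pullback E (\<lambda>p. (base_point, snd p)) y) = transfer y"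
    by (simp add: transfer_add transfer_pull)
  then have "transfer y = coboundary BX (transfer b)"
    using b(2) coboundary_transfer[OF cochains_absolute[OF b(1)]] by (simp add: B_eq)
  then show ?thesis
    using transfer_in_cochains[OF invariant_F b(1)] by (metis B_eq q_image coboundariesI)
qed

text \<open>By the Gysin kernel \<open>z\<close> is the transfer of a cocycle, and over a trivial
  action such transfers bound.\<close>

lemma cancel_w:
  assumes "z \<in> cocycles BX S" "cup BX z w \<in> coboundaries BX S"
  shows "z \<in> coboundaries BX S"
  using gysin_kernel[OF invariant_F, of z] assms transfer_coboundary_if_trivial
  by (metis B_eq q_image)

section \<open>Filtration of the equivariant classes by degree in \<open>u\<close>\<close>

definition poly :: "(nat \<Rightarrow> 'a cochain) \<Rightarrow> nat \<Rightarrow> ((nat \<Rightarrow> real) \<times> 'a) set cochain" where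
  "poly f m = (\<Sum>i<m. cup BX (P (f i)) (W i))"

text \<open>Only the exponent of \<open>u\<close> is bounded, the coefficients may have any degree.
  Working modulo coboundaries makes membership a property of the class.\<close>

definition L :: "nat \<Rightarrow> ((nat \<Rightarrow> real) \<times> 'a) set cochain set" where
  "L m = {z. \<exists>f. (\<forall>i. f i \<in> cocycles X Y) \<and> z + poly f m \<in> coboundaries BX S}"

lemma L_I: "\<lbrakk>\<And>i. f i \<in> cocycles X Y; z + poly f m \<in> coboundaries BX S\<rbrakk> \<Longrightarrow> z \<in> L m"
  by (auto simp: L_def)

lemma L_E:
  assumes "z \<in> L m"
  obtains f where "\<And>i. f i \<in> cocycles X Y" "z + poly f m \<in> coboundaries BX S"
  using assms by (auto simp: L_def)

lemma monomial_cocycle [simp]: "x \<in> cocycles X Y \<Longrightarrow> cup BX (P x) (W i) \<in> cocycles BX S"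
  by (intro cocycles_cup_left P_cocycles cocycles_cup_power w_cocycle_BX)

lemma poly_cocycle: "(\<And>i. f i \<in> cocycles X Y) \<Longrightarrow> poly f m \<in> cocycles BX S"
  unfolding poly_def by (intro cocycles_sum monomial_cocycle)

lemma poly_add: "poly (\<lambda>i. f i + g i) m = poly f m + poly g m"
  by (simp add: poly_def P_add cup_add_left sum.distrib)

lemma L_add: "\<lbrakk>a \<in> L m; b \<in> L m\<rbrakk> \<Longrightarrow> a + b \<in> L m"
proof -
  assume "a \<in> L m" "b \<in> L m"
  then obtain f g where f: "\<And>i. f i \<in> cocycles X Y" "a + poly f m \<in> coboundaries BX S"
    and g: "\<And>i. g i \<in> cocycles X Y" "b + poly g m \<in> coboundaries BX S"
    by (metis L_E)
  have "(a + poly f m) + (b + poly g m) \<in> coboundaries BX S"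
    using f g by simp
  also have "(a + poly f m) + (b + poly g m) = (a + b) + poly (\<lambda>i. f i + g i) m"
    by (simp only: poly_add ac_simps)
  finally show ?thesis
    using f g by (intro L_I[of "\<lambda>i. f i + g i"]) auto
qed

lemma coboundaries_L: "z \<in> coboundaries BX S \<Longrightarrow> z \<in> L m"
  by (rule L_I[of "\<lambda>i. 0"]) (auto simp: poly_def)

lemma L_0: "z \<in> L 0 \<Longrightarrow> z \<in> coboundaries BX S"
  by (auto simp: L_def poly_def)

lemma L_cong:
  assumes "z \<in> L m" "z + z' \<in> coboundaries BX S"
  shows "z' \<in> L m"
  using L_add[OF assms(1) coboundaries_L[OF assms(2)]] by simp

lemma L_monomial:
  assumes x: "x \<in> cocycles X Y" and i: "i < m"
  shows "cup BX (P x) (W i) \<in> L m"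
proof (rule L_I)
  show "(if j = i then x else 0) \<in> cocycles X Y" for j
    using x by simp
  have "poly (\<lambda>j. if j = i then x else 0) m = (\<Sum>j<m. if j = i then cup BX (P x) (W i) else 0)"
    unfolding poly_def by (intro sum.cong) auto
  also have "\<dots> = cup BX (P x) (W i)"
    using i by simp
  finally show "cup BX (P x) (W i) + poly (\<lambda>j. if j = i then x else 0) m \<in> coboundaries BX S"
    by simp
qed

lemma L_sum: "(\<And>i. i \<in> I \<Longrightarrow> f i \<in> L m) \<Longrightarrow> (\<Sum>i\<in>I. f i) \<in> L m"
  by (induction I rule: infinite_finite_induct) (auto simp: coboundaries_L L_add)

lemma L_mono:
  assumes "z \<in> L m" "m \<le> n"
  shows "z \<in> L n"
proof -
  obtain f where f: "\<And>i. f i \<in> cocycles X Y" "z + poly f m \<in> coboundaries BX S"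
    using L_E[OF assms(1)] by blast
  have "poly f m \<in> L n"
    unfolding poly_def using f(1) assms(2) by (intro L_sum L_monomial) auto
  then show ?thesis
    by (rule L_cong) (use f(2) in \<open>simp add: add.commute\<close>)
qed

lemma poly_Suc_shift: "poly f (Suc m) = P (f 0) + cup BX (poly (\<lambda>i. f (Suc i)) m) w"
  if "\<And>i. f i \<in> cocycles X Y"
proof -
  have "P (f 0) \<in> cochains BX {}"
    using P_cocycles[OF that] cocycles_cochains cochains_absolute by blast
  then show ?thesis
    by (simp add: poly_def sum.lessThan_Suc_shift cup_sum_left cup_assoc cup_one_right del: sum.lessThan_Suc)
qed

text \<open>The constant coefficient must bound, because restriction to the fibre kills every
  multiple of \<open>w\<close>. What is left is divisible by \<open>w\<close> and can be
  cancelled.\<close>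

lemma L_cancel:
  assumes z: "z \<in> cocycles BX S" and zw: "cup BX z w \<in> L (Suc m)"
  shows "z \<in> L m"
proof -
  obtain f where f: "\<And>i. f i \<in> cocycles X Y" "cup BX z w + poly f (Suc m) \<in> coboundaries BX S"
    using L_E[OF zw] by blast
  define p where "p = poly (\<lambda>i. f (Suc i)) m"
  have p: "p \<in> cocycles BX S"
    unfolding p_def using f(1) by (rule poly_cocycle)
  have "cup BX z w + poly f (Suc m) = P (f 0) + cup BX (z + p) w"
    unfolding poly_Suc_shift[OF f(1)] p_def cup_add_left by (simp only: ac_simps)
  with f(2) have 1: "P (f 0) + cup BX (z + p) w \<in> coboundaries BX S"
    by simp
  \<comment> \<open>Uses \<open>rho_w\<close> and \<open>rho_P\<close>, both of them equalities of
    cochains.\<close>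
  have "rho (P (f 0) + cup BX (z + p) w) = f 0"
    using f(1)[of 0] by (simp add: rho_add rho_cup rho_w rho_P cocycles_cochains)
  then have "f 0 \<in> coboundaries X Y"
    using rho_coboundaries[OF 1] by simp
  then have "P (f 0) + (P (f 0) + cup BX (z + p) w) \<in> coboundaries BX S"
    by (rule coboundaries_add[OF P_coboundaries 1])
  then have "cup BX (z + p) w \<in> coboundaries BX S"
    by simp
  then have "z + p \<in> coboundaries BX S"
    by (rule cancel_w[OF cocycles_add[OF z p]])
  then show ?thesis
    unfolding p_def by (rule L_I[OF f(1)])
qed

text \<open>Cancelling \<open>w\<close> k times brings \<open>P x\<close> into \<open>L 0\<close>,
  where only coboundaries are left; restriction to the fibre then returns \<open>x\<close>.\<close>

lemma L_leading_coefficient: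
  assumes x: "x \<in> cocycles X Y"
  shows "cup BX (P x) (W k) \<in> L k \<Longrightarrow> x \<in> coboundaries X Y"
proof (induction k)
  case 0
  have "P x \<in> cochains BX {}"
    using P_cocycles[OF x] cocycles_cochains cochains_absolute by blast
  then have "P x \<in> coboundaries BX S"
    using L_0[OF 0] by (simp add: cup_one_right)
  then have "rho (P x) \<in> coboundaries X Y"
    by (rule rho_coboundaries)
  then show ?case
    using rho_P[OF cocycles_cochains[OF x]] by simp
next
  case (Suc k)
  have "cup BX (cup BX (P x) (W k)) w \<in> L (Suc k)"
    using Suc.prems by (simp add: cup_assoc)
  then have "cup BX (P x) (W k) \<in> L k"
    by (rule L_cancel[OF monomial_cocycle[OF x]])
  then show ?case
    by (rule Suc.IH)
qed

text \<open>Everything but the exchange of \<open>W i\<close> with \<open>P y\<close> is an equality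
  of cochains.\<close>

lemma monomial_mult:
  assumes x: "x \<in> cocycles X Y" and y: "y \<in> cocycles X Y"
  shows "cup BX (cup BX (P x) (W i)) (cup BX (P y) (W j)) + cup BX (P (cup X x y)) (W (i + j))
    \<in> coboundaries BX S"
proof -
  have "cup BX (P x) (cup BX (cup BX (W i) (P y) + cup BX (P y) (W i)) (W j)) \<in> coboundaries BX S"
    using P_cocycles[OF x] P_cocycles[OF y] cocycles_absolute
    by (intro coboundaries_cup_right coboundaries_cup_left W_commutes) auto
  also have "cup BX (P x) (cup BX (cup BX (W i) (P y) + cup BX (P y) (W i)) (W j))
      = cup BX (cup BX (P x) (W i)) (cup BX (P y) (W j)) + cup BX (P (cup X x y)) (W (i + j))"
    unfolding cup_add_left cup_add_right P_cup cup_power_add[symmetric] cup_assoc ..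
  finally show ?thesis .
qed

text \<open>The largest exponents are a - 1 and b - 1, so those of the product stay below m when a +
  b is at most m + 1.\<close>

lemma L_mult:
  assumes z: "z \<in> L a" "z \<in> cocycles BX S" and z': "z' \<in> L b" "z' \<in> cocycles BX S" and ab: "a + b \<le> Suc m"
  shows "cup BX z z' \<in> L m"
proof -
  obtain f where f: "\<And>i. f i \<in> cocycles X Y" "z + poly f a \<in> coboundaries BX S"
    using L_E[OF z(1)] by blast
  obtain g where g: "\<And>i. g i \<in> cocycles X Y" "z' + poly g b \<in> coboundaries BX S"
    using L_E[OF z'(1)] by blast
  have "cup BX (cup BX (P (f i)) (W i)) (cup BX (P (g j)) (W j)) \<in> L m" if "i < a" "j < b" for i j
  proof (rule L_cong)
    show "cup BX (P (cup X (f i) (g j))) (W (i + j)) \<in> L m"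
      using that ab f(1) g(1) by (intro L_monomial cocycles_cup) auto
    show "cup BX (P (cup X (f i) (g j))) (W (i + j)) + cup BX (cup BX (P (f i)) (W i)) (cup BX (P (g j)) (W j))
        \<in> coboundaries BX S"
      using monomial_mult[OF f(1) g(1)] by (simp only: add.commute)
  qed
  then have 1: "cup BX (poly f a) (poly g b) \<in> L m"
    unfolding poly_def cup_sum_left cup_sum_right by (intro L_sum) auto
  have "cup BX (z + poly f a) z' \<in> coboundaries BX S"
    using f(2) z'(2) cocycles_absolute by (intro coboundaries_cup_left)
  moreover have "poly f a \<in> cocycles BX {}"
    by (rule cocycles_absolute[OF poly_cocycle[OF f(1)]])
  then have "cup BX (poly f a) (z' + poly g b) \<in> coboundaries BX S"
    using g(2) by (rule coboundaries_cup_right)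
  ultimately have "cup BX (z + poly f a) z' + cup BX (poly f a) (z' + poly g b) \<in> coboundaries BX S"
    by (rule coboundaries_add)
  also have "cup BX (z + poly f a) z' + cup BX (poly f a) (z' + poly g b)
      = cup BX (poly f a) (poly g b) + cup BX z z' + (cup BX (poly f a) z' + cup BX (poly f a) z')"
    unfolding cup_add_left cup_add_right by (simp only: ac_simps)
  finally have "cup BX (poly f a) (poly g b) + cup BX z z' \<in> coboundaries BX S"
    by (simp only: cochain_add_self add_0_right)
  then show ?thesis
    by (rule L_cong[OF 1])
qed

text \<open>With leading terms X and Y, the product z z' differs from X Y by z (z' + Y) and (z + X)
  Y, and each of these has a factor of lower degree.\<close>

lemma L_mult_leading:
  assumes x: "x \<in> cocycles X Y" and z: "z \<in> cocycles BX S" "z + cup BX (P x) (W i) \<in> L i"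
    and y: "y \<in> cocycles X Y" and z': "z' \<in> cocycles BX S" "z' + cup BX (P y) (W j) \<in> L j"
  shows "cup BX z z' + cup BX (P (cup X x y)) (W (i + j)) \<in> L (i + j)"
proof -
  let ?x = "cup BX (P x) (W i)" and ?y = "cup BX (P y) (W j)"
  have "z + ?x + ?x \<in> L (Suc i)"
    by (rule L_add) (use L_mono[OF z(2), of "Suc i"] L_monomial[OF x, of i "Suc i"] in auto)
  then have "z \<in> L (Suc i)"
    by (simp add: add.assoc)
  then have "cup BX z (z' + ?y) \<in> L (i + j)"
    by (rule L_mult[of z "Suc i" _ j]) (use z z' y in auto)
  moreover have "cup BX (z + ?x) ?y \<in> L (i + j)"
    by (rule L_mult[of _ i _ "Suc j"]) (use z x y L_monomial[OF y, of j "Suc j"] in auto)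
  moreover have "cup BX ?x ?y + cup BX (P (cup X x y)) (W (i + j)) \<in> L (i + j)"
    by (rule coboundaries_L[OF monomial_mult[OF x y]])
  ultimately have "cup BX z (z' + ?y) + cup BX (z + ?x) ?y
      + (cup BX ?x ?y + cup BX (P (cup X x y)) (W (i + j))) \<in> L (i + j)"
    by (rule L_add[OF L_add])
  also have "cup BX z (z' + ?y) + cup BX (z + ?x) ?y + (cup BX ?x ?y + cup BX (P (cup X x y)) (W (i + j)))
      = cup BX z z' + cup BX (P (cup X x y)) (W (i + j)) + (cup BX z ?y + cup BX z ?y)
        + (cup BX ?x ?y + cup BX ?x ?y)"
    unfolding cup_add_left cup_add_right by (simp only: ac_simps)
  finally show ?thesis
    by (simp only: cochain_add_self add_0_right)
qed

text \<open>The passage from the polynomial ring over cohomology classes to the cochains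
  \<open>poly\<close>.\<close>

lemma kunneth_class:
  assumes p: "p \<in> carrier (UP (cohom X Y))"
    and deg: "\<And>j. m \<le> j \<Longrightarrow> coeff (UP (cohom X Y)) p j = \<zero>\<^bsub>cohom X Y\<^esub>"
  obtains f where "\<And>i. f i \<in> cocycles X Y" "\<And>i. coeff (UP (cohom X Y)) p i = cohom_class X Y (f i)"
    "kunneth X \<tau> Y p = cohom_class BX S (poly f m)"
proof -
  let ?c = "coeff (UP (cohom X Y)) p"
  have "?c i \<in> carrier (cohom X Y)" for i
    using p by (auto simp: UP_def up_def)
  \<comment> \<open>A vanishing coefficient is represented by the zero cochain, so that the sum over
    the support in \<open>kunneth\<close> equals the sum over all i < m.\<close>
  then have "\<exists>x. x \<in> cocycles X Y \<and> ?c i = cohom_class X Y x \<and> (?c i = \<zero>\<^bsub>cohom X Y\<^esub> \<longrightarrow> x = 0)" for i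
    by (cases "?c i = \<zero>\<^bsub>cohom X Y\<^esub>") (auto simp: carrier_cohom cohom_zero)
  then obtain f where f: "\<And>i. f i \<in> cocycles X Y" "\<And>i. ?c i = cohom_class X Y (f i)"
    "\<And>i. ?c i = \<zero>\<^bsub>cohom X Y\<^esub> \<Longrightarrow> f i = 0"
    by metis
  let ?J = "{j. ?c j \<noteq> \<zero>\<^bsub>cohom X Y\<^esub>}"
  have J: "?J \<subseteq> {..<m}"
    using deg by (auto simp: not_le[symmetric])
  have summand: "cup_absolute BX S (cohom_map BX S (\<lambda>A. the_elem (snd ` A)) (?c j))
      (cohom_map BX {} (\<lambda>A. fst ` A) (u_class [^]\<^bsub>cohom BC {}\<^esub> j)) = cohom_class BX S (cup BX (P (f j)) (W j))" for j
  proof -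
    have "cohom_map BX S (\<lambda>A. the_elem (snd ` A)) (?c j) = cohom_class BX S (P (f j))"
      unfolding f(2) P_def using cohom_map_class[OF pair_map_proj] by (simp add: proj_def[abs_def])
    then show ?thesis
      unfolding u_power_class using P_cocycles[OF f(1)] by (simp add: cup_absolute_class)
  qed
  have "kunneth X \<tau> Y p = (\<Oplus>\<^bsub>cohom BX S\<^esub>j\<in>?J. cohom_class BX S (cup BX (P (f j)) (W j)))"
    unfolding kunneth_def Let_def summand ..
  also have "\<dots> = cohom_class BX S (\<Sum>j\<in>?J. cup BX (P (f j)) (W j))"
    using J f(1) by (intro finsum_cohom_class) (auto intro: finite_subset)
  also have "(\<Sum>j\<in>?J. cup BX (P (f j)) (W j)) = poly f m"
    unfolding poly_def using J f(3) by (intro sum.mono_neutral_left) auto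
  finally show ?thesis
    using that f by blast
qed

end

section \<open>Conjugations\<close>

text \<open>At this point \<open>cohom\<close> is known as an abelian group, so the polynomial
  operations are evaluated directly on coefficient functions.\<close>

lemma UP_leading_coefficient:
  assumes R: "abelian_group R" and a: "a \<in> carrier R" and l: "l \<in> carrier (UP R)"
  shows "monom (UP R) a m \<oplus>\<^bsub>UP R\<^esub> l \<in> carrier (UP R)"
    and "coeff (UP R) (monom (UP R) a m \<oplus>\<^bsub>UP R\<^esub> l) j
      = (if j = m then a else \<zero>\<^bsub>R\<^esub>) \<oplus>\<^bsub>R\<^esub> coeff (UP R) l j"
proof -
  interpret abelian_group R by (rule R)
  let ?a = "\<lambda>j. if j = m then a else \<zero>\<^bsub>R\<^esub>"
  have l': "l \<in> up R"
    using l by (simp add: UP_def)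
  then obtain n where l_fun: "\<And>j. l j \<in> carrier R" and n: "bound \<zero>\<^bsub>R\<^esub> n l"
    by (auto simp: up_def)
  have a': "?a \<in> up R"
    using a by (auto simp: up_def intro!: exI[of _ m])
  have "bound \<zero>\<^bsub>R\<^esub> (max m n) (\<lambda>j. ?a j \<oplus>\<^bsub>R\<^esub> l j)"
    using bound.bound[OF n] by (intro bound.intro) auto
  then have sum: "(\<lambda>j. ?a j \<oplus>\<^bsub>R\<^esub> l j) \<in> up R"
    using a l_fun by (intro mem_upI) auto
  have monom: "monom (UP R) a m = ?a"
    using a by (simp add: UP_def)
  have eq: "monom (UP R) a m \<oplus>\<^bsub>UP R\<^esub> l = (\<lambda>j. ?a j \<oplus>\<^bsub>R\<^esub> l j)"
    unfolding monom using a' l' by (simp add: UP_def)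
  show "monom (UP R) a m \<oplus>\<^bsub>UP R\<^esub> l \<in> carrier (UP R)"
    unfolding eq using sum by (simp add: UP_def)
  show "coeff (UP R) (monom (UP R) a m \<oplus>\<^bsub>UP R\<^esub> l) j = ?a j \<oplus>\<^bsub>R\<^esub> coeff (UP R) l j"
    unfolding eq using sum l' by (simp add: UP_def)
qed

section \<open>Reduction from even cocycles to homogeneous ones\<close>

definition even_cocycles :: "'a topology \<Rightarrow> 'a set \<Rightarrow> 'a cochain set" where
  "even_cocycles X S = {c \<in> cocycles X S. \<forall>k. odd k \<longrightarrow> c k = 0}"

lemma even_cocyclesD: "c \<in> even_cocycles X S \<Longrightarrow> c \<in> cocycles X S"
  by (simp add: even_cocycles_def)

lemma carrier_cohom_even': "carrier (cohom_even X S) = cohom_class X S ` even_cocycles X S"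
  by (simp add: carrier_cohom_even even_cocycles_def)

lemma even_cocycles_homogeneous:
  assumes "c \<in> cocycles X S" "homogeneous (2 * m) c"
  shows "c \<in> even_cocycles X S"
proof -
  have "c k = 0" if "odd k" for k
  proof -
    have "k \<noteq> 2 * m"
      using that by auto
    then show ?thesis
      using assms(2) by (simp add: homogeneous_def)
  qed
  then show ?thesis
    using assms(1) by (simp add: even_cocycles_def)
qed

lemma even_cocycles_zero: "0 \<in> even_cocycles X S"
  by (auto simp: even_cocycles_def zero_fun_apply)

lemma even_cocycles_add: "\<lbrakk>a \<in> even_cocycles X S; b \<in> even_cocycles X S\<rbrakk> \<Longrightarrow> a + b \<in> even_cocycles X S"
  by (auto simp: even_cocycles_def plus_fun_apply)

text \<open>The conjugation equation speaks of homogeneous classes only. A cochain is the finite sum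
  of its components, so additive properties extend from these.\<close>

lemma even_cocycle_induct [consumes 1, case_names homogeneous add]:
  assumes c: "c \<in> even_cocycles X S"
    and hom: "\<And>m a. \<lbrakk>a \<in> cocycles X S; homogeneous (2 * m) a\<rbrakk> \<Longrightarrow> Q a"
    and add: "\<And>a b. \<lbrakk>a \<in> even_cocycles X S; b \<in> even_cocycles X S; Q a; Q b\<rbrakk> \<Longrightarrow> Q (a + b)"
  shows "Q c"
proof -
  have c': "c \<in> cocycles X S"
    using c by (rule even_cocyclesD)
  obtain N where N: "\<And>n. N < n \<Longrightarrow> c n = 0"
    using cochains_bounded[OF cocycles_cochains[OF c']] by blast
  have comp: "component n c \<in> even_cocycles X S \<and> Q (component n c)" for n
  proof (cases "even n")
    case True
    then obtain m where "n = 2 * m" by blast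
    then show ?thesis
      using hom[of "component n c" m] even_cocycles_homogeneous[of "component n c" X S m] c' by simp
  next
    \<comment> \<open>A component in odd degree is zero and counts as homogeneous of degree
      0.\<close>
    case False
    then have "component n c = 0"
      using c by (auto simp: even_cocycles_def component_def fun_eq_iff zero_fun_apply)
    then show ?thesis
      using hom[of 0 0] even_cocycles_zero by simp
  qed
  have "(\<Sum>n\<le>M. component n c) \<in> even_cocycles X S \<and> Q (\<Sum>n\<le>M. component n c)" for M
  proof (induction M)
    case 0
    then show ?case using comp by simp
  next
    case (Suc M)
    then show ?case
      using comp[of "Suc M"] add[of "\<Sum>n\<le>M. component n c" "component (Suc M) c"]
        even_cocycles_add[of "\<Sum>n\<le>M. component n c" X S "component (Suc M) c"] by simp
  qed
  from this[of N] show ?thesis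
    using sum_components[of N c] N by simp
qed

lemma even_cocycles_cup:
  assumes "a \<in> even_cocycles X S" "b \<in> even_cocycles X S"
  shows "cup X a b \<in> even_cocycles X S"
  using assms
proof (induction a rule: even_cocycle_induct)
  case (homogeneous m a)
  show ?case
    using homogeneous(3,1,2)
  proof (induction b rule: even_cocycle_induct)
    case (homogeneous k b)
    then show ?case
      using even_cocycles_homogeneous[of "cup X a b" X S "m + k"] homogeneous_cup[of "2 * m" a "2 * k" b X]
      by (simp add: cocycles_cup algebra_simps)
  next
    case (add b c)
    then show ?case
      by (simp add: cup_add_right even_cocycles_add)
  qed
next
  case (add a c)
  then show ?case
    by (simp add: cup_add_left even_cocycles_add)
qed

lemma cup_cong_coboundaries:
  assumes "a \<in> cocycles X S" "b \<in> cocycles X S" "a' \<in> cocycles X S" "b' \<in> cocycles X S"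
    and "a + a' \<in> coboundaries X S" "b + b' \<in> coboundaries X S"
  shows "cup X a b + cup X a' b' \<in> coboundaries X S"
proof -
  have "cup X (a + a') b + cup X a' (b + b') \<in> coboundaries X S"
    by (rule coboundaries_add[OF coboundaries_cup_left[OF assms(5) cocycles_absolute[OF assms(2)]]
          coboundaries_cup_right[OF cocycles_absolute[OF assms(3)] assms(6)]])
  also have "cup X (a + a') b + cup X a' (b + b') = cup X a b + cup X a' b' + (cup X a' b + cup X a' b)"
    unfolding cup_add_left cup_add_right by (simp only: ac_simps)
  finally show ?thesis
    by (simp only: cochain_add_self add_0_right)
qed

text \<open>Induction in each factor by distributivity. The values of \<open>h\<close> are replaced
  by representatives \<open>g\<close>, since distributivity is available for cochains.\<close>

lemma multiplicative_if_multiplicative_on_homogeneous: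
  fixes h :: "'a cochain set \<Rightarrow> 'b cochain set"
  assumes car: "\<And>c. c \<in> even_cocycles X S \<Longrightarrow> h (cohom_class X S c) \<in> carrier (cohom Z V)"
    and add: "\<And>c d. \<lbrakk>c \<in> even_cocycles X S; d \<in> even_cocycles X S\<rbrakk> \<Longrightarrow>
      h (cohom_class X S (c + d)) = h (cohom_class X S c) \<oplus>\<^bsub>cohom Z V\<^esub> h (cohom_class X S d)"
    and hom: "\<And>m k c d. \<lbrakk>c \<in> cocycles X S; homogeneous (2 * m) c; d \<in> cocycles X S; homogeneous (2 * k) d\<rbrakk> \<Longrightarrow>
      h (cohom_class X S (cup X c d)) = h (cohom_class X S c) \<otimes>\<^bsub>cohom Z V\<^esub> h (cohom_class X S d)"
    and c: "c \<in> even_cocycles X S" and d: "d \<in> even_cocycles X S"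
  shows "h (cohom_class X S (cup X c d)) = h (cohom_class X S c) \<otimes>\<^bsub>cohom Z V\<^esub> h (cohom_class X S d)"
proof -
  have "\<exists>x. c \<in> even_cocycles X S \<longrightarrow> x \<in> cocycles Z V \<and> h (cohom_class X S c) = cohom_class Z V x" for c
    using car[of c] by (auto simp: carrier_cohom)
  then obtain g where g: "\<And>c. c \<in> even_cocycles X S \<Longrightarrow> g c \<in> cocycles Z V"
    "\<And>c. c \<in> even_cocycles X S \<Longrightarrow> h (cohom_class X S c) = cohom_class Z V (g c)"
    by metis
  have left: "h (cohom_class X S (cup X (a + b) d)) = h (cohom_class X S (a + b)) \<otimes>\<^bsub>cohom Z V\<^esub> h (cohom_class X S d)"
    if "a \<in> even_cocycles X S" "b \<in> even_cocycles X S" "d \<in> even_cocycles X S"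
      "h (cohom_class X S (cup X a d)) = h (cohom_class X S a) \<otimes>\<^bsub>cohom Z V\<^esub> h (cohom_class X S d)"
      "h (cohom_class X S (cup X b d)) = h (cohom_class X S b) \<otimes>\<^bsub>cohom Z V\<^esub> h (cohom_class X S d)" for a b d
    using that by (simp add: cup_add_left add even_cocycles_cup g cohom_add cohom_mult)
  have right: "h (cohom_class X S (cup X d (a + b))) = h (cohom_class X S d) \<otimes>\<^bsub>cohom Z V\<^esub> h (cohom_class X S (a + b))"
    if "a \<in> even_cocycles X S" "b \<in> even_cocycles X S" "d \<in> even_cocycles X S"
      "h (cohom_class X S (cup X d a)) = h (cohom_class X S d) \<otimes>\<^bsub>cohom Z V\<^esub> h (cohom_class X S a)"
      "h (cohom_class X S (cup X d b)) = h (cohom_class X S d) \<otimes>\<^bsub>cohom Z V\<^esub> h (cohom_class X S b)" for a b d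
    using that by (simp add: cup_add_right add even_cocycles_cup g cohom_add cohom_mult)
  show ?thesis
    using c
  proof (induction c rule: even_cocycle_induct)
    case (homogeneous m c)
    show ?case
      using d
    proof (induction d rule: even_cocycle_induct)
      case (homogeneous k d)
      then show ?case
        using hom \<open>c \<in> cocycles X S\<close> \<open>homogeneous (2 * m) c\<close> by blast
    next
      case (add a b)
      then show ?case
        using right[of a b c] even_cocycles_homogeneous[OF homogeneous] by blast
    qed
  next
    case (add a b)
    then show ?case
      using left[of a b d] d by blast
  qed
qed

locale conjugation_frame = equivariant_pair X \<tau> Y
  for X :: "'a topology" and \<tau> :: "'a \<Rightarrow> 'a" and Y :: "'a set" +
  fixes \<kappa> :: "'a cochain set \<Rightarrow> 'a cochain set"
    and \<sigma> :: "'a cochain set \<Rightarrow> ((nat \<Rightarrow> real) \<times> 'a) set cochain set"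
  assumes odd: "odd n \<Longrightarrow> cohom_deg X Y n = {\<zero>\<^bsub>cohom X Y\<^esub>}"
    and frame: "H_frame X \<tau> Y \<kappa> \<sigma>"

lemma topspace_fixed_space: "topspace (fixed_space X \<tau>) = fixed_set X \<tau>"
  by (auto simp: fixed_space_def fixed_set_def)

sublocale conjugation_frame \<subseteq> Z: trivial_pair "fixed_space X \<tau>" \<tau> "Y \<inter> fixed_set X \<tau>"
proof
  have "continuous_map (fixed_space X \<tau>) (fixed_space X \<tau>) \<tau>"
    using involution unfolding fixed_space_def involution_def
    by (auto simp: continuous_map_in_subtopology continuous_map_from_subtopology fixed_set_def)
  then show "involution (fixed_space X \<tau>) \<tau>"
    by (simp add: involution_def topspace_fixed_space) (simp add: fixed_set_def)
qed (use \<tau>_Y in \<open>auto simp: topspace_fixed_space, auto simp: fixed_set_def\<close>)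

context conjugation_frame
begin

abbreviation "Z \<equiv> fixed_space X \<tau>"
abbreviation "V \<equiv> Y \<inter> fixed_set X \<tau>"

text \<open>An orbit of the fixed point set is literally an orbit of \<open>X\<close>, so the
  inclusion of the Borel constructions is \<open>id\<close>.\<close>

definition r :: "((nat \<Rightarrow> real) \<times> 'a) set cochain \<Rightarrow> ((nat \<Rightarrow> real) \<times> 'a) set cochain" where
  "r = cochain_pullback Z.BX id"

text \<open>The source carries its own quotient topology, so continuity of \<open>id\<close> is
  tested after composition with its quotient map.\<close>

lemma pair_map_r: "pair_map Z.BX Z.S BX S id"
proof
  have "continuous_map Z.E E id"
    by (simp add: fixed_space_def prod_topology_subtopology continuous_map_from_subtopology)
  then have "continuous_map Z.E B (q \<circ> id)"
    using continuous_q by (rule continuous_map_compose)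
  moreover have "q \<circ> id = id \<circ> Z.q"
    by (simp add: q_eq_orbit Z.q_eq_orbit)
  ultimately show "continuous_map Z.BX BX id"
    using continuous_compose_quotient_map[OF Z.quotient_map_q, of BX id] by (simp add: B_eq Z.B_eq)
  show "id ` (topspace Z.BX \<inter> Z.S) \<subseteq> S"
    by (auto simp: borel_subset_def)
qed

lemma r_map_class: "r_map X \<tau> Y (cohom_class BX S c) = cohom_class Z.BX Z.S (r c)"
  using cohom_map_class[OF pair_map_r] by (simp add: r_map_def r_def)

lemma r_cocycles: "c \<in> cocycles BX S \<Longrightarrow> r c \<in> cocycles Z.BX Z.S"
  unfolding r_def by (rule cocycles_pullback[OF pair_map_r])

lemma r_coboundaries: "c \<in> coboundaries BX S \<Longrightarrow> r c \<in> coboundaries Z.BX Z.S"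
  unfolding r_def by (rule coboundaries_pullback[OF pair_map_r])

lemma r_add: "r (a + b) = r a + r b"
  by (simp add: r_def pullback_add)

lemma r_cup: "r (cup BX a b) = cup Z.BX (r a) (r b)"
  unfolding r_def by (rule pullback_cup) (use pair_map_r in blast)

lemma r_one: "r (one_cochain BX) = one_cochain Z.BX"
  unfolding r_def by (rule pullback_one) (use pair_map_r in blast)

text \<open>Both classes are pulled back from \<open>BC\<close>, along maps that agree on the fixed
  part.\<close>

lemma r_w: "r w = Z.w"
proof -
  have "r w = cochain_pullback Z.BX ((\<lambda>A. fst ` A) \<circ> id) bc.w"
    unfolding r_def pullback_bc_w[symmetric] by (rule pullback_compose) (use pair_map_r in blast)
  then show ?thesis
    by (simp add: Z.pullback_bc_w)
qed

lemma \<kappa>_hom: "\<kappa> \<in> hom (add_monoid (cohom_even X Y)) (add_monoid (cohom Z V))"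
  and \<kappa>_inj: "inj_on \<kappa> (carrier (cohom_even X Y))"
  and \<kappa>_deg: "\<kappa> ` cohom_deg X Y (2 * m) \<subseteq> cohom_deg Z V m"
  and \<sigma>_hom: "\<sigma> \<in> hom (add_monoid (cohom_even X Y)) (add_monoid (cohom_even BX S))"
  and \<sigma>_deg: "\<sigma> ` cohom_deg X Y (2 * m) \<subseteq> cohom_deg BX S (2 * m)"
  and \<sigma>_section: "a \<in> carrier (cohom_even X Y) \<Longrightarrow> rho_map X \<tau> Y (\<sigma> a) = a"
  using frame by (auto simp: H_frame_def iso_def bij_betw_def)

lemma conjugation_equation:
  assumes "a \<in> cohom_deg X Y (2 * m)"
  obtains l where "l \<in> carrier (UP (cohom Z V))"
    "\<And>j. m \<le> j \<Longrightarrow> coeff (UP (cohom Z V)) l j = \<zero>\<^bsub>cohom Z V\<^esub>"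
    "r_map X \<tau> Y (\<sigma> a) = kunneth Z \<tau> V (monom (UP (cohom Z V)) (\<kappa> a) m \<oplus>\<^bsub>UP (cohom Z V)\<^esub> l)"
proof -
  have "\<forall>m. \<forall>a \<in> cohom_deg X Y (2 * m). \<exists>l \<in> carrier (UP (cohom Z V)).
      (\<forall>j\<ge>m. coeff (UP (cohom Z V)) l j = \<zero>\<^bsub>cohom Z V\<^esub>) \<and>
      r_map X \<tau> Y (\<sigma> a) = kunneth Z \<tau> V (monom (UP (cohom Z V)) (\<kappa> a) m \<oplus>\<^bsub>UP (cohom Z V)\<^esub> l)"
    using frame unfolding H_frame_def by (elim conjE)
  from this[rule_format, OF assms] show ?thesis
    using that by auto
qed

lemma \<kappa>_add: "\<lbrakk>c \<in> even_cocycles X Y; d \<in> even_cocycles X Y\<rbrakk> \<Longrightarrow>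
    \<kappa> (cohom_class X Y (c + d)) = \<kappa> (cohom_class X Y c) \<oplus>\<^bsub>cohom Z V\<^esub> \<kappa> (cohom_class X Y d)"
  and \<sigma>_add: "\<lbrakk>c \<in> even_cocycles X Y; d \<in> even_cocycles X Y\<rbrakk> \<Longrightarrow>
    \<sigma> (cohom_class X Y (c + d)) = \<sigma> (cohom_class X Y c) \<oplus>\<^bsub>cohom BX S\<^esub> \<sigma> (cohom_class X Y d)"
  and \<kappa>_carrier: "c \<in> even_cocycles X Y \<Longrightarrow> \<kappa> (cohom_class X Y c) \<in> carrier (cohom Z V)"
  and \<sigma>_carrier: "c \<in> even_cocycles X Y \<Longrightarrow> \<sigma> (cohom_class X Y c) \<in> carrier (cohom_even BX S)"
proof -
  have cls: "cohom_class X Y c \<in> carrier (cohom_even X Y)" if "c \<in> even_cocycles X Y" for c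
    using that by (simp add: carrier_cohom_even')
  have e: "cohom_class X Y (c + d) = cohom_class X Y c \<otimes>\<^bsub>add_monoid (cohom_even X Y)\<^esub> cohom_class X Y d"
    by (simp add: cohom_even_simps cohom_add)
  {
    assume "c \<in> even_cocycles X Y" "d \<in> even_cocycles X Y"
    then have cd: "cohom_class X Y c \<in> carrier (add_monoid (cohom_even X Y))"
      "cohom_class X Y d \<in> carrier (add_monoid (cohom_even X Y))"
      using cls by simp_all
    show "\<kappa> (cohom_class X Y (c + d)) = \<kappa> (cohom_class X Y c) \<oplus>\<^bsub>cohom Z V\<^esub> \<kappa> (cohom_class X Y d)"
      unfolding e hom_mult[OF \<kappa>_hom cd] by simp
    show "\<sigma> (cohom_class X Y (c + d)) = \<sigma> (cohom_class X Y c) \<oplus>\<^bsub>cohom BX S\<^esub> \<sigma> (cohom_class X Y d)"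
      unfolding e hom_mult[OF \<sigma>_hom cd] by (simp add: cohom_even_simps)
  }
  assume "c \<in> even_cocycles X Y"
  then have c: "cohom_class X Y c \<in> carrier (add_monoid (cohom_even X Y))"
    using cls by simp
  show "\<kappa> (cohom_class X Y c) \<in> carrier (cohom Z V)" "\<sigma> (cohom_class X Y c) \<in> carrier (cohom_even BX S)"
    using hom_in_carrier[OF \<kappa>_hom c] hom_in_carrier[OF \<sigma>_hom c] by simp_all
qed

lemma \<sigma>_carrier': "c \<in> even_cocycles X Y \<Longrightarrow> \<sigma> (cohom_class X Y c) \<in> carrier (cohom BX S)"
  using \<sigma>_carrier[of c] by (auto simp: carrier_cohom_even' carrier_cohom dest: even_cocyclesD)

lemma \<kappa>_zero: "\<kappa> (cohom_class X Y 0) = cohom_class Z V 0"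
  and \<sigma>_zero: "\<sigma> (cohom_class X Y 0) = cohom_class BX S 0"
proof -
  obtain x where "\<kappa> (cohom_class X Y 0) = cohom_class Z V x"
    using \<kappa>_carrier[OF even_cocycles_zero] by (auto simp: carrier_cohom)
  then show "\<kappa> (cohom_class X Y 0) = cohom_class Z V 0"
    using \<kappa>_add[OF even_cocycles_zero even_cocycles_zero] by (simp add: cohom_add)
  obtain x where "\<sigma> (cohom_class X Y 0) = cohom_class BX S x"
    using \<sigma>_carrier'[OF even_cocycles_zero] by (auto simp: carrier_cohom)
  then show "\<sigma> (cohom_class X Y 0) = cohom_class BX S 0"
    using \<sigma>_add[OF even_cocycles_zero even_cocycles_zero] by (simp add: cohom_add)
qed

lemma odd_coboundary:
  assumes "c \<in> cocycles X Y" "homogeneous n c" "odd n"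
  shows "c \<in> coboundaries X Y"
proof -
  have "cohom_class X Y c \<in> cohom_deg X Y n"
    using assms by (auto simp: cohom_deg_alt)
  then show ?thesis
    using odd[OF assms(3)] by (simp add: cohom_class_eq_zero_iff)
qed

text \<open>The conjugation equation at cochain level: the representative of the value under
  \<open>\<kappa>\<close> is the coefficient of u^m, and the lower terms are absorbed in
  \<open>Z.L m\<close>.\<close>

lemma frame_representatives:
  assumes a: "a \<in> cocycles X Y" "homogeneous (2 * m) a"
  obtains x z where "x \<in> cocycles Z V" "\<kappa> (cohom_class X Y a) = cohom_class Z V x"
    "z \<in> cocycles BX S" "homogeneous (2 * m) z" "\<sigma> (cohom_class X Y a) = cohom_class BX S z"
    "rho z + a \<in> coboundaries X Y" "r z + cup Z.BX (Z.P x) (Z.W m) \<in> Z.L m"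
proof -
  let ?a = "cohom_class X Y a" and ?U = "UP (cohom Z V)"
  have deg: "?a \<in> cohom_deg X Y (2 * m)"
    using a by (auto simp: cohom_deg_alt)
  have even: "a \<in> even_cocycles X Y"
    using a by (rule even_cocycles_homogeneous)
  obtain z where z: "z \<in> cocycles BX S" "homogeneous (2 * m) z" "\<sigma> ?a = cohom_class BX S z"
    using \<sigma>_deg[of m] deg by (auto simp: cohom_deg_alt image_subset_iff)
  have "rho_map X \<tau> Y (\<sigma> ?a) = ?a"
    using even by (intro \<sigma>_section) (auto simp: carrier_cohom_even')
  then have rho: "rho z + a \<in> coboundaries X Y"
    unfolding z(3) rho_map_class by (simp add: cohom_class_eq_iff)
  obtain l where l: "l \<in> carrier ?U" "\<And>j. m \<le> j \<Longrightarrow> coeff ?U l j = \<zero>\<^bsub>cohom Z V\<^esub>"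
    "r_map X \<tau> Y (\<sigma> ?a) = kunneth Z \<tau> V (monom ?U (\<kappa> ?a) m \<oplus>\<^bsub>?U\<^esub> l)"
    using conjugation_equation[OF deg] by blast
  let ?p = "monom ?U (\<kappa> ?a) m \<oplus>\<^bsub>?U\<^esub> l"
  interpret abelian_group "cohom Z V"
    by (rule abelian_group_cohom)
  note p = UP_leading_coefficient[OF abelian_group_cohom \<kappa>_carrier[OF even] l(1), of m]
  have p_deg: "coeff ?U ?p j = \<zero>\<^bsub>cohom Z V\<^esub>" if "Suc m \<le> j" for j
    using that unfolding p(2) by (simp add: l(2))
  obtain f where f: "\<And>i. f i \<in> cocycles Z V" "\<And>i. coeff ?U ?p i = cohom_class Z V (f i)"
    "kunneth Z \<tau> V ?p = cohom_class Z.BX Z.S (Z.poly f (Suc m))"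
    using Z.kunneth_class[OF p(1) p_deg] by blast
  have "coeff ?U ?p m = \<kappa> ?a"
    unfolding p(2) by (simp add: l(2) \<kappa>_carrier[OF even])
  then have x: "\<kappa> ?a = cohom_class Z V (f m)"
    using f(2) by simp
  have "r z + Z.poly f (Suc m) \<in> coboundaries Z.BX Z.S"
    using l(3) unfolding z(3) r_map_class f(3) by (simp add: cohom_class_eq_iff)
  \<comment> \<open>The top term of \<open>Z.poly f (Suc m)\<close> is split off.\<close>
  then have "(r z + cup Z.BX (Z.P (f m)) (Z.W m)) + Z.poly f m \<in> coboundaries Z.BX Z.S"
    by (simp add: Z.poly_def ac_simps)
  then have "r z + cup Z.BX (Z.P (f m)) (Z.W m) \<in> Z.L m"
    by (rule Z.L_I[OF f(1)])
  then show ?thesis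
    using that f(1) x z rho by blast
qed

text \<open>The vanishing statement one step below is an assumption, so that the lemma serves inside
  the induction for \<open>coboundary_if_r\<close> and again after it.\<close>

lemma coboundary_if_rho_and_r:
  assumes IH: "\<And>k D. \<lbrakk>n = Suc k; D \<in> cocycles BX S; homogeneous (2 * k) D; r D \<in> Z.L k\<rbrakk> \<Longrightarrow> D \<in> coboundaries BX S"
    and D: "D \<in> cocycles BX S" "homogeneous (2 * n) D" "rho D \<in> coboundaries X Y" "r D \<in> Z.L (Suc n)"
  shows "D \<in> coboundaries BX S"
proof (cases n)
  case 0
  then show ?thesis
    using rho_injective_degree_0[OF D(1,3)] D(2) by simp
next
  case (Suc k)
  obtain D1 where D1: "D1 \<in> cocycles BX S" "homogeneous (Suc (2 * k)) D1" "D + cup BX D1 w \<in> coboundaries BX S"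
    using divide_by_w[OF D(1,3), of "Suc (2 * k)"] D(2) Suc by auto
  \<comment> \<open>The first quotient has odd degree, where the cohomology of (X, Y) vanishes, so
    it can be divided once more.\<close>
  have "rho D1 \<in> coboundaries X Y"
    by (rule odd_coboundary[OF rho_cocycles[OF D1(1)] rho_homogeneous[OF D1(2)]]) simp
  then obtain D2 where D2: "D2 \<in> cocycles BX S" "homogeneous (2 * k) D2" "D1 + cup BX D2 w \<in> coboundaries BX S"
    using divide_by_w[OF D1(1) _ D1(2)] by blast
  have "cup BX (D1 + cup BX D2 w) w \<in> coboundaries BX S"
    using D2(3) by (rule coboundaries_cup_left) simp
  then have "(D + cup BX D1 w) + cup BX (D1 + cup BX D2 w) w \<in> coboundaries BX S"
    by (rule coboundaries_add[OF D1(3)])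
  then have D_eq: "D + cup BX (cup BX D2 w) w \<in> coboundaries BX S"
    by (simp add: cup_add_left add.assoc)
  have "r D + cup Z.BX (cup Z.BX (r D2) Z.w) Z.w \<in> coboundaries Z.BX Z.S"
    using r_coboundaries[OF D_eq] by (simp add: r_add r_cup r_w)
  \<comment> \<open>As n + 1 = k + 2, cancelling the two factors leaves exactly the bound k required
    by \<open>IH\<close>.\<close>
  then have "cup Z.BX (cup Z.BX (r D2) Z.w) Z.w \<in> Z.L (Suc (Suc k))"
    by (rule Z.L_cong[OF D(4)[unfolded Suc]])
  then have "cup Z.BX (r D2) Z.w \<in> Z.L (Suc k)"
    by (rule Z.L_cancel[rotated]) (intro cocycles_cup_left r_cocycles D2 Z.w_cocycle_BX)
  then have "r D2 \<in> Z.L k"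
    by (rule Z.L_cancel[OF r_cocycles[OF D2(1)]])
  then have "D2 \<in> coboundaries BX S"
    using IH[OF Suc D2(1,2)] by blast
  then have "cup BX (cup BX D2 w) w \<in> coboundaries BX S"
    by (intro coboundaries_cup_left) simp_all
  with D_eq have "D + cup BX (cup BX D2 w) w + cup BX (cup BX D2 w) w \<in> coboundaries BX S"
    by (rule coboundaries_add)
  then show ?thesis
    by (simp add: add.assoc)
qed

text \<open>D is compared with a representative z of \<open>\<sigma>\<close> at its restriction to
  the fibre. They turn out to be cohomologous, so z has no term in u^n; this term carries the value
  of \<open>\<kappa>\<close>, whence the restriction of D is zero and z bounds.\<close>

lemma coboundary_if_r:
  assumes "D \<in> cocycles BX S" "homogeneous (2 * n) D" "r D \<in> Z.L n"
  shows "D \<in> coboundaries BX S"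
  using assms
proof (induction n arbitrary: D rule: less_induct)
  case (less n)
  obtain x z where xz: "x \<in> cocycles Z V" "\<kappa> (cohom_class X Y (rho D)) = cohom_class Z V x"
    "z \<in> cocycles BX S" "homogeneous (2 * n) z" "\<sigma> (cohom_class X Y (rho D)) = cohom_class BX S z"
    "rho z + rho D \<in> coboundaries X Y" "r z + cup Z.BX (Z.P x) (Z.W n) \<in> Z.L n"
    using frame_representatives[OF rho_cocycles[OF less.prems(1)] rho_homogeneous[OF less.prems(2)]] by blast
  let ?m = "cup Z.BX (Z.P x) (Z.W n)"
  have "(r z + ?m) + ?m \<in> Z.L (Suc n)"
    by (rule Z.L_add) (use Z.L_mono[OF xz(7)] Z.L_monomial[OF xz(1)] in auto)
  then have "r z \<in> Z.L (Suc n)"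
    by (simp add: add.assoc)
  then have "r (z + D) \<in> Z.L (Suc n)"
    unfolding r_add using Z.L_mono[OF less.prems(3), of "Suc n"] by (intro Z.L_add) auto
  \<comment> \<open>The sum restricts to a coboundary on the fibre because \<open>\<sigma>\<close>
    is a section.\<close>
  then have zD: "z + D \<in> coboundaries BX S"
    using less.IH xz less.prems
    by (intro coboundary_if_rho_and_r[of n "z + D"]) (auto simp: rho_add)
  have "(r z + ?m) + r (z + D) + r D \<in> Z.L n"
    using xz(7) Z.coboundaries_L[OF r_coboundaries[OF zD]] less.prems(3) by (rule Z.L_add[OF Z.L_add])
  also have "(r z + ?m) + r (z + D) + r D = ?m + (r z + r z) + (r D + r D)"
    unfolding r_add by (simp only: ac_simps)
  \<comment> \<open>The monomial differs from \<open>r z\<close> and hence from \<open>r D\<close>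
    by terms of lower degree, and \<open>r D\<close> itself has bound n.\<close>
  finally have "?m \<in> Z.L n"
    by (simp only: cochain_add_self add_0_right)
  then have "x \<in> coboundaries Z V"
    by (rule Z.L_leading_coefficient[OF xz(1)])
  then have eq: "\<kappa> (cohom_class X Y (rho D)) = \<kappa> (cohom_class X Y 0)"
    unfolding xz(2) \<kappa>_zero by (simp add: cohom_class_eq_iff)
  have "rho D \<in> even_cocycles X Y"
    using even_cocycles_homogeneous[OF rho_cocycles[OF less.prems(1)] rho_homogeneous[OF less.prems(2)]] .
  then have "cohom_class X Y (rho D) = cohom_class X Y 0"
    by (intro inj_onD[OF \<kappa>_inj eq]) (simp_all add: carrier_cohom_even' even_cocycles_zero)
  then have "cohom_class BX S z = cohom_class BX S 0"
    using xz(5) \<sigma>_zero by simp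
  then have "z \<in> coboundaries BX S"
    by (simp add: cohom_class_eq_iff)
  then have "z + (z + D) \<in> coboundaries BX S"
    using zD by (rule coboundaries_add)
  then show ?case
    by simp
qed

text \<open>The two claims are linked: the one for \<open>\<sigma>\<close> comes first, from a weak
  bound on its defect, and it then sharpens this bound to the claim for
  \<open>\<kappa>\<close>.\<close>

lemma multiplicative_homogeneous:
  assumes a: "a \<in> cocycles X Y" "homogeneous (2 * m) a" and b: "b \<in> cocycles X Y" "homogeneous (2 * k) b"
  shows "\<kappa> (cohom_class X Y (cup X a b)) = \<kappa> (cohom_class X Y a) \<otimes>\<^bsub>cohom Z V\<^esub> \<kappa> (cohom_class X Y b)"
    and "\<sigma> (cohom_class X Y (cup X a b)) = \<sigma> (cohom_class X Y a) \<otimes>\<^bsub>cohom BX S\<^esub> \<sigma> (cohom_class X Y b)"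
proof -
  let ?n = "m + k" and ?ab = "cup X a b"
  have ab: "?ab \<in> cocycles X Y" "homogeneous (2 * ?n) ?ab"
    using cocycles_cup[OF a(1) b(1)] homogeneous_cup[OF a(2) b(2)] by (simp_all add: algebra_simps)
  obtain x z where x: "x \<in> cocycles Z V" "\<kappa> (cohom_class X Y a) = cohom_class Z V x"
    and z: "z \<in> cocycles BX S" "homogeneous (2 * m) z" "\<sigma> (cohom_class X Y a) = cohom_class BX S z"
    "rho z + a \<in> coboundaries X Y" "r z + cup Z.BX (Z.P x) (Z.W m) \<in> Z.L m"
    using frame_representatives[OF a] by blast
  obtain x' z' where x': "x' \<in> cocycles Z V" "\<kappa> (cohom_class X Y b) = cohom_class Z V x'"
    and z': "z' \<in> cocycles BX S" "homogeneous (2 * k) z'" "\<sigma> (cohom_class X Y b) = cohom_class BX S z'"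
    "rho z' + b \<in> coboundaries X Y" "r z' + cup Z.BX (Z.P x') (Z.W k) \<in> Z.L k"
    using frame_representatives[OF b] by blast
  obtain v y where v: "v \<in> cocycles Z V" "\<kappa> (cohom_class X Y ?ab) = cohom_class Z V v"
    and y: "y \<in> cocycles BX S" "homogeneous (2 * ?n) y" "\<sigma> (cohom_class X Y ?ab) = cohom_class BX S y"
    "rho y + ?ab \<in> coboundaries X Y" "r y + cup Z.BX (Z.P v) (Z.W ?n) \<in> Z.L ?n"
    using frame_representatives[OF ab] by blast
  let ?D = "y + cup BX z z'"
  let ?v = "cup Z.BX (Z.P v) (Z.W ?n)" and ?xx = "cup Z.BX (Z.P (cup Z x x')) (Z.W ?n)"
  have zz: "cup BX z z' \<in> cocycles BX S" "homogeneous (2 * ?n) (cup BX z z')"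
    using cocycles_cup[OF z(1) z'(1)] homogeneous_cup[OF z(2) z'(2)] by (simp_all add: algebra_simps)
  have xx: "cup Z x x' \<in> cocycles Z V"
    using x x' by (intro cocycles_cup)
  have prod: "cup Z.BX (r z) (r z') + ?xx \<in> Z.L ?n"
    by (rule Z.L_mult_leading[OF x(1) r_cocycles[OF z(1)] z(5) x'(1) r_cocycles[OF z'(1)] z'(5)])
  have sum: "(r y + ?v) + (cup Z.BX (r z) (r z') + ?xx) \<in> Z.L ?n"
    using y(5) prod by (rule Z.L_add)
  \<comment> \<open>The leading terms \<open>?v\<close> and \<open>?xx\<close> are not yet known to
    agree, so both are added back and the bound is \<open>Suc ?n\<close> instead of
    \<open>?n\<close>.\<close>
  have "(r y + ?v) + (cup Z.BX (r z) (r z') + ?xx) + (?v + ?xx) \<in> Z.L (Suc ?n)"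
    by (rule Z.L_add[OF Z.L_mono[OF sum] Z.L_add[OF Z.L_monomial[OF v(1)] Z.L_monomial[OF xx]]]) simp_all
  also have "(r y + ?v) + (cup Z.BX (r z) (r z') + ?xx) + (?v + ?xx) = r ?D + (?v + ?v) + (?xx + ?xx)"
    unfolding r_add r_cup by (simp only: ac_simps)
  finally have rD: "r ?D \<in> Z.L (Suc ?n)"
    by (simp only: cochain_add_self add_0_right)
  have "cup X (rho z) (rho z') + cup X a b \<in> coboundaries X Y"
    using z z' a b by (intro cup_cong_coboundaries rho_cocycles)
  then have "(rho y + ?ab) + (cup X (rho z) (rho z') + cup X a b) \<in> coboundaries X Y"
    using y(4) by (intro coboundaries_add[of "rho y + ?ab"])
  also have "(rho y + ?ab) + (cup X (rho z) (rho z') + cup X a b) = rho ?D + (?ab + ?ab)"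
    unfolding rho_add rho_cup by (simp only: ac_simps)
  finally have rhoD: "rho ?D \<in> coboundaries X Y"
    by (simp only: cochain_add_self add_0_right)
  have D: "?D \<in> coboundaries BX S"
    by (rule coboundary_if_rho_and_r[OF coboundary_if_r cocycles_add[OF y(1) zz(1)]
          homogeneous_add[OF y(2) zz(2)] rhoD rD])
  then show "\<sigma> (cohom_class X Y ?ab) = \<sigma> (cohom_class X Y a) \<otimes>\<^bsub>cohom BX S\<^esub> \<sigma> (cohom_class X Y b)"
    using z z' by (simp add: y(3) cohom_mult cohom_class_eq_iff)
  have "(r y + ?v) + (cup Z.BX (r z) (r z') + ?xx) + r ?D \<in> Z.L ?n"
    by (rule Z.L_add[OF sum Z.coboundaries_L[OF r_coboundaries[OF D]]])
  also have "(r y + ?v) + (cup Z.BX (r z) (r z') + ?xx) + r ?D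
      = ?v + ?xx + (r y + r y) + (cup Z.BX (r z) (r z') + cup Z.BX (r z) (r z'))"
    unfolding r_add r_cup by (simp only: ac_simps)
  \<comment> \<open>Once the defect bounds, the difference of the leading terms must itself lie in
    lower degree, and \<open>Z.L_leading_coefficient\<close> applies.\<close>
  finally have "cup Z.BX (Z.P (v + cup Z x x')) (Z.W ?n) \<in> Z.L ?n"
    by (simp only: cochain_add_self add_0_right Z.P_add cup_add_left)
  then have "v + cup Z x x' \<in> coboundaries Z V"
    by (rule Z.L_leading_coefficient[OF cocycles_add[OF v(1) xx]])
  then show "\<kappa> (cohom_class X Y ?ab) = \<kappa> (cohom_class X Y a) \<otimes>\<^bsub>cohom Z V\<^esub> \<kappa> (cohom_class X Y b)"
    using x x' by (simp add: v(2) cohom_mult cohom_class_eq_iff)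
qed

lemma \<kappa>_rng_hom: "\<kappa> \<in> rng_hom (cohom_even X Y) (cohom Z V)"
proof -
  have "\<kappa> (cohom_class X Y (cup X c d)) = \<kappa> (cohom_class X Y c) \<otimes>\<^bsub>cohom Z V\<^esub> \<kappa> (cohom_class X Y d)"
    if "c \<in> even_cocycles X Y" "d \<in> even_cocycles X Y" for c d
    by (rule multiplicative_if_multiplicative_on_homogeneous[OF \<kappa>_carrier \<kappa>_add multiplicative_homogeneous(1) that])
  then show ?thesis
    using \<kappa>_hom
    by (auto simp: rng_hom_def hom_def carrier_cohom_even' cohom_even_simps cohom_mult even_cocyclesD)
qed

lemma \<sigma>_rng_hom: "\<sigma> \<in> rng_hom (cohom_even X Y) (cohom_even BX S)"
proof -
  have "\<sigma> (cohom_class X Y (cup X c d)) = \<sigma> (cohom_class X Y c) \<otimes>\<^bsub>cohom BX S\<^esub> \<sigma> (cohom_class X Y d)"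
    if "c \<in> even_cocycles X Y" "d \<in> even_cocycles X Y" for c d
    by (rule multiplicative_if_multiplicative_on_homogeneous[OF \<sigma>_carrier' \<sigma>_add multiplicative_homogeneous(2) that])
  then show ?thesis
    using \<sigma>_hom
    by (auto simp: rng_hom_def hom_def carrier_cohom_even' cohom_even_simps cohom_mult even_cocyclesD)
qed

text \<open>In degree 0 the conjugation equation has no lower terms, and a cocycle is determined by
  its restriction to the fibre. So the representative of the value under \<open>\<sigma>\<close> is
  the unit cochain, and the constant polynomial it restricts to is the value under
  \<open>\<kappa>\<close>.\<close>

lemma unit_preserved:
  assumes "Y = {}"
  shows "\<kappa> \<one>\<^bsub>cohom_even X Y\<^esub> = \<one>\<^bsub>cohom Z V\<^esub>" and "\<sigma> \<one>\<^bsub>cohom_even X Y\<^esub> = \<one>\<^bsub>cohom_even BX S\<^esub>"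
proof -
  have S: "S = {}" "V = {}" "Z.S = {}"
    using assms by (auto simp: borel_subset_def)
  have one: "one_cochain X \<in> cocycles X Y"
    using assms by simp
  obtain x z where x: "x \<in> cocycles Z V" "\<kappa> (cohom_class X Y (one_cochain X)) = cohom_class Z V x"
    and z: "z \<in> cocycles BX S" "homogeneous (2 * 0) z" "\<sigma> (cohom_class X Y (one_cochain X)) = cohom_class BX S z"
    "rho z + one_cochain X \<in> coboundaries X Y" "r z + cup Z.BX (Z.P x) (Z.W 0) \<in> Z.L 0"
    by (rule frame_representatives[OF one, of 0]) simp_all
  have "z + one_cochain BX = 0"
    using z by (intro rho_injective_degree_0) (simp_all add: S rho_add rho_one)
  then have z_eq: "z = one_cochain BX"
    by (simp add: cochain_add_eq_0_iff)
  then show "\<sigma> \<one>\<^bsub>cohom_even X Y\<^esub> = \<one>\<^bsub>cohom_even BX S\<^esub>"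
    using z(3) assms S by (simp add: cohom_even_simps cohom_one)
  have x': "x + one_cochain Z \<in> cocycles Z V"
    using x(1) by (intro cocycles_add) (simp_all add: S)
  have "Z.P x \<in> cochains Z.BX {}"
    using Z.P_cocycles[OF x(1)] cocycles_cochains cochains_absolute by blast
  then have "Z.P (x + one_cochain Z) \<in> coboundaries Z.BX Z.S"
    using Z.L_0[OF z(5)] by (simp add: z_eq r_one cup_one_right Z.P_add Z.P_one add.commute)
  then have "x + one_cochain Z \<in> coboundaries Z V"
    using Z.rho_coboundaries Z.rho_P[OF cocycles_cochains[OF x']] by metis
  then show "\<kappa> \<one>\<^bsub>cohom_even X Y\<^esub> = \<one>\<^bsub>cohom Z V\<^esub>"
    using x(2) assms by (simp add: cohom_even_simps cohom_one cohom_class_eq_iff)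
qed

end

lemma ring_hom_if_rng_hom: "\<lbrakk>h \<in> rng_hom R S; h \<one>\<^bsub>R\<^esub> = \<one>\<^bsub>S\<^esub>\<rbrakk> \<Longrightarrow> h \<in> ring_hom R S"
  by (auto simp: rng_hom_def ring_hom_def hom_def)

theorem theorem3p3:
  fixes X :: "'a topology" and \<tau> :: "'a \<Rightarrow> 'a" and Y :: "'a set"
    and \<kappa> :: "'a cochain set \<Rightarrow> 'a cochain set"
    and \<sigma> :: "'a cochain set \<Rightarrow> ((nat \<Rightarrow> real) \<times> 'a) set cochain set"
  assumes "involution X \<tau>"
    and "Y \<subseteq> topspace X" and "\<tau> ` Y = Y"
    and "\<And>n. odd n \<Longrightarrow> cohom_deg X Y n = {\<zero>\<^bsub>cohom X Y\<^esub>}"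
    and "H_frame X \<tau> Y \<kappa> \<sigma>"
  shows "\<kappa> \<in> rng_hom (cohom_even X Y) (fixed_cohom X \<tau> Y)
       \<and> \<sigma> \<in> rng_hom (cohom_even X Y) (equiv_cohom_even X \<tau> Y)
       \<and> (Y = {} \<longrightarrow> \<kappa> \<in> ring_hom (cohom_even X Y) (fixed_cohom X \<tau> Y)
                 \<and> \<sigma> \<in> ring_hom (cohom_even X Y) (equiv_cohom_even X \<tau> Y))"
proof -
  interpret conjugation_frame X \<tau> Y \<kappa> \<sigma>
    by unfold_locales (use assms in auto)
  show ?thesis
  proof (intro conjI impI)
    assume "Y = {}"
    then show "\<kappa> \<in> ring_hom (cohom_even X Y) (fixed_cohom X \<tau> Y)"
      "\<sigma> \<in> ring_hom (cohom_even X Y) (equiv_cohom_even X \<tau> Y)"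
      using ring_hom_if_rng_hom[OF \<kappa>_rng_hom] ring_hom_if_rng_hom[OF \<sigma>_rng_hom] unit_preserved by auto
  qed (rule \<kappa>_rng_hom \<sigma>_rng_hom)+
qed

end
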